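(* Let $\mathfrak g$ be a symmetrizable Kac--Moody algebra whose Yangian $Y(\mathfrak g)$ satisfies conditions (A) and (B) given in the context, and let $\widehat Y(\mathfrak g)=\prod_{k=0}^\infty Y(\mathfrak g)[k]$. For $X^\circ=\sum_{k\ge0}X_k^\circ$ and $X^\bullet=\sum_{\ell\ge0}X_\ell^\bullet$ in $\widehat Y(\mathfrak g)$ (with $X_k^\circ\in Y(\mathfrak g)[k]$, $X^\bullet_\ell\in Y(\mathfrak g)[\ell]$) put $$X^\circ\cdot X^\bullet=\sum_{m=0}^\infty (X^\circ X^\bullet)_m,\qquad (X^\circ X^\bullet)_m=\sum_{k,\ell=0}^\infty (X_k^\circ X_\ell^\bullet)_m,$$ where $(X_k^\circ X_\ell^\bullet)_m$ is the component in $Y(\mathfrak g)[m]$ of the product $X_k^\circ X_\ell^\bullet\in Y(\mathfrak g)$. Then this operation is well defined (for each $m$ only finitely many of the terms $(X_k^\circ X_\ell^\bullet)_m$ are nonzero) and it equips $\widehat Y(\mathfrak g)$ with the structure of an associative algebra.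
   Context: All algebras are associative unital over $\mathbb C$, and $[a,b]=ab-ba$. Let $\mathfrak g$ be a symmetrizable Kac--Moody algebra over $\mathbb C$ with Cartan matrix $(a_{ij})_{i,j\in I}$, not necessarily indecomposable (with no component of type $A_1^{(1)}$), Cartan subalgebra $\mathfrak h$, simple roots $\alpha_i$, simple coroots $\alpha_i^\vee$, and standard nondegenerate invariant symmetric form $(\cdot,\cdot)$ (so $(\alpha_i,\alpha_i)>0$, $a_{ij}=2(\alpha_i,\alpha_j)/(\alpha_i,\alpha_i)$). The Yangian $Y(\mathfrak g)$ (parameter $\hbar=1$) is generated by $x_{ir}^{\pm},h_{ir}$ ($i\in I$, $r\in\mathbb Z_{\ge0}$) and the (commuting) vector space $\mathfrak h$, with relations for all $i,j\in I$, $r,s\ge0$, $h\in\mathfrak h$: (i) $[h_{ir},h_{js}]=0$; (ii) $[h_{i0},x_{js}^{\pm}]=\pm(\alpha_i,\alpha_j)x_{js}^{\pm}$; (iii) $[x_{ir}^{+},x_{js}^{-}]=\delta_{ij}h_{i,r+s}$; (iv) $[h_{i,r+1},x_{js}^{\pm}]-[h_{ir},x_{j,s+1}^{\pm}]=\pm\frac{(\alpha_i,\alpha_j)}2(h_{ir}x_{js}^{\pm}+x_{js}^{\pm}h_{ir})$; (v) $[x_{i,r+1}^{\pm},x_{js}^{\pm}]-[x_{ir}^{\pm},x_{j,s+1}^{\pm}]=\pm\frac{(\alpha_i,\alpha_j)}2(x_{ir}^{\pm}x_{js}^{\pm}+x_{js}^{\pm}x_{ir}^{\pm})$; (vi) for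 $i\ne j$, $b=1-a_{ij}$: $\sum_{\sigma\in S_b}[x_{ir_{\sigma(1)}}^{\pm},[x_{ir_{\sigma(2)}}^{\pm},\cdots,[x_{ir_{\sigma(b)}}^{\pm},x_{js}^{\pm}]\cdots]]=0$; (vii) $h_{i0}=\frac{(\alpha_i,\alpha_i)}2\alpha_i^\vee$, $[h,h_{ir}]=0$, $[h,x_{ir}^{\pm}]=\pm\langle\alpha_i,h\rangle x_{ir}^{\pm}$. Let $Y^\pm$ be the subalgebra generated by all $x_{ir}^\pm$, $Y^0$ the subalgebra generated by all $h_{ir}$ and $\mathfrak h$, and $Y^{\le0}$ the subalgebra generated by all $x_{ir}^-$, $h_{ir}$ and $\mathfrak h$. Conditions: (A) multiplication gives a vector space isomorphism $Y^-\otimes Y^0\otimes Y^+\cong Y(\mathfrak g)$; (B) $Y^\pm$ is isomorphic to the quotient of the free algebra on the $x_{ir}^\pm$ ($i\in I$, $r\ge0$) by the ideal corresponding to relations (v) and (vi). By (B), $Y^+=\bigoplus_{k\ge0}Y^+[k]$ is graded as an algebra with $\deg x_{ir}^+=1$. Set $Y(\mathfrak g)[k]=Y^{\le0}\otimes Y^+[k]$ (i.e. $Y^{\le 0}\cdot Y^+[k]$); then $Y(\mathfrak g)=\bigoplus_{k\ge0}Y(\mathfrak g)[k]$ as a vector space (not an algebra grading). Elements of $\widehat Y(\mathfrak g)=\prod_{k\ge 0} Y(\mathfrak g)[k]$ are written as infinite series $\sum_{k\ge0}X_k$ with $X_k\in Y(\mathfrak g)[k]$. *)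

theory Defs
  imports
    "HOL-Library.Poly_Mapping"
    "HOL-Combinatorics.Permutations"
    "HOL-Analysis.Cartesian_Space"
    "HOL-Algebra.QuotRing"
    "HOL-Algebra.Subrings"
    "HOL-Algebra.Module"
    "HOL-Algebra.Algebraic_Closure_Type"
begin

section \<open>Associative unital algebras over the complex numbers\<close>

text \<open>
  Algebras are module records over the field of complex numbers.  The locale
  \<^locale>\<open>algebra\<close> of the library requires commutativity and hence cannot be used here.
\<close>

abbreviation complex_field :: "complex ring" where
  "complex_field \<equiv> ring_of_type_algebra"

locale complex_algebra = ring A + module complex_field A
  for A :: "(complex, 'a) module" (structure) +
  assumes smult_mult_left:
      "\<lbrakk>x \<in> carrier A; y \<in> carrier A\<rbrakk> \<Longrightarrow> (c \<odot>\<^bsub>A\<^esub> x) \<otimes>\<^bsub>A\<^esub> y = c \<odot>\<^bsub>A\<^esub> (x \<otimes>\<^bsub>A\<^esub> y)"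
    and smult_mult_right:
      "\<lbrakk>x \<in> carrier A; y \<in> carrier A\<rbrakk> \<Longrightarrow> x \<otimes>\<^bsub>A\<^esub> (c \<odot>\<^bsub>A\<^esub> y) = c \<odot>\<^bsub>A\<^esub> (x \<otimes>\<^bsub>A\<^esub> y)"

definition linear_span :: "(complex, 'a) module \<Rightarrow> 'a set \<Rightarrow> 'a set" where
  "linear_span A S = \<Inter>{N. submodule N complex_field A \<and> S \<subseteq> N}"

definition subalgebra_generated :: "(complex, 'a) module \<Rightarrow> 'a set \<Rightarrow> 'a set" where
  "subalgebra_generated A S = \<Inter>{B. subring B A \<and> submodule B complex_field A \<and> S \<subseteq> B}"

definition quotient_algebra :: "(complex, 'a) module \<Rightarrow> 'a set \<Rightarrow> (complex, 'a set) module" where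
  "quotient_algebra A J = ring.extend (A Quot J)
     (module.fields (\<lambda>c S. \<Union>x\<in>S. J +>\<^bsub>A\<^esub> (c \<odot>\<^bsub>A\<^esub> x)))"

definition algebra_iso :: "(complex, 'a) module \<Rightarrow> (complex, 'b) module \<Rightarrow> ('a \<Rightarrow> 'b) set" where
  "algebra_iso A B = {\<phi> \<in> ring_iso A B. \<forall>c. \<forall>x\<in>carrier A. \<phi> (c \<odot>\<^bsub>A\<^esub> x) = c \<odot>\<^bsub>B\<^esub> \<phi> x}"


section \<open>Free algebras\<close>

text \<open>
  Words under concatenation are the free monoid.  The product of \<^type>\<open>poly_mapping\<close> is the
  convolution product with respect to the operation + of the index type, which therefore is
  concatenation; the empty word is 0.
\<close>

datatype 'g word = Word (letters: "'g list")

instantiation word :: (type) monoid_add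
begin

definition zero_word :: "'a word" where "0 = Word []"

definition plus_word :: "'a word \<Rightarrow> 'a word \<Rightarrow> 'a word" where
  "u + v = Word (letters u @ letters v)"

instance
  by standard (simp_all add: zero_word_def plus_word_def)

end

type_synonym 'g free_alg = "'g word \<Rightarrow>\<^sub>0 complex"

definition fscale :: "complex \<Rightarrow> ('k \<Rightarrow>\<^sub>0 complex) \<Rightarrow> ('k \<Rightarrow>\<^sub>0 complex)"  (infixr \<open>\<cdot>\<^sub>C\<close> 75) where
  "c \<cdot>\<^sub>C p = Poly_Mapping.map ((*) c) p"

definition gen :: "'g \<Rightarrow> 'g free_alg" where
  "gen a = Poly_Mapping.single (Word [a]) 1"

definition free_algebra :: "(complex, 'g free_alg) module" where
  "free_algebra = ring.extend ring_of_type_algebra (module.fields (\<cdot>\<^sub>C))"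

definition presented_algebra :: "'g free_alg set \<Rightarrow> (complex, 'g free_alg set) module" where
  "presented_algebra R = quotient_algebra free_algebra (Idl\<^bsub>free_algebra\<^esub> R)"

definition presented_gen :: "'g free_alg set \<Rightarrow> 'g \<Rightarrow> 'g free_alg set" where
  "presented_gen R a = (Idl\<^bsub>free_algebra\<^esub> R) +>\<^bsub>free_algebra\<^esub> gen a"


section \<open>Symmetrizable Kac--Moody data\<close>

text \<open>
  A Kac--Moody algebra is determined by its Cartan matrix together with a realization: the
  Cartan subalgebra (here the whole type \<^typ>\<open>'h\<close>), the simple roots (linear forms on it) and
  the simple coroots.  The last component is the restriction of the invariant form to the
  Cartan subalgebra.
\<close>

record ('i, 'h) cartan_datum =
  cartan_scale :: "complex \<Rightarrow> 'h \<Rightarrow> 'h"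
  cartan_matrix :: "'i \<Rightarrow> 'i \<Rightarrow> int"
  simple_root :: "'i \<Rightarrow> 'h \<Rightarrow> complex"
  simple_coroot :: "'i \<Rightarrow> 'h"
  cartan_form :: "'h \<Rightarrow> 'h \<Rightarrow> complex"

text \<open>
  The form on the Cartan subalgebra is transported to its dual: a root is represented by the
  vector with which it is identified under the nondegenerate form.
\<close>

definition root_vec :: "('i, 'h) cartan_datum \<Rightarrow> 'i \<Rightarrow> 'h" where
  "root_vec \<gg> i = (THE t. \<forall>h. cartan_form \<gg> t h = simple_root \<gg> i h)"

definition root_form :: "('i, 'h) cartan_datum \<Rightarrow> 'i \<Rightarrow> 'i \<Rightarrow> complex" where
  "root_form \<gg> i j = cartan_form \<gg> (root_vec \<gg> i) (root_vec \<gg> j)"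

text \<open>
  For a nondegenerate symmetric form on the Cartan subalgebra, being the restriction of an
  invariant form on the Kac--Moody algebra is the condition \<open>form_coroot\<close>
  (apply invariance to the brackets of Chevalley generators \<open>e\<^sub>i\<close>, \<open>f\<^sub>i\<close>).
  Together with \<open>root_coroot\<close> it gives the usual expression of the Cartan matrix
  through the form on the roots.
\<close>

locale symmetrizable_kac_moody = vector_space "cartan_scale \<gg>"
  for \<gg> :: "('i::finite, 'h::ab_group_add) cartan_datum" +
  assumes cartan_diag: "cartan_matrix \<gg> i i = 2"
    and cartan_off_diag: "i \<noteq> j \<Longrightarrow> cartan_matrix \<gg> i j \<le> 0"
    and cartan_zero: "cartan_matrix \<gg> i j = 0 \<Longrightarrow> cartan_matrix \<gg> j i = 0"
    and root_linear: "Vector_Spaces.linear (cartan_scale \<gg>) (*) (simple_root \<gg> i)"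
    and root_coroot: "simple_root \<gg> j (simple_coroot \<gg> i) = of_int (cartan_matrix \<gg> i j)"
    and roots_independent:
      "(\<And>h. (\<Sum>k\<in>UNIV. c k * simple_root \<gg> k h) = 0) \<Longrightarrow> c i = 0"
    and coroots_independent:
      "(\<Sum>k\<in>UNIV. cartan_scale \<gg> (c k) (simple_coroot \<gg> k)) = 0 \<Longrightarrow> c i = 0"
    and cartan_dim:
      "vector_space.dim (cartan_scale \<gg>) (UNIV :: 'h set) =
         2 * CARD('i) - rank ((\<chi> i j. of_int (cartan_matrix \<gg> i j)) :: complex ^ 'i ^ 'i)"
    and form_linear: "Vector_Spaces.linear (cartan_scale \<gg>) (*) (cartan_form \<gg> h)"
    and form_sym: "cartan_form \<gg> h h' = cartan_form \<gg> h' h"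
    and form_nondegenerate: "(\<And>h'. cartan_form \<gg> h h' = 0) \<Longrightarrow> h = 0"
    and root_form_positive: "root_form \<gg> i i \<in> \<real>" "0 < Re (root_form \<gg> i i)"
    and form_coroot:
      "cartan_form \<gg> (simple_coroot \<gg> i) h = 2 / root_form \<gg> i i * simple_root \<gg> i h"

definition has_A1_1_component :: "('i, 'h) cartan_datum \<Rightarrow> bool" where
  "has_A1_1_component \<gg> \<longleftrightarrow>
     (\<exists>i j. i \<noteq> j \<and> cartan_matrix \<gg> i j = - 2 \<and> cartan_matrix \<gg> j i = - 2 \<and>
       (\<forall>k. k \<notin> {i, j} \<longrightarrow> cartan_matrix \<gg> i k = 0 \<and> cartan_matrix \<gg> j k = 0))"


section \<open>The Yangian\<close>

datatype pm = Plus | Minus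

fun sgn_pm :: "pm \<Rightarrow> complex" where
  "sgn_pm Plus = 1"
| "sgn_pm Minus = - 1"

datatype ('i, 'h) yangian_gen = XG pm 'i nat | HG 'i nat | CG 'h

definition commutator :: "'a::ring \<Rightarrow> 'a \<Rightarrow> 'a" where
  "commutator a b = a * b - b * a"

text \<open>
  The common shape of the relations between \<open>u r = h\<^sub>i\<^sub>r\<close> (or \<open>u r = x\<^sub>i\<^sub>r\<close>) and \<open>v s = x\<^sub>j\<^sub>s\<close>;
  \<open>c\<close> is the signed value of the form on the two simple roots.
\<close>

definition shift_relator ::
    "complex \<Rightarrow> (nat \<Rightarrow> 'g free_alg) \<Rightarrow> (nat \<Rightarrow> 'g free_alg) \<Rightarrow> nat \<Rightarrow> nat \<Rightarrow> 'g free_alg" where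
  "shift_relator c u v r s =
     commutator (u (r + 1)) (v s) - commutator (u r) (v (s + 1))
       - (c / 2) \<cdot>\<^sub>C (u r * v s + v s * u r)"

definition serre_relator ::
    "nat \<Rightarrow> (nat \<Rightarrow> 'g free_alg) \<Rightarrow> 'g free_alg \<Rightarrow> (nat \<Rightarrow> nat) \<Rightarrow> 'g free_alg" where
  "serre_relator b u y r =
     (\<Sum>\<sigma> | \<sigma> permutes {..<b}. foldr (\<lambda>k z. commutator (u (r (\<sigma> k))) z) [0..<b] y)"

text \<open>
  The relations that involve only the \<open>x\<^sub>i\<^sub>r\<close> of one sign, for a family \<open>x\<close> in an arbitrary free
  algebra: they are used both for the Yangian and for the presentation of its halves.
\<close>

definition half_relators ::
    "('i, 'h) cartan_datum \<Rightarrow> pm \<Rightarrow> ('i \<Rightarrow> nat \<Rightarrow> 'g free_alg) \<Rightarrow> 'g free_alg set" where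
  "half_relators \<gg> \<epsilon> x =
     {shift_relator (sgn_pm \<epsilon> * root_form \<gg> i j) (x i) (x j) r s | i j r s. True} \<union>
     {serre_relator (nat (1 - cartan_matrix \<gg> i j)) (x i) (x j s) r | i j r s. i \<noteq> j}"

definition yangian_relators ::
    "('i, 'h::ab_group_add) cartan_datum \<Rightarrow> ('i, 'h) yangian_gen free_alg set" where
  "yangian_relators \<gg> =
    (let x = (\<lambda>\<epsilon> i r. gen (XG \<epsilon> i r)); h = (\<lambda>i r. gen (HG i r)); \<kappa> = (\<lambda>t. gen (CG t)) in
     {\<kappa> (t + t') - \<kappa> t - \<kappa> t' | t t'. True} \<union>
     {\<kappa> (cartan_scale \<gg> c t) - c \<cdot>\<^sub>C \<kappa> t | c t. True} \<union>
     {commutator (\<kappa> t) (\<kappa> t') | t t'. True} \<union>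
     {commutator (h i r) (h j s) | i j r s. True} \<union>
     {commutator (h i 0) (x \<epsilon> j s) - (sgn_pm \<epsilon> * root_form \<gg> i j) \<cdot>\<^sub>C x \<epsilon> j s
        | \<epsilon> i j s. True} \<union>
     {commutator (x Plus i r) (x Minus j s) - (if i = j then h i (r + s) else 0)
        | i j r s. True} \<union>
     {shift_relator (sgn_pm \<epsilon> * root_form \<gg> i j) (h i) (x \<epsilon> j) r s | \<epsilon> i j r s. True} \<union>
     half_relators \<gg> Plus (x Plus) \<union> half_relators \<gg> Minus (x Minus) \<union>
     {h i 0 - (root_form \<gg> i i / 2) \<cdot>\<^sub>C \<kappa> (simple_coroot \<gg> i) | i. True} \<union>
     {commutator (\<kappa> t) (h i r) | t i r. True} \<union>
     {commutator (\<kappa> t) (x \<epsilon> i r) - (sgn_pm \<epsilon> * simple_root \<gg> i t) \<cdot>\<^sub>C x \<epsilon> i r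
        | t \<epsilon> i r. True})"

type_synonym ('i, 'h) yangian_elem = "('i, 'h) yangian_gen free_alg set"

definition yangian ::
    "('i, 'h::ab_group_add) cartan_datum \<Rightarrow> (complex, ('i, 'h) yangian_elem) module" where
  "yangian \<gg> = presented_algebra (yangian_relators \<gg>)"

definition yx :: "('i, 'h::ab_group_add) cartan_datum \<Rightarrow> pm \<Rightarrow> 'i \<Rightarrow> nat \<Rightarrow> ('i, 'h) yangian_elem" where
  "yx \<gg> \<epsilon> i r = presented_gen (yangian_relators \<gg>) (XG \<epsilon> i r)"

definition yh :: "('i, 'h::ab_group_add) cartan_datum \<Rightarrow> 'i \<Rightarrow> nat \<Rightarrow> ('i, 'h) yangian_elem" where
  "yh \<gg> i r = presented_gen (yangian_relators \<gg>) (HG i r)"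

definition yc :: "('i, 'h::ab_group_add) cartan_datum \<Rightarrow> 'h \<Rightarrow> ('i, 'h) yangian_elem" where
  "yc \<gg> t = presented_gen (yangian_relators \<gg>) (CG t)"

definition Y_pm :: "('i, 'h::ab_group_add) cartan_datum \<Rightarrow> pm \<Rightarrow> ('i, 'h) yangian_elem set" where
  "Y_pm \<gg> \<epsilon> = subalgebra_generated (yangian \<gg>) {yx \<gg> \<epsilon> i r | i r. True}"

definition Y_zero :: "('i, 'h::ab_group_add) cartan_datum \<Rightarrow> ('i, 'h) yangian_elem set" where
  "Y_zero \<gg> = subalgebra_generated (yangian \<gg>) ({yh \<gg> i r | i r. True} \<union> range (yc \<gg>))"

definition Y_le_zero :: "('i, 'h::ab_group_add) cartan_datum \<Rightarrow> ('i, 'h) yangian_elem set" where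
  "Y_le_zero \<gg> = subalgebra_generated (yangian \<gg>)
     ({yx \<gg> Minus i r | i r. True} \<union> {yh \<gg> i r | i r. True} \<union> range (yc \<gg>))"


section \<open>Triangular decomposition and presentation of the halves\<close>

text \<open>
  The tensor product of three subspaces of an algebra: the free vector space on triples modulo
  the subspace spanned by the multilinearity relations.
\<close>

definition free_triples :: "'a set \<Rightarrow> 'a set \<Rightarrow> 'a set \<Rightarrow> ('a \<times> 'a \<times> 'a \<Rightarrow>\<^sub>0 complex) set" where
  "free_triples U V W = {p. Poly_Mapping.keys p \<subseteq> U \<times> V \<times> W}"

definition multilinear_relators ::
    "(complex, 'a) module \<Rightarrow> 'a set \<Rightarrow> 'a set \<Rightarrow> 'a set \<Rightarrow> ('a \<times> 'a \<times> 'a \<Rightarrow>\<^sub>0 complex) set" where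
  "multilinear_relators A U V W =
    (let e = (\<lambda>u v w. Poly_Mapping.single (u, v, w) (1::complex)) in
     {e (u \<oplus>\<^bsub>A\<^esub> u') v w - e u v w - e u' v w | u u' v w. u \<in> U \<and> u' \<in> U \<and> v \<in> V \<and> w \<in> W} \<union>
     {e u (v \<oplus>\<^bsub>A\<^esub> v') w - e u v w - e u v' w | u v v' w. u \<in> U \<and> v \<in> V \<and> v' \<in> V \<and> w \<in> W} \<union>
     {e u v (w \<oplus>\<^bsub>A\<^esub> w') - e u v w - e u v w' | u v w w'. u \<in> U \<and> v \<in> V \<and> w \<in> W \<and> w' \<in> W} \<union>
     {e (c \<odot>\<^bsub>A\<^esub> u) v w - c \<cdot>\<^sub>C e u v w | c u v w. u \<in> U \<and> v \<in> V \<and> w \<in> W} \<union>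
     {e u (c \<odot>\<^bsub>A\<^esub> v) w - c \<cdot>\<^sub>C e u v w | c u v w. u \<in> U \<and> v \<in> V \<and> w \<in> W} \<union>
     {e u v (c \<odot>\<^bsub>A\<^esub> w) - c \<cdot>\<^sub>C e u v w | c u v w. u \<in> U \<and> v \<in> V \<and> w \<in> W})"

definition tensor_rel ::
    "(complex, 'a) module \<Rightarrow> 'a set \<Rightarrow> 'a set \<Rightarrow> 'a set \<Rightarrow> ('a \<times> 'a \<times> 'a \<Rightarrow>\<^sub>0 complex) rel" where
  "tensor_rel A U V W =
     {(p, q). p \<in> free_triples U V W \<and> q \<in> free_triples U V W \<and>
        p - q \<in> Modules.module.span (\<cdot>\<^sub>C) (multilinear_relators A U V W)}"

definition tensor3 ::
    "(complex, 'a) module \<Rightarrow> 'a set \<Rightarrow> 'a set \<Rightarrow> 'a set \<Rightarrow> ('a \<times> 'a \<times> 'a \<Rightarrow>\<^sub>0 complex) set set" where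
  "tensor3 A U V W = free_triples U V W // tensor_rel A U V W"

definition triple_mult :: "(complex, 'a) module \<Rightarrow> ('a \<times> 'a \<times> 'a \<Rightarrow>\<^sub>0 complex) \<Rightarrow> 'a" where
  "triple_mult A p = finsum A
     (\<lambda>(u, v, w). Poly_Mapping.lookup p (u, v, w) \<odot>\<^bsub>A\<^esub> (u \<otimes>\<^bsub>A\<^esub> v \<otimes>\<^bsub>A\<^esub> w)) (Poly_Mapping.keys p)"

text \<open>
  The class of a formal combination \<open>\<Sum> c (u, v, w)\<close> is the tensor \<open>\<Sum> c (u \<otimes> v \<otimes> w)\<close>, so the map
  \<open>\<phi>\<close> below is the linear map that sends \<open>u \<otimes> v \<otimes> w\<close> to the product \<open>u v w\<close>.
\<close>

definition yangian_triangular :: "('i, 'h::ab_group_add) cartan_datum \<Rightarrow> bool" where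
  "yangian_triangular \<gg> \<longleftrightarrow>
    (let Y = yangian \<gg>; U = Y_pm \<gg> Minus; V = Y_zero \<gg>; W = Y_pm \<gg> Plus in
     \<exists>\<phi>. bij_betw \<phi> (tensor3 Y U V W) (carrier Y) \<and>
         (\<forall>p\<in>free_triples U V W. \<phi> (tensor_rel Y U V W `` {p}) = triple_mult Y p))"

text \<open>
  The isomorphism is the canonical one: it matches the generators.
\<close>

definition yangian_halves_presented :: "('i, 'h::ab_group_add) cartan_datum \<Rightarrow> bool" where
  "yangian_halves_presented \<gg> \<longleftrightarrow>
    (\<forall>\<epsilon>. let R = half_relators \<gg> \<epsilon> (\<lambda>i r. gen (i, r)) in
       \<exists>\<phi> \<in> algebra_iso (presented_algebra R) ((yangian \<gg>)\<lparr>carrier := Y_pm \<gg> \<epsilon>\<rparr>).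
         \<forall>i r. \<phi> (presented_gen R (i, r)) = yx \<gg> \<epsilon> i r)"


section \<open>The completed Yangian\<close>

definition Y_plus_deg :: "('i, 'h::ab_group_add) cartan_datum \<Rightarrow> nat \<Rightarrow> ('i, 'h) yangian_elem set" where
  "Y_plus_deg \<gg> k = linear_span (yangian \<gg>)
     {foldr (\<lambda>(i, r) z. yx \<gg> Plus i r \<otimes>\<^bsub>yangian \<gg>\<^esub> z) w \<one>\<^bsub>yangian \<gg>\<^esub> | w. length w = k}"

definition Y_deg :: "('i, 'h::ab_group_add) cartan_datum \<Rightarrow> nat \<Rightarrow> ('i, 'h) yangian_elem set" where
  "Y_deg \<gg> k = linear_span (yangian \<gg>)
     {a \<otimes>\<^bsub>yangian \<gg>\<^esub> b | a b. a \<in> Y_le_zero \<gg> \<and> b \<in> Y_plus_deg \<gg> k}"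

text \<open>
  The component of an element in degree \<open>m\<close> with respect to the direct sum decomposition of the
  Yangian into the subspaces \<^const>\<open>Y_deg\<close>.
\<close>

definition Y_component ::
    "('i, 'h::ab_group_add) cartan_datum \<Rightarrow> nat \<Rightarrow> ('i, 'h) yangian_elem \<Rightarrow> ('i, 'h) yangian_elem" where
  "Y_component \<gg> m y =
    (THE f. (\<forall>k. f k \<in> Y_deg \<gg> k) \<and> finite {k. f k \<noteq> \<zero>\<^bsub>yangian \<gg>\<^esub>} \<and>
            y = finsum (yangian \<gg>) f {k. f k \<noteq> \<zero>\<^bsub>yangian \<gg>\<^esub>}) m"

definition Y_hat_mult ::
    "('i, 'h::ab_group_add) cartan_datum \<Rightarrow> (nat \<Rightarrow> ('i, 'h) yangian_elem) \<Rightarrow>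
     (nat \<Rightarrow> ('i, 'h) yangian_elem) \<Rightarrow> nat \<Rightarrow> ('i, 'h) yangian_elem" where
  "Y_hat_mult \<gg> P Q m =
     finsum (yangian \<gg>) (\<lambda>(k, l). Y_component \<gg> m (P k \<otimes>\<^bsub>yangian \<gg>\<^esub> Q l))
       {(k, l). Y_component \<gg> m (P k \<otimes>\<^bsub>yangian \<gg>\<^esub> Q l) \<noteq> \<zero>\<^bsub>yangian \<gg>\<^esub>}"

text \<open>
  The series \<open>\<Sum>\<^sub>k P\<^sub>k\<close> is the sequence of its components; vector space operations are those of
  the product of vector spaces.
\<close>

definition Y_hat ::
    "('i, 'h::ab_group_add) cartan_datum \<Rightarrow> (complex, nat \<Rightarrow> ('i, 'h) yangian_elem) module" where
  "Y_hat \<gg> =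
    \<lparr>carrier = {P. \<forall>k. P k \<in> Y_deg \<gg> k},
     monoid.mult = Y_hat_mult \<gg>,
     monoid.one = (\<lambda>k. if k = 0 then \<one>\<^bsub>yangian \<gg>\<^esub> else \<zero>\<^bsub>yangian \<gg>\<^esub>),
     ring.zero = (\<lambda>k. \<zero>\<^bsub>yangian \<gg>\<^esub>),
     ring.add = (\<lambda>P Q k. P k \<oplus>\<^bsub>yangian \<gg>\<^esub> Q k),
     module.smult = (\<lambda>c P k. c \<odot>\<^bsub>yangian \<gg>\<^esub> P k)\<rparr>"

end

theory Submission
  imports Defs
begin

text \<open>
  The completed Yangian is the completion of the Yangian \<open>Y\<close> with respect to the subspaces
  \<open>F\<^sub>n = \<Oplus>\<^sub>k\<^sub>\<ge>\<^sub>n Y[k]\<close>.  The decomposition into the \<open>Y[k]\<close> is not an algebra grading, but two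
  properties of the \<open>F\<^sub>n\<close> suffice: each \<open>F\<^sub>n\<close> is a left ideal, and for every \<open>y \<in> Y\<close> and every \<open>m\<close>
  there is an \<open>n\<close> with \<open>F\<^sub>n y \<subseteq> F\<^sub>m\<close>, so that right multiplication by \<open>y\<close> is continuous.  Two-sided
  ideals are not to be expected, since \<open>x\<^sup>-\<close> lowers the degree when multiplied from the right.

  Let these properties be given.  In the product of \<open>\<Sum> P\<^sub>k\<close> and \<open>\<Sum> Q\<^sub>l\<close> the terms with \<open>l > m\<close>
  have no component of degree \<open>m\<close> because \<open>F\<^sub>l\<close> is a left ideal, and for each of the finitely many
  \<open>l \<le> m\<close> continuity for \<open>y = Q\<^sub>l\<close> bounds \<open>k\<close> (lemma \<open>product_support\<close>).  Moreover, if
  \<open>P \<equiv> a\<close> modulo \<open>F\<^sub>n\<close>, \<open>Q \<equiv> b\<close> modulo \<open>F\<^sub>m\<close> and \<open>F\<^sub>n b \<subseteq> F\<^sub>m\<close>, then \<open>P Q \<equiv> a b\<close> modulo \<open>F\<^sub>m\<close>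
  (lemma \<open>approximates_mult\<close>).  So every law, associativity in particular, is inherited from \<open>Y\<close>
  by approximating the factors, starting with the rightmost one.  This part concerns an arbitrary
  algebra with such a decomposition (locale \<open>decomposed_algebra\<close>).

  For the Yangian, the relations among the \<open>x\<^sup>+\<^sub>i\<^sub>r\<close> are homogeneous in the number of generators,
  so the presentation of \<open>Y\<^sup>+\<close> makes it a graded algebra (lemma \<open>half_parametrization\<close>).  The projection of
  \<open>Y\<^sup>+\<close> to degree \<open>m\<close> extends through the tensor product of the triangular decomposition to a linear map on \<open>Y\<close>
  (lemma \<open>extend_third_factor\<close>), and because the commutation relations give
  \<open>Y\<^sup>\<le>\<^sup>0 = Y\<^sup>- Y\<^sup>0\<close> (lemma \<open>Y_le_zero_ordered\<close>), this map is the projection onto \<open>Y[m]\<close>.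

  Finally \<open>F\<^sub>n\<close> is the left ideal generated by the products of \<open>n\<close> generators \<open>x\<^sup>+\<^sub>i\<^sub>r\<close>
  (lemma \<open>pos_ideal_iff\<close>).  From this description the commutation relations show
  \<open>F\<^sub>n x\<^sup>+ \<subseteq> F\<^sub>n\<^sub>+\<^sub>1\<close>, \<open>F\<^sub>n h \<subseteq> F\<^sub>n\<close> and \<open>F\<^sub>n\<^sub>+\<^sub>1 x\<^sup>- \<subseteq> F\<^sub>n\<close>; as continuity is preserved by sums and
  products, it holds for all of \<open>Y\<close> (lemma \<open>pos_ideal_right_continuous\<close>).
\<close>

section \<open>Subspaces, linear maps and generated subalgebras\<close>

lemma complex_field_simps [simp]:
  "carrier complex_field = UNIV"
  "a \<oplus>\<^bsub>complex_field\<^esub> b = a + b"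
  "a \<otimes>\<^bsub>complex_field\<^esub> b = a * b"
  "\<one>\<^bsub>complex_field\<^esub> = 1"
  "\<zero>\<^bsub>complex_field\<^esub> = 0"
  by (simp_all add: ring_of_type_algebra_def)

lemmas (in abelian_monoid) finsum_mono_neutral_cong_left = add.finprod_mono_neutral_cong_left

context complex_algebra
begin

lemma ring_A: "ring A"
  by unfold_locales

lemma semiring_A: "semiring A"
  by unfold_locales

lemma abelian_monoid_A: "abelian_monoid A"
  by unfold_locales

lemma monoid_A: "Group.monoid A"
  by unfold_locales

text \<open>
  The ring of scalars and the algebra have fact names in common.  These are the facts about
  the algebra.
\<close>

lemmas l_distr = semiring.l_distr [OF semiring_A]
  and r_distr = semiring.r_distr [OF semiring_A]
  and m_assoc = monoid.m_assoc [OF monoid_A]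
  and a_assoc = abelian_monoid.a_assoc [OF abelian_monoid_A]
  and a_comm = abelian_monoid.a_comm [OF abelian_monoid_A]
  and a_lcomm = abelian_monoid.a_lcomm [OF abelian_monoid_A]
  and minus_equality = abelian_group.minus_equality [OF ring.is_abelian_group [OF ring_A]]
  and subringI = ring.subringI [OF ring_A]
  and carrier_is_subring = ring.carrier_is_subring [OF ring_A]
  and finsum_insert = abelian_monoid.finsum_insert [OF abelian_monoid_A]
  and finsum_cong' = abelian_monoid.finsum_cong' [OF abelian_monoid_A]
  and finsum_addf = abelian_monoid.finsum_addf [OF abelian_monoid_A]
  and finsum_Un_disjoint = abelian_monoid.finsum_Un_disjoint [OF abelian_monoid_A]
  and finsum_reindex = abelian_monoid.finsum_reindex [OF abelian_monoid_A]
  and finsum_singleton = abelian_monoid.finsum_singleton [OF abelian_monoid_A]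
  and l_neg = abelian_group.l_neg [OF ring.is_abelian_group [OF ring_A]]
  and r_neg = abelian_group.r_neg [OF ring.is_abelian_group [OF ring_A]]
  and m_closed = monoid.m_closed [OF monoid_A]
  and finsum_mono_neutral = abelian_monoid.finsum_mono_neutral_cong_left [OF abelian_monoid_A]

lemmas a_ac = a_assoc a_comm a_lcomm

abbreviation subspace :: "'a set \<Rightarrow> bool" where
  "subspace N \<equiv> submodule N complex_field A"

definition linear_map :: "('a \<Rightarrow> 'a) \<Rightarrow> bool" where
  "linear_map f \<longleftrightarrow> f \<in> carrier A \<rightarrow> carrier A \<and>
     (\<forall>x\<in>carrier A. \<forall>y\<in>carrier A. f (x \<oplus> y) = f x \<oplus> f y) \<and>
     (\<forall>c. \<forall>x\<in>carrier A. f (c \<odot> x) = c \<odot> f x)"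

lemma scale_closed [simp, intro]: "x \<in> carrier A \<Longrightarrow> c \<odot> x \<in> carrier A"
  by (rule smult_closed) simp_all

lemma scale_simps:
  "x \<in> carrier A \<Longrightarrow> (a + b) \<odot> x = a \<odot> x \<oplus> b \<odot> x"
  "x \<in> carrier A \<Longrightarrow> y \<in> carrier A \<Longrightarrow> a \<odot> (x \<oplus> y) = a \<odot> x \<oplus> a \<odot> y"
  "x \<in> carrier A \<Longrightarrow> (a * b) \<odot> x = a \<odot> (b \<odot> x)"
  using smult_l_distr[of a b x] smult_r_distr[of a x y] smult_assoc1[of a b x] by simp_all

lemma scale_one [simp]: "x \<in> carrier A \<Longrightarrow> 1 \<odot> x = x"
  using smult_one[of x] by simp

lemma scale_zero [simp]:
  "x \<in> carrier A \<Longrightarrow> 0 \<odot> x = \<zero>" "c \<odot> \<zero> = \<zero>"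
  using smult_l_null[of x] smult_r_null[of c] by simp_all

lemma scale_minus_one: "x \<in> carrier A \<Longrightarrow> (- 1) \<odot> x = \<ominus> x"
  using scale_simps(1)[of x "-1" 1] by (simp add: minus_equality)

lemma subspaceI:
  assumes "N \<subseteq> carrier A" "\<zero> \<in> N"
    and "\<And>x y. x \<in> N \<Longrightarrow> y \<in> N \<Longrightarrow> x \<oplus> y \<in> N"
    and "\<And>c x. x \<in> N \<Longrightarrow> c \<odot> x \<in> N"
  shows "subspace N"
proof (rule submoduleI)
  show "\<ominus> x \<in> N" if "x \<in> N" for x
    using assms(4)[OF that, of "- 1"] scale_minus_one[of x] assms(1) that by auto
qed (use assms in auto)

lemma subspaceD:
  assumes "subspace N"
  shows "x \<in> N \<Longrightarrow> x \<in> carrier A" "\<zero> \<in> N"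
    "x \<in> N \<Longrightarrow> y \<in> N \<Longrightarrow> x \<oplus> y \<in> N" "x \<in> N \<Longrightarrow> c \<odot> x \<in> N"
proof -
  note E = submoduleE[OF assms]
  show "x \<in> N \<Longrightarrow> x \<in> carrier A" "x \<in> N \<Longrightarrow> y \<in> N \<Longrightarrow> x \<oplus> y \<in> N" using E(1,5) by auto
  show *: "x \<in> N \<Longrightarrow> c \<odot> x \<in> N" for x c using E(4)[of c x] by simp
  obtain x where "x \<in> N" using E(2) by auto
  then show "\<zero> \<in> N" using *[of x 0] E(1) by auto
qed

lemma subspace_carrier: "subspace (carrier A)"
  by (rule subspaceI) auto

lemma subspace_zero: "subspace {\<zero>}"
  by (rule subspaceI) auto

lemma subspace_Ball:
  assumes "\<And>i. i \<in> I \<Longrightarrow> subspace {x \<in> carrier A. P i x}"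
  shows "subspace {x \<in> carrier A. \<forall>i\<in>I. P i x}"
proof (rule subspaceI)
  show "\<zero> \<in> {x \<in> carrier A. \<forall>i\<in>I. P i x}" using assms subspaceD(2) by fastforce
  show "x \<oplus> y \<in> {x \<in> carrier A. \<forall>i\<in>I. P i x}"
    if "x \<in> {x \<in> carrier A. \<forall>i\<in>I. P i x}" "y \<in> {x \<in> carrier A. \<forall>i\<in>I. P i x}" for x y
    using that subspaceD(3)[OF assms, of _ x y] by auto
  show "c \<odot> x \<in> {x \<in> carrier A. \<forall>i\<in>I. P i x}"
    if "x \<in> {x \<in> carrier A. \<forall>i\<in>I. P i x}" for c x
    using that subspaceD(4)[OF assms, of _ x c] by auto
qed auto

lemma subspace_finsum:
  assumes "subspace N" "\<And>i. i \<in> I \<Longrightarrow> f i \<in> N"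
  shows "finsum A f I \<in> N"
  using assms(2)
proof (induction I rule: infinite_finite_induct)
  case (insert i I)
  then have "f \<in> I \<rightarrow> carrier A" "f i \<in> carrier A"
    using subspaceD(1)[OF assms(1)] by auto
  with insert show ?case using subspaceD(3)[OF assms(1)] by auto
qed (use subspaceD(2)[OF assms(1)] in auto)

lemma linear_mapD:
  assumes "linear_map f"
  shows "x \<in> carrier A \<Longrightarrow> f x \<in> carrier A"
    "x \<in> carrier A \<Longrightarrow> y \<in> carrier A \<Longrightarrow> f (x \<oplus> y) = f x \<oplus> f y"
    "x \<in> carrier A \<Longrightarrow> f (c \<odot> x) = c \<odot> f x" "f \<zero> = \<zero>"
proof -
  show *: "x \<in> carrier A \<Longrightarrow> f x \<in> carrier A"
    "x \<in> carrier A \<Longrightarrow> y \<in> carrier A \<Longrightarrow> f (x \<oplus> y) = f x \<oplus> f y"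
    "x \<in> carrier A \<Longrightarrow> f (c \<odot> x) = c \<odot> f x" for x y c
    using assms by (auto simp: linear_map_def)
  show "f \<zero> = \<zero>" using *(3)[of \<zero> 0] *(1)[of \<zero>] by simp
qed

lemma linear_map_finsum:
  assumes "linear_map f" "\<And>i. i \<in> I \<Longrightarrow> g i \<in> carrier A"
  shows "f (finsum A g I) = finsum A (\<lambda>i. f (g i)) I"
  using assms(2)
proof (induction I rule: infinite_finite_induct)
  case (insert i I)
  then have "g \<in> I \<rightarrow> carrier A" "g i \<in> carrier A" by auto
  moreover from this have "(\<lambda>i. f (g i)) \<in> I \<rightarrow> carrier A" "f (g i) \<in> carrier A"
    using linear_mapD(1)[OF assms(1)] by auto
  ultimately show ?case using insert by (simp add: linear_mapD(2)[OF assms(1)])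
qed (simp_all add: linear_mapD(4)[OF assms(1)])

lemma linear_map_mult_left: "a \<in> carrier A \<Longrightarrow> linear_map (\<lambda>x. a \<otimes> x)"
  by (auto simp: linear_map_def r_distr smult_mult_right)

lemma linear_map_mult_right: "a \<in> carrier A \<Longrightarrow> linear_map (\<lambda>x. x \<otimes> a)"
  by (auto simp: linear_map_def l_distr smult_mult_left)

lemma linear_map_id: "linear_map (\<lambda>x. x)"
  by (auto simp: linear_map_def)

lemma subspace_vimage:
  assumes "linear_map f" "subspace N"
  shows "subspace {x \<in> carrier A. f x \<in> N}"
  using assms by (intro subspaceI) (auto simp: linear_mapD subspaceD)

lemma subspace_equalizer:
  assumes "linear_map f" "linear_map g"
  shows "subspace {x \<in> carrier A. f x = g x}"
  using assms by (intro subspaceI) (auto simp: linear_mapD)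

lemma span_superset: "S \<subseteq> linear_span A S"
  by (auto simp: linear_span_def)

lemma span_minimal: "S \<subseteq> N \<Longrightarrow> subspace N \<Longrightarrow> linear_span A S \<subseteq> N"
  by (auto simp: linear_span_def)

lemma subspace_span:
  assumes "S \<subseteq> carrier A"
  shows "subspace (linear_span A S)"
proof (rule subspaceI)
  show "linear_span A S \<subseteq> carrier A" using assms by (intro span_minimal subspace_carrier)
qed (auto simp: linear_span_def dest: subspaceD)

lemma span_in_vimage:
  assumes "linear_map f" "subspace N" "S \<subseteq> carrier A" "\<And>x. x \<in> S \<Longrightarrow> f x \<in> N" "x \<in> linear_span A S"
  shows "f x \<in> N"
  using span_minimal[OF _ subspace_vimage[OF assms(1,2)], of S] assms(3-5) by auto

lemma generated_superset: "S \<subseteq> subalgebra_generated A S"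
  by (auto simp: subalgebra_generated_def)

lemma generated_minimal: "S \<subseteq> B \<Longrightarrow> subring B A \<Longrightarrow> subspace B \<Longrightarrow> subalgebra_generated A S \<subseteq> B"
  by (auto simp: subalgebra_generated_def)

lemma generated_mult:
  "x \<in> subalgebra_generated A S \<Longrightarrow> y \<in> subalgebra_generated A S \<Longrightarrow> x \<otimes> y \<in> subalgebra_generated A S"
  by (auto simp: subalgebra_generated_def dest: subringE)

lemma generated_one: "\<one> \<in> subalgebra_generated A S"
  by (auto simp: subalgebra_generated_def dest: subringE)

lemma generated_subspace:
  assumes "S \<subseteq> carrier A"
  shows "subspace (subalgebra_generated A S)"
proof (rule subspaceI)
  show "subalgebra_generated A S \<subseteq> carrier A"
    using assms by (intro generated_minimal subspace_carrier carrier_is_subring)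
qed (auto simp: subalgebra_generated_def dest: subspaceD)

lemma generated_mono:
  assumes "S \<subseteq> T"
  shows "subalgebra_generated A S \<subseteq> subalgebra_generated A T"
  using assms by (auto simp: subalgebra_generated_def)

text \<open>
  The elements that map a subspace into itself by left multiplication form a subalgebra.  This
  replaces inductions over words in the generators.
\<close>

lemma generated_left_induct:
  assumes S: "S \<subseteq> carrier A" and N: "subspace N" "\<one> \<in> N"
    and step: "\<And>s x. s \<in> S \<Longrightarrow> x \<in> N \<Longrightarrow> s \<otimes> x \<in> N"
  shows "subalgebra_generated A S \<subseteq> N"
proof -
  let ?B = "{a \<in> carrier A. \<forall>x\<in>N. a \<otimes> x \<in> N}"
  note [simp] = subspaceD[OF N(1)]
  have sub: "subspace ?B"
    using N by (intro subspace_Ball subspace_vimage linear_map_mult_right) auto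
  have "subring ?B A"
  proof (rule subringI)
    show "\<ominus> h \<in> ?B" if "h \<in> ?B" for h
      using subspaceD(4)[OF sub, of h "- 1"] that scale_minus_one[of h] by auto
    show "h \<otimes> k \<in> ?B" if "h \<in> ?B" "k \<in> ?B" for h k
      using that by (auto simp: m_assoc)
    show "h \<oplus> k \<in> ?B" if "h \<in> ?B" "k \<in> ?B" for h k
      using that subspaceD(3)[OF sub] by blast
  qed auto
  then have *: "subalgebra_generated A S \<subseteq> ?B"
    using S step sub by (intro generated_minimal) auto
  show ?thesis
  proof
    fix a assume "a \<in> subalgebra_generated A S"
    then have "a \<in> ?B" using * by blast
    then have "a \<otimes> \<one> \<in> N" using N(2) by blast
    then show "a \<in> N" using \<open>a \<in> ?B\<close> by simp
  qed
qed

end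

section \<open>Linear extension from a basis\<close>

lemma lookup_fscale [simp]: "Poly_Mapping.lookup (c \<cdot>\<^sub>C p) k = c * Poly_Mapping.lookup p k"
  by (simp add: fscale_def Poly_Mapping.map.rep_eq when_def)

lemma keys_fscale: "Poly_Mapping.keys (c \<cdot>\<^sub>C p) \<subseteq> Poly_Mapping.keys p"
  by (auto simp: in_keys_iff)

context complex_algebra
begin

text \<open>
  A \<^type>\<open>poly_mapping\<close> with complex coefficients is an element of the free vector space on its
  index type; this is the linear map given by the images of the basis vectors.
\<close>

definition extend_linearly :: "('k \<Rightarrow> 'a) \<Rightarrow> ('k \<Rightarrow>\<^sub>0 complex) \<Rightarrow> 'a" where
  "extend_linearly g p = finsum A (\<lambda>k. Poly_Mapping.lookup p k \<odot> g k) (Poly_Mapping.keys p)"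

text \<open>
  Enlarging the index set makes sums for different arguments comparable, as needed for additivity.
\<close>

lemma extend_linearly_superset:
  assumes "finite K" "Poly_Mapping.keys p \<subseteq> K" "\<And>k. k \<in> K \<Longrightarrow> g k \<in> carrier A"
  shows "extend_linearly g p = finsum A (\<lambda>k. Poly_Mapping.lookup p k \<odot> g k) K"
  unfolding extend_linearly_def using assms
  by (intro finsum_mono_neutral) (auto simp: in_keys_iff)

lemma extend_linearly_subspace:
  assumes "subspace N" "\<And>k. k \<in> Poly_Mapping.keys p \<Longrightarrow> g k \<in> N"
  shows "extend_linearly g p \<in> N"
  unfolding extend_linearly_def using assms by (intro subspace_finsum) (auto simp: subspaceD)

lemma extend_linearly_closed:
  "(\<And>k. k \<in> Poly_Mapping.keys p \<Longrightarrow> g k \<in> carrier A) \<Longrightarrow> extend_linearly g p \<in> carrier A"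
  by (rule extend_linearly_subspace[OF subspace_carrier])

lemma extend_linearly_zero: "extend_linearly g 0 = \<zero>"
  by (simp add: extend_linearly_def)

lemma extend_linearly_add:
  assumes "\<And>k. k \<in> Poly_Mapping.keys p \<union> Poly_Mapping.keys q \<Longrightarrow> g k \<in> carrier A"
  shows "extend_linearly g (p + q) = extend_linearly g p \<oplus> extend_linearly g q"
proof -
  let ?K = "Poly_Mapping.keys p \<union> Poly_Mapping.keys q"
  have K: "finite ?K" by simp
  have "extend_linearly g (p + q) = finsum A (\<lambda>k. Poly_Mapping.lookup (p + q) k \<odot> g k) ?K"
    using keys_add[of p q] assms by (intro extend_linearly_superset[OF K]) auto
  also have "\<dots> = finsum A (\<lambda>k. Poly_Mapping.lookup p k \<odot> g k \<oplus> Poly_Mapping.lookup q k \<odot> g k) ?K"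
    using assms by (intro finsum_cong') (auto simp: lookup_add scale_simps)
  also have "\<dots> = finsum A (\<lambda>k. Poly_Mapping.lookup p k \<odot> g k) ?K \<oplus>
      finsum A (\<lambda>k. Poly_Mapping.lookup q k \<odot> g k) ?K"
    using assms by (intro finsum_addf) auto
  also have "\<dots> = extend_linearly g p \<oplus> extend_linearly g q"
    using assms extend_linearly_superset[OF K, of p g] extend_linearly_superset[OF K, of q g] by auto
  finally show ?thesis .
qed

lemma extend_linearly_scale:
  assumes "\<And>k. k \<in> Poly_Mapping.keys p \<Longrightarrow> g k \<in> carrier A"
  shows "extend_linearly g (c \<cdot>\<^sub>C p) = c \<odot> extend_linearly g p"
proof -
  have "extend_linearly g (c \<cdot>\<^sub>C p) =
      finsum A (\<lambda>k. c \<odot> (Poly_Mapping.lookup p k \<odot> g k)) (Poly_Mapping.keys p)"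
    using assms keys_fscale[of c p]
    by (subst extend_linearly_superset[of "Poly_Mapping.keys p"])
       (auto intro!: finsum_cong' simp: scale_simps)
  also have "\<dots> = c \<odot> extend_linearly g p"
    unfolding extend_linearly_def using assms by (subst finsum_smult_ldistr) auto
  finally show ?thesis .
qed

lemma extend_linearly_single:
  "g k \<in> carrier A \<Longrightarrow> extend_linearly g (Poly_Mapping.single k c) = c \<odot> g k"
  by (cases "c = 0") (simp_all add: extend_linearly_def)

lemma extend_linearly_diff:
  assumes "\<And>k. k \<in> Poly_Mapping.keys p \<union> Poly_Mapping.keys q \<Longrightarrow> g k \<in> carrier A"
  shows "extend_linearly g (p - q) = extend_linearly g p \<ominus> extend_linearly g q"
proof -
  have eq: "p - q = p + (- 1) \<cdot>\<^sub>C q" by (rule poly_mapping_eqI) (simp add: lookup_add lookup_minus)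
  have "extend_linearly g (p - q) = extend_linearly g p \<oplus> (- 1) \<odot> extend_linearly g q"
    unfolding eq using assms keys_fscale[of "- 1" q]
    by (subst extend_linearly_add) (auto simp: extend_linearly_scale)
  moreover have "extend_linearly g q \<in> carrier A" using assms by (intro extend_linearly_closed) auto
  ultimately show ?thesis by (simp add: scale_minus_one a_minus_def)
qed

end


section \<open>Completion of an algebra along a decomposition\<close>

text \<open>
  The subspaces \<open>G k\<close> play the role of the homogeneous components, although they need not form
  an algebra grading, and \<open>comp k\<close> is the projection onto \<open>G k\<close>.  Instead of multiplicativity
  there are two conditions on the tails, the subspaces of elements without components of degree
  below \<open>n\<close>: they are left ideals, and every right multiplication is continuous for the topology
  that has them as neighbourhoods of zero.  An element of the completion is a sequence of
  components, that is, a compatible system of residues modulo the tails.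
\<close>

locale decomposed_algebra = complex_algebra A
  for A :: "(complex, 'a) module" (structure) +
  fixes G :: "nat \<Rightarrow> 'a set" and comp :: "nat \<Rightarrow> 'a \<Rightarrow> 'a"
  assumes subspace_G: "submodule (G k) complex_field A"
    and one_G: "\<one> \<in> G 0"
    and comp_in_G: "y \<in> carrier A \<Longrightarrow> comp m y \<in> G m"
    and comp_linear: "linear_map (comp m)"
    and comp_G: "y \<in> G k \<Longrightarrow> comp m y = (if k = m then y else \<zero>)"
    and left_ideal: "y \<in> carrier A \<Longrightarrow> z \<in> carrier A \<Longrightarrow> (\<And>i. i < n \<Longrightarrow> comp i z = \<zero>) \<Longrightarrow>
      i < n \<Longrightarrow> comp i (y \<otimes> z) = \<zero>"
    and right_continuous: "y \<in> carrier A \<Longrightarrow>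
      \<exists>n. \<forall>z\<in>carrier A. (\<forall>i<n. comp i z = \<zero>) \<longrightarrow> (\<forall>i<m. comp i (z \<otimes> y) = \<zero>)"
begin

definition tail :: "nat \<Rightarrow> 'a set" where
  "tail n = {z \<in> carrier A. \<forall>i\<in>{..<n}. comp i z = \<zero>}"

definition hat_mult :: "(nat \<Rightarrow> 'a) \<Rightarrow> (nat \<Rightarrow> 'a) \<Rightarrow> nat \<Rightarrow> 'a" where
  "hat_mult P Q m = finsum A (\<lambda>(k, l). comp m (P k \<otimes> Q l)) {(k, l). comp m (P k \<otimes> Q l) \<noteq> \<zero>}"

definition hat :: "(complex, nat \<Rightarrow> 'a) module" where
  "hat = \<lparr>carrier = {P. \<forall>k. P k \<in> G k},
     monoid.mult = hat_mult,
     monoid.one = (\<lambda>k. if k = 0 then \<one> else \<zero>),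
     ring.zero = (\<lambda>k. \<zero>),
     ring.add = (\<lambda>P Q k. P k \<oplus> Q k),
     module.smult = (\<lambda>c P k. c \<odot> P k)\<rparr>"

text \<open>
  Congruence of a series and an element of the algebra modulo the tail of order \<open>n\<close>.
\<close>

definition approximates :: "nat \<Rightarrow> (nat \<Rightarrow> 'a) \<Rightarrow> 'a \<Rightarrow> bool" where
  "approximates n P a \<longleftrightarrow> a \<in> carrier A \<and> (\<forall>i<n. comp i a = P i)"

definition trunc :: "(nat \<Rightarrow> 'a) \<Rightarrow> nat \<Rightarrow> 'a" where
  "trunc P n = finsum A P {..<n}"

lemma subspace_tail: "subspace (tail n)"
  unfolding tail_def using subspace_equalizer[OF comp_linear, of "\<lambda>x. \<zero>"]
  by (intro subspace_Ball) (auto simp: linear_map_def)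

lemma tail_antimono: "m \<le> n \<Longrightarrow> tail n \<subseteq> tail m"
  by (auto simp: tail_def)

lemma tail_left_ideal: "y \<in> carrier A \<Longrightarrow> z \<in> tail n \<Longrightarrow> y \<otimes> z \<in> tail n"
  by (auto simp: tail_def intro: left_ideal)

lemma tail_right_continuous:
  assumes "y \<in> carrier A"
  shows "\<exists>n. \<forall>z\<in>tail n. z \<otimes> y \<in> tail m"
proof -
  obtain n where "\<forall>z\<in>carrier A. (\<forall>i<n. comp i z = \<zero>) \<longrightarrow> (\<forall>i<m. comp i (z \<otimes> y) = \<zero>)"
    using right_continuous[OF assms] by blast
  then have "\<forall>z\<in>tail n. z \<otimes> y \<in> tail m" using assms by (simp add: tail_def)
  then show ?thesis by blast
qed

lemma tail_right_continuous_finite: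
  assumes "finite S" "S \<subseteq> carrier A"
  shows "\<exists>n. \<forall>y\<in>S. \<forall>z\<in>tail n. z \<otimes> y \<in> tail m"
  using assms
proof (induction S rule: finite_induct)
  case (insert x S)
  then obtain n where n: "\<forall>y\<in>S. \<forall>z\<in>tail n. z \<otimes> y \<in> tail m" by auto
  obtain n' where n': "\<forall>z\<in>tail n'. z \<otimes> x \<in> tail m"
    using insert.prems tail_right_continuous[of x m] by auto
  show ?case
    using n n' tail_antimono[of n "max n n'"] tail_antimono[of n' "max n n'"]
    by (intro exI[of _ "max n n'"]) auto
qed simp

lemma G_tail: "y \<in> G k \<Longrightarrow> n \<le> k \<Longrightarrow> y \<in> tail n"
  using subspaceD(1)[OF subspace_G] by (auto simp: tail_def comp_G)

lemma hat_closed: "P \<in> carrier hat \<Longrightarrow> P k \<in> carrier A"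
  using subspaceD(1)[OF subspace_G] by (auto simp: hat_def)

lemma trunc_closed: "P \<in> carrier hat \<Longrightarrow> trunc P n \<in> carrier A"
  unfolding trunc_def by (intro subspace_finsum subspace_carrier hat_closed)

lemma comp_trunc:
  assumes "P \<in> carrier hat" "i < n"
  shows "comp i (trunc P n) = P i"
proof -
  have "comp i (trunc P n) = finsum A (\<lambda>k. comp i (P k)) {..<n}"
    unfolding trunc_def using assms hat_closed by (intro linear_map_finsum comp_linear) auto
  also have "\<dots> = finsum A (\<lambda>k. if i = k then P k else \<zero>) {..<n}"
    using assms hat_closed comp_G[of "P k" k for k] by (intro finsum_cong') (auto simp: hat_def)
  also have "\<dots> = P i" using assms hat_closed by (intro finsum_singleton) auto
  finally show ?thesis .
qed

lemma approximates_trunc: "P \<in> carrier hat \<Longrightarrow> approximates n P (trunc P n)"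
  by (simp add: approximates_def trunc_closed comp_trunc)

lemma approximates_minus:
  assumes "approximates n P a" "approximates n P b"
  shows "a \<ominus> b \<in> tail n"
proof -
  have *: "a \<in> carrier A" "b \<in> carrier A" using assms by (auto simp: approximates_def)
  have eq: "a \<ominus> b = a \<oplus> (- 1) \<odot> b" using * by (simp add: scale_minus_one a_minus_def)
  have "comp i (a \<ominus> b) = \<zero>" if "i < n" for i
  proof -
    have "comp i a = comp i b" using assms that by (simp add: approximates_def)
    then have "comp i (a \<ominus> b) = comp i b \<oplus> (- 1) \<odot> comp i b"
      using * comp_linear by (simp add: eq linear_mapD)
    also have "\<dots> = (1 + - 1) \<odot> comp i b"
      using * linear_mapD(1)[OF comp_linear] by (subst scale_simps(1)) simp_all
    finally show ?thesis using * linear_mapD(1)[OF comp_linear] by simp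
  qed
  then show ?thesis using * by (simp add: tail_def)
qed

lemma approximates_add:
  assumes "approximates n P a" "z \<in> tail n"
  shows "approximates n P (a \<oplus> z)"
proof -
  have "P i \<in> carrier A" if "i < n" for i
    using assms(1) that linear_mapD(1)[OF comp_linear, of a i] by (simp add: approximates_def)
  then show ?thesis
    using assms comp_linear by (simp add: approximates_def tail_def linear_mapD)
qed

lemma finsum_product:
  assumes "finite I" "finite J" "\<And>i. i \<in> I \<Longrightarrow> f i \<in> carrier A" "\<And>j. j \<in> J \<Longrightarrow> g j \<in> carrier A"
  shows "finsum A f I \<otimes> finsum A g J = finsum A (\<lambda>(i, j). f i \<otimes> g j) (I \<times> J)"
  using assms(1,3)
proof (induction I rule: finite_induct)
  case empty
  have "finsum A g J \<in> carrier A" using assms(4) by (intro subspace_finsum subspace_carrier)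
  then show ?case by simp
next
  case (insert i I)
  let ?h = "\<lambda>(i, j). f i \<otimes> g j"
  have fin: "finsum A g J \<in> carrier A" "finsum A f I \<in> carrier A" "f i \<in> carrier A"
    using assms(4) insert by (auto intro!: subspace_finsum[OF subspace_carrier])
  have split: "insert i I \<times> J = Pair i ` J \<union> I \<times> J" by auto
  have "finsum A ?h (insert i I \<times> J) = finsum A ?h (Pair i ` J) \<oplus> finsum A ?h (I \<times> J)"
    unfolding split using insert assms by (intro finsum_Un_disjoint) auto
  also have "finsum A ?h (Pair i ` J) = finsum A (\<lambda>j. f i \<otimes> g j) J"
    using insert assms by (subst finsum_reindex) (auto simp: inj_on_def)
  also have "\<dots> = f i \<otimes> finsum A g J"
    using linear_map_finsum[OF linear_map_mult_left[OF fin(3)], of J g] assms(4) by simp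
  also have "f i \<otimes> finsum A g J \<oplus> finsum A ?h (I \<times> J) = finsum A f (insert i I) \<otimes> finsum A g J"
    using insert fin by (subst finsum_insert) (auto simp: l_distr)
  finally show ?case by simp
qed

text \<open>
  A factor \<open>Q\<^sub>l\<close> with \<open>l \<ge> m\<close> only produces terms of degree at least \<open>m\<close>, because the tails
  are left ideals.  For each of the remaining finitely many \<open>Q\<^sub>l\<close> continuity of the right
  multiplication bounds \<open>k\<close>.
\<close>

lemma product_support:
  assumes P: "P \<in> carrier hat" and Q: "Q \<in> carrier hat"
  shows "\<exists>n. \<forall>i<m. {(k, l). comp i (P k \<otimes> Q l) \<noteq> \<zero>} \<subseteq> {..<n} \<times> {..<m}"
proof -
  obtain n where n: "\<forall>y\<in>Q ` {..<m}. \<forall>z\<in>tail n. z \<otimes> y \<in> tail m"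
    using tail_right_continuous_finite[of "Q ` {..<m}" m] hat_closed[OF Q] by blast
  have "k < n \<and> l < m" if "i < m" "comp i (P k \<otimes> Q l) \<noteq> \<zero>" for i k l
  proof (rule ccontr)
    assume "\<not> ?thesis"
    moreover have "P k \<otimes> Q l \<in> tail m" if "m \<le> l"
      using tail_left_ideal[OF hat_closed[OF P] G_tail[of "Q l" l m]] that Q by (simp add: hat_def)
    moreover have "P k \<otimes> Q l \<in> tail m" if "n \<le> k" "l < m"
      using n that G_tail[of "P k" k n] P by (simp add: hat_def)
    ultimately have "P k \<otimes> Q l \<in> tail m" by linarith
    then show False using that by (auto simp: tail_def)
  qed
  then show ?thesis by blast
qed

lemma finite_product_support:
  "P \<in> carrier hat \<Longrightarrow> Q \<in> carrier hat \<Longrightarrow> finite {(k, l). comp m (P k \<otimes> Q l) \<noteq> \<zero>}"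
  using product_support[of P Q "Suc m"] by (meson finite_SigmaI finite_lessThan finite_subset lessI)

lemma hat_mult_closed:
  assumes "P \<in> carrier hat" "Q \<in> carrier hat"
  shows "hat_mult P Q \<in> carrier hat"
  using assms hat_closed unfolding hat_mult_def hat_def
  by (auto intro!: subspace_finsum subspace_G comp_in_G m_closed simp: hat_closed[unfolded hat_def])

lemma hat_mult_trunc:
  assumes P: "P \<in> carrier hat" and Q: "Q \<in> carrier hat" and "i < m"
    and supp: "{(k, l). comp i (P k \<otimes> Q l) \<noteq> \<zero>} \<subseteq> {..<n} \<times> {..<m}"
  shows "hat_mult P Q i = comp i (trunc P n \<otimes> trunc Q m)"
proof -
  note c = hat_closed[OF P] hat_closed[OF Q]
  have "comp i (trunc P n \<otimes> trunc Q m) =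
      comp i (finsum A (\<lambda>(k, l). P k \<otimes> Q l) ({..<n} \<times> {..<m}))"
    unfolding trunc_def using c by (subst finsum_product) auto
  also have "\<dots> = finsum A (\<lambda>p. comp i (case p of (k, l) \<Rightarrow> P k \<otimes> Q l)) ({..<n} \<times> {..<m})"
    using c by (intro linear_map_finsum comp_linear) auto
  also have "\<dots> = hat_mult P Q i"
    unfolding hat_mult_def using supp c linear_mapD(1)[OF comp_linear]
    by (intro finsum_mono_neutral[symmetric]) auto
  finally show ?thesis by simp
qed

text \<open>
  Replacing \<open>Q\<close> by \<open>b\<close> changes the product by an element of a left ideal, the tail of order \<open>m\<close>;
  replacing \<open>P\<close> by \<open>a\<close> afterwards is harmless by the assumption on \<open>b\<close>.  All laws of the completion
  follow from this lemma: the product of two series is determined below degree \<open>m\<close> by suitable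
  elements of the algebra, so a law only has to be checked for these.
\<close>

lemma approximates_mult:
  assumes P: "P \<in> carrier hat" and Q: "Q \<in> carrier hat"
    and a: "approximates n P a" and b: "approximates m Q b"
    and cont: "\<forall>z\<in>tail n. z \<otimes> b \<in> tail m"
  shows "approximates m (hat_mult P Q) (a \<otimes> b)"
proof -
  obtain n0 where n0: "\<forall>i<m. {(k, l). comp i (P k \<otimes> Q l) \<noteq> \<zero>} \<subseteq> {..<n0} \<times> {..<m}"
    using product_support[OF P Q] by blast
  define N where "N = max n n0"
  let ?p = "trunc P N" and ?q = "trunc Q m"
  have ab: "a \<in> carrier A" "b \<in> carrier A" using a b by (auto simp: approximates_def)
  have pq: "?p \<in> carrier A" "?q \<in> carrier A" by (simp_all add: trunc_closed P Q)
  have "{(k, l). comp i (P k \<otimes> Q l) \<noteq> \<zero>} \<subseteq> {..<N} \<times> {..<m}" if "i < m" for i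
    using n0 that unfolding N_def by fastforce
  then have "comp i (?p \<otimes> ?q) = hat_mult P Q i" if "i < m" for i
    using hat_mult_trunc[OF P Q that] that by metis
  then have 1: "approximates m (hat_mult P Q) (?p \<otimes> ?q)"
    using pq by (simp add: approximates_def)
  have "approximates n P ?p" using P comp_trunc[OF P, of _ N] pq(1) by (simp add: approximates_def N_def)
  then have e: "a \<ominus> ?p \<in> tail n" using approximates_minus a by blast
  have d: "b \<ominus> ?q \<in> tail m" using approximates_minus[OF b approximates_trunc[OF Q]] .
  have "a \<otimes> b = ?p \<otimes> ?q \<oplus> (?p \<otimes> (b \<ominus> ?q) \<oplus> (a \<ominus> ?p) \<otimes> b)"
  proof -
    have "?p \<otimes> b = ?p \<otimes> (?q \<oplus> (b \<ominus> ?q))"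
      using pq ab by (simp add: a_minus_def a_lcomm r_neg)
    also have "\<dots> = ?p \<otimes> ?q \<oplus> ?p \<otimes> (b \<ominus> ?q)" using pq ab by (simp add: r_distr)
    finally have 2: "?p \<otimes> b = \<dots>" .
    have "a \<otimes> b = (?p \<oplus> (a \<ominus> ?p)) \<otimes> b" using pq ab by (simp add: a_minus_def a_lcomm r_neg)
    also have "\<dots> = ?p \<otimes> b \<oplus> (a \<ominus> ?p) \<otimes> b" using pq ab by (simp add: l_distr)
    finally show ?thesis using pq ab 2 by (simp add: a_assoc)
  qed
  moreover have "?p \<otimes> (b \<ominus> ?q) \<oplus> (a \<ominus> ?p) \<otimes> b \<in> tail m"
    using cont e tail_left_ideal[OF pq(1) d] by (intro subspaceD(3)[OF subspace_tail]) auto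
  ultimately show ?thesis using approximates_add[OF 1] by simp
qed

lemma hat_eqI:
  assumes "\<And>m. \<exists>a. approximates m P a \<and> approximates m Q a"
  shows "P = Q"
proof
  fix i
  obtain a where "approximates (Suc i) P a" "approximates (Suc i) Q a" using assms by blast
  then have "comp i a = P i" "comp i a = Q i" by (simp_all add: approximates_def)
  then show "P i = Q i" by simp
qed

text \<open>
  Right factors are approximated first, since the precision needed for a left factor depends on
  the approximation chosen to its right.
\<close>

lemma approximates_pair:
  assumes "P \<in> carrier hat" "b \<in> carrier A"
  obtains n a where "approximates n P a" "\<forall>z\<in>tail n. z \<otimes> b \<in> tail m"
  using tail_right_continuous[OF assms(2)] approximates_trunc[OF assms(1)] by blast

lemma hat_mult_assoc:
  assumes P: "P \<in> carrier hat" and Q: "Q \<in> carrier hat" and R: "R \<in> carrier hat"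
  shows "hat_mult (hat_mult P Q) R = hat_mult P (hat_mult Q R)"
proof (rule hat_eqI)
  fix m
  obtain c where c: "approximates m R c" using approximates_trunc[OF R] by blast
  then have cc: "c \<in> carrier A" by (simp add: approximates_def)
  obtain n b where b: "approximates n Q b" "\<forall>z\<in>tail n. z \<otimes> c \<in> tail m"
    using approximates_pair[OF Q cc] .
  then have bc: "b \<in> carrier A" by (simp add: approximates_def)
  obtain l a where a: "approximates l P a" "\<forall>z\<in>tail l. z \<otimes> b \<in> tail n"
    using approximates_pair[OF P bc] .
  then have ac: "a \<in> carrier A" by (simp add: approximates_def)
  have tl: "z \<in> carrier A" if "z \<in> tail l" for z using that by (simp add: tail_def)
  have "approximates m (hat_mult (hat_mult P Q) R) (a \<otimes> b \<otimes> c)"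
    using approximates_mult[OF hat_mult_closed[OF P Q] R approximates_mult[OF P Q a(1) b(1) a(2)] c b(2)] .
  moreover have "\<forall>z\<in>tail l. z \<otimes> (b \<otimes> c) \<in> tail m"
    using a(2) b(2) bc cc tl by (simp add: m_assoc[symmetric])
  then have "approximates m (hat_mult P (hat_mult Q R)) (a \<otimes> (b \<otimes> c))"
    by (rule approximates_mult[OF P hat_mult_closed[OF Q R] a(1) approximates_mult[OF Q R b(1) c b(2)]])
  ultimately show "\<exists>a. approximates m (hat_mult (hat_mult P Q) R) a \<and>
      approximates m (hat_mult P (hat_mult Q R)) a"
    using ac bc cc by (auto simp: m_assoc)
qed

lemma hat_simps:
  "P \<otimes>\<^bsub>hat\<^esub> Q = hat_mult P Q" "P \<oplus>\<^bsub>hat\<^esub> Q = (\<lambda>k. P k \<oplus> Q k)" "\<zero>\<^bsub>hat\<^esub> = (\<lambda>k. \<zero>)"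
  "\<one>\<^bsub>hat\<^esub> = (\<lambda>k. if k = 0 then \<one> else \<zero>)" "c \<odot>\<^bsub>hat\<^esub> P = (\<lambda>k. c \<odot> P k)"
  "P \<in> carrier hat \<longleftrightarrow> (\<forall>k. P k \<in> G k)"
  by (simp_all add: hat_def)

lemma approximates_hat_add:
  "approximates n P a \<Longrightarrow> approximates n Q b \<Longrightarrow> approximates n (P \<oplus>\<^bsub>hat\<^esub> Q) (a \<oplus> b)"
  using comp_linear by (simp add: approximates_def hat_simps linear_mapD)

lemma approximates_hat_smult:
  "approximates n P a \<Longrightarrow> approximates n (c \<odot>\<^bsub>hat\<^esub> P) (c \<odot> a)"
  using comp_linear by (simp add: approximates_def hat_simps linear_mapD)

lemma approximates_hat_one: "approximates n \<one>\<^bsub>hat\<^esub> \<one>"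
  using comp_G[OF one_G] by (auto simp: approximates_def hat_simps)

lemma hat_closure:
  "P \<in> carrier hat \<Longrightarrow> Q \<in> carrier hat \<Longrightarrow> P \<oplus>\<^bsub>hat\<^esub> Q \<in> carrier hat"
  "P \<in> carrier hat \<Longrightarrow> c \<odot>\<^bsub>hat\<^esub> P \<in> carrier hat"
  "\<zero>\<^bsub>hat\<^esub> \<in> carrier hat" "\<one>\<^bsub>hat\<^esub> \<in> carrier hat"
  using one_G by (auto simp: hat_simps subspaceD[OF subspace_G])

lemma hat_one_left:
  assumes P: "P \<in> carrier hat"
  shows "\<one>\<^bsub>hat\<^esub> \<otimes>\<^bsub>hat\<^esub> P = P"
proof (rule hat_eqI)
  fix m
  obtain a where a: "approximates m P a" using approximates_trunc[OF P] by blast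
  then have ac: "a \<in> carrier A" by (simp add: approximates_def)
  obtain n where n: "\<forall>z\<in>tail n. z \<otimes> a \<in> tail m" using tail_right_continuous[OF ac] by blast
  show "\<exists>a. approximates m (\<one>\<^bsub>hat\<^esub> \<otimes>\<^bsub>hat\<^esub> P) a \<and> approximates m P a"
    using approximates_mult[OF hat_closure(4) P approximates_hat_one a n] a ac
    by (auto simp: hat_simps(1))
qed

lemma hat_one_right:
  assumes P: "P \<in> carrier hat"
  shows "P \<otimes>\<^bsub>hat\<^esub> \<one>\<^bsub>hat\<^esub> = P"
proof (rule hat_eqI)
  fix m
  obtain a where a: "approximates m P a" using approximates_trunc[OF P] by blast
  then have ac: "a \<in> carrier A" by (simp add: approximates_def)
  have n: "\<forall>z\<in>tail m. z \<otimes> \<one> \<in> tail m" by (simp add: tail_def)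
  show "\<exists>a. approximates m (P \<otimes>\<^bsub>hat\<^esub> \<one>\<^bsub>hat\<^esub>) a \<and> approximates m P a"
    using approximates_mult[OF P hat_closure(4) a approximates_hat_one n] a ac
    by (auto simp: hat_simps(1))
qed

lemma hat_distrib_right:
  assumes P: "P \<in> carrier hat" and Q: "Q \<in> carrier hat" and R: "R \<in> carrier hat"
  shows "(P \<oplus>\<^bsub>hat\<^esub> Q) \<otimes>\<^bsub>hat\<^esub> R = P \<otimes>\<^bsub>hat\<^esub> R \<oplus>\<^bsub>hat\<^esub> Q \<otimes>\<^bsub>hat\<^esub> R"
proof (rule hat_eqI)
  fix m
  obtain c where c: "approximates m R c" using approximates_trunc[OF R] by blast
  then have cc: "c \<in> carrier A" by (simp add: approximates_def)
  obtain n a where a: "approximates n P a" "\<forall>z\<in>tail n. z \<otimes> c \<in> tail m"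
    using approximates_pair[OF P cc] .
  obtain b where b: "approximates n Q b" using approximates_trunc[OF Q] by blast
  have "a \<in> carrier A" "b \<in> carrier A" using a b by (auto simp: approximates_def)
  then show "\<exists>a. approximates m ((P \<oplus>\<^bsub>hat\<^esub> Q) \<otimes>\<^bsub>hat\<^esub> R) a \<and>
      approximates m (P \<otimes>\<^bsub>hat\<^esub> R \<oplus>\<^bsub>hat\<^esub> Q \<otimes>\<^bsub>hat\<^esub> R) a"
    using approximates_mult[OF hat_closure(1)[OF P Q] R approximates_hat_add[OF a(1) b] c a(2)]
      approximates_hat_add[OF approximates_mult[OF P R a(1) c a(2)] approximates_mult[OF Q R b c a(2)]] cc
    by (auto simp: hat_simps(1) l_distr)
qed

lemma hat_distrib_left:
  assumes P: "P \<in> carrier hat" and Q: "Q \<in> carrier hat" and R: "R \<in> carrier hat"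
  shows "R \<otimes>\<^bsub>hat\<^esub> (P \<oplus>\<^bsub>hat\<^esub> Q) = R \<otimes>\<^bsub>hat\<^esub> P \<oplus>\<^bsub>hat\<^esub> R \<otimes>\<^bsub>hat\<^esub> Q"
proof (rule hat_eqI)
  fix m
  obtain a b where ab: "approximates m P a" "approximates m Q b"
    using approximates_trunc P Q by blast
  then have abc: "a \<in> carrier A" "b \<in> carrier A" by (auto simp: approximates_def)
  obtain n where n: "\<forall>y\<in>{a, b}. \<forall>z\<in>tail n. z \<otimes> y \<in> tail m"
    using tail_right_continuous_finite[of "{a, b}" m] abc by blast
  then have "\<forall>z\<in>tail n. z \<otimes> (a \<oplus> b) \<in> tail m"
    using abc subspaceD[OF subspace_tail] by (auto simp: r_distr)
  moreover obtain c where c: "approximates n R c" using approximates_trunc[OF R] by blast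
  ultimately have "approximates m (R \<otimes>\<^bsub>hat\<^esub> (P \<oplus>\<^bsub>hat\<^esub> Q)) (c \<otimes> (a \<oplus> b))"
    using approximates_mult[OF R hat_closure(1)[OF P Q] c approximates_hat_add[OF ab]]
    by (simp add: hat_simps(1))
  moreover have "approximates m (R \<otimes>\<^bsub>hat\<^esub> P \<oplus>\<^bsub>hat\<^esub> R \<otimes>\<^bsub>hat\<^esub> Q) (c \<otimes> a \<oplus> c \<otimes> b)"
    unfolding hat_simps(1)
    using n approximates_hat_add approximates_mult[OF R P c ab(1)] approximates_mult[OF R Q c ab(2)]
    by simp
  moreover have "c \<in> carrier A" using c by (simp add: approximates_def)
  ultimately show "\<exists>a. approximates m (R \<otimes>\<^bsub>hat\<^esub> (P \<oplus>\<^bsub>hat\<^esub> Q)) a \<and>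
      approximates m (R \<otimes>\<^bsub>hat\<^esub> P \<oplus>\<^bsub>hat\<^esub> R \<otimes>\<^bsub>hat\<^esub> Q) a"
    using abc by (auto simp: r_distr)
qed

lemma hat_scale_left:
  assumes P: "P \<in> carrier hat" and Q: "Q \<in> carrier hat"
  shows "(c \<odot>\<^bsub>hat\<^esub> P) \<otimes>\<^bsub>hat\<^esub> Q = c \<odot>\<^bsub>hat\<^esub> (P \<otimes>\<^bsub>hat\<^esub> Q)"
proof (rule hat_eqI)
  fix m
  obtain b where b: "approximates m Q b" using approximates_trunc[OF Q] by blast
  then have bc: "b \<in> carrier A" by (simp add: approximates_def)
  obtain n a where a: "approximates n P a" "\<forall>z\<in>tail n. z \<otimes> b \<in> tail m"
    using approximates_pair[OF P bc] .
  have "a \<in> carrier A" using a by (auto simp: approximates_def)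
  then show "\<exists>a. approximates m ((c \<odot>\<^bsub>hat\<^esub> P) \<otimes>\<^bsub>hat\<^esub> Q) a \<and>
      approximates m (c \<odot>\<^bsub>hat\<^esub> (P \<otimes>\<^bsub>hat\<^esub> Q)) a"
    using approximates_mult[OF hat_closure(2)[OF P] Q approximates_hat_smult[OF a(1)] b a(2)]
      approximates_hat_smult[OF approximates_mult[OF P Q a(1) b a(2)]] bc
    by (auto simp: hat_simps(1) smult_mult_left)
qed

lemma hat_scale_right:
  assumes P: "P \<in> carrier hat" and Q: "Q \<in> carrier hat"
  shows "P \<otimes>\<^bsub>hat\<^esub> (c \<odot>\<^bsub>hat\<^esub> Q) = c \<odot>\<^bsub>hat\<^esub> (P \<otimes>\<^bsub>hat\<^esub> Q)"
proof (rule hat_eqI)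
  fix m
  obtain b where b: "approximates m Q b" using approximates_trunc[OF Q] by blast
  then have bc: "b \<in> carrier A" by (simp add: approximates_def)
  obtain n a where a: "approximates n P a" "\<forall>z\<in>tail n. z \<otimes> b \<in> tail m"
    using approximates_pair[OF P bc] .
  have ac: "a \<in> carrier A" using a by (auto simp: approximates_def)
  have "\<forall>z\<in>tail n. z \<otimes> (c \<odot> b) \<in> tail m"
    using a(2) bc subspaceD[OF subspace_tail] by (auto simp: smult_mult_right)
  then show "\<exists>a. approximates m (P \<otimes>\<^bsub>hat\<^esub> (c \<odot>\<^bsub>hat\<^esub> Q)) a \<and>
      approximates m (c \<odot>\<^bsub>hat\<^esub> (P \<otimes>\<^bsub>hat\<^esub> Q)) a"
    using approximates_mult[OF P hat_closure(2)[OF Q] a(1) approximates_hat_smult[OF b]]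
      approximates_hat_smult[OF approximates_mult[OF P Q a(1) b a(2)]] ac bc
    by (auto simp: hat_simps(1) smult_mult_right)
qed

theorem complex_algebra_hat: "complex_algebra hat"
proof -
  have c: "P k \<in> carrier A" if "P \<in> carrier hat" for P k using hat_closed[OF that] .
  have ab: "abelian_group hat"
  proof (rule abelian_groupI)
    show "\<exists>y\<in>carrier hat. y \<oplus>\<^bsub>hat\<^esub> x = \<zero>\<^bsub>hat\<^esub>" if "x \<in> carrier hat" for x
    proof (rule bexI[of _ "(- 1) \<odot>\<^bsub>hat\<^esub> x"])
      show "(- 1) \<odot>\<^bsub>hat\<^esub> x \<oplus>\<^bsub>hat\<^esub> x = \<zero>\<^bsub>hat\<^esub>"
        using c[OF that] by (simp add: hat_simps scale_minus_one l_neg)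
    qed (rule hat_closure(2)[OF that])
  qed (use c hat_closure in \<open>auto simp: hat_simps(2,3) a_ac\<close>)
  have "Group.monoid hat"
    using hat_closure hat_mult_closed hat_mult_assoc hat_one_left hat_one_right
    by (intro monoidI) (simp_all add: hat_simps(1))
  then have "ring hat"
    using ab hat_distrib_left hat_distrib_right by (intro ringI) auto
  moreover have "module complex_field hat"
    using c hat_closure
    by (intro moduleI ab cring_from_type_algebra) (auto simp: hat_simps(2,5) scale_simps)
  ultimately show ?thesis
    using hat_scale_left hat_scale_right
    by (intro complex_algebra.intro complex_algebra_axioms.intro) auto
qed

end


section \<open>Presented algebras and their gradings\<close>

text \<open>
  Bilinear identities between elements of free algebras are checked on monomials.
\<close>

lemma poly_mapping_additive_induct:
  fixes p :: "'k \<Rightarrow>\<^sub>0 'c::comm_monoid_add"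
  assumes "\<And>k c. P (Poly_Mapping.single k c)" "\<And>p q. P p \<Longrightarrow> P q \<Longrightarrow> P (p + q)"
  shows "P p"
proof (induction p rule: update_induct)
  case const
  show ?case using assms(1)[of undefined 0] by simp
next
  case (update f a b)
  have "Poly_Mapping.update a b f = f + Poly_Mapping.single a b"
    using update(1) by (intro poly_mapping_eqI)
      (auto simp: lookup_update lookup_add lookup_single in_keys_iff when_def)
  then show ?case using assms update by simp
qed

lemma fscale_single: "c \<cdot>\<^sub>C Poly_Mapping.single k a = Poly_Mapping.single k (c * a)"
  by (rule poly_mapping_eqI) (simp add: lookup_single when_def)

lemma fscale_add:
  "c \<cdot>\<^sub>C (p + q) = c \<cdot>\<^sub>C p + c \<cdot>\<^sub>C q" "(c + d) \<cdot>\<^sub>C p = c \<cdot>\<^sub>C p + d \<cdot>\<^sub>C p"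
  by (rule poly_mapping_eqI; simp add: lookup_add algebra_simps)+

lemma fscale_assoc: "(c * d) \<cdot>\<^sub>C p = c \<cdot>\<^sub>C (d \<cdot>\<^sub>C p)"
  by (rule poly_mapping_eqI) simp

lemma fscale_one [simp]: "1 \<cdot>\<^sub>C p = p"
  by (rule poly_mapping_eqI) simp

lemma fscale_uminus: "(- c) \<cdot>\<^sub>C p = - (c \<cdot>\<^sub>C p)"
  by (rule poly_mapping_eqI) simp

lemma fscale_mult_left: "(c \<cdot>\<^sub>C p) * q = c \<cdot>\<^sub>C (p * (q :: 'g free_alg))"
proof (induction p rule: poly_mapping_additive_induct)
  case (1 k a)
  show ?case
    by (induction q rule: poly_mapping_additive_induct)
       (simp_all add: fscale_single mult_single fscale_add distrib_left mult_ac)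
qed (simp add: fscale_add distrib_right)

lemma fscale_mult_right: "p * (c \<cdot>\<^sub>C q) = c \<cdot>\<^sub>C (p * (q :: 'g free_alg))"
proof (induction p rule: poly_mapping_additive_induct)
  case (1 k a)
  show ?case
    by (induction q rule: poly_mapping_additive_induct)
       (simp_all add: fscale_single mult_single fscale_add distrib_left mult_ac)
qed (simp add: fscale_add distrib_right)

lemma free_algebra_simps [simp]:
  "carrier free_algebra = UNIV" "p \<otimes>\<^bsub>free_algebra\<^esub> q = p * q" "p \<oplus>\<^bsub>free_algebra\<^esub> q = p + q"
  "\<one>\<^bsub>free_algebra\<^esub> = 1" "\<zero>\<^bsub>free_algebra\<^esub> = 0" "c \<odot>\<^bsub>free_algebra\<^esub> p = c \<cdot>\<^sub>C p"
  by (simp_all add: free_algebra_def ring_of_type_algebra_def ring.extend_def module.fields_def)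

lemma ring_free_algebra: "ring (free_algebra :: (complex, 'g free_alg) module)"
proof (rule ringI)
  show "abelian_group (free_algebra :: (complex, 'g free_alg) module)"
  proof (rule abelian_groupI)
    show "\<exists>y\<in>carrier free_algebra. y \<oplus>\<^bsub>free_algebra\<^esub> x = \<zero>\<^bsub>free_algebra\<^esub>" for x :: "'g free_alg"
      by (rule bexI[of _ "- x"]) simp_all
  qed (simp_all add: algebra_simps)
  show "Group.monoid (free_algebra :: (complex, 'g free_alg) module)"
    by (rule monoidI) (simp_all add: algebra_simps)
qed (simp_all add: algebra_simps)

definition relation_ideal :: "'g free_alg set \<Rightarrow> 'g free_alg set" where
  "relation_ideal R = Idl\<^bsub>free_algebra\<^esub> R"

definition presented_class :: "'g free_alg set \<Rightarrow> 'g free_alg \<Rightarrow> 'g free_alg set" where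
  "presented_class R p = relation_ideal R +>\<^bsub>free_algebra\<^esub> p"

lemma presented_gen_class: "presented_gen R a = presented_class R (gen a)"
  by (simp add: presented_gen_def presented_class_def relation_ideal_def)

lemma ideal_relation_ideal: "ideal (relation_ideal R) free_algebra"
  unfolding relation_ideal_def by (rule ring.genideal_ideal[OF ring_free_algebra]) simp

lemma relation_ideal_superset: "R \<subseteq> relation_ideal R"
  unfolding relation_ideal_def by (rule ring.genideal_self[OF ring_free_algebra]) simp

lemma free_algebra_minus: "\<ominus>\<^bsub>free_algebra\<^esub> p = - (p :: 'g free_alg)"
  using abelian_group.minus_equality[OF ring.is_abelian_group[OF ring_free_algebra], of "- p" p] by simp

lemma relation_ideal_closed:
  "0 \<in> relation_ideal R"
  "p \<in> relation_ideal R \<Longrightarrow> q \<in> relation_ideal R \<Longrightarrow> p + q \<in> relation_ideal R"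
  "p \<in> relation_ideal R \<Longrightarrow> - p \<in> relation_ideal R"
  "p \<in> relation_ideal R \<Longrightarrow> q * p \<in> relation_ideal R"
  "p \<in> relation_ideal R \<Longrightarrow> p * q \<in> relation_ideal R"
  "p \<in> relation_ideal R \<Longrightarrow> q \<in> relation_ideal R \<Longrightarrow> p - q \<in> relation_ideal R"
  "p \<in> relation_ideal R \<Longrightarrow> c \<cdot>\<^sub>C p \<in> relation_ideal R"
proof -
  interpret ideal "relation_ideal R" free_algebra by (rule ideal_relation_ideal)
  show 1: "0 \<in> relation_ideal R"
    "p \<in> relation_ideal R \<Longrightarrow> q \<in> relation_ideal R \<Longrightarrow> p + q \<in> relation_ideal R"
    "p \<in> relation_ideal R \<Longrightarrow> q * p \<in> relation_ideal R"
    "p \<in> relation_ideal R \<Longrightarrow> p * q \<in> relation_ideal R" for p q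
    using additive_subgroup.zero_closed[OF additive_subgroup_axioms]
      additive_subgroup.a_closed[OF additive_subgroup_axioms, of p q] I_l_closed[of p q] I_r_closed[of p q]
    by simp_all
  show 2: "p \<in> relation_ideal R \<Longrightarrow> - p \<in> relation_ideal R" for p
    using 1(3)[of p "- 1"] by simp
  show "p \<in> relation_ideal R \<Longrightarrow> q \<in> relation_ideal R \<Longrightarrow> p - q \<in> relation_ideal R"
    using 1(2)[of p "- q"] 2[of q] by simp
  show "p \<in> relation_ideal R \<Longrightarrow> c \<cdot>\<^sub>C p \<in> relation_ideal R"
    using 1(3)[of p "c \<cdot>\<^sub>C 1"] by (simp add: fscale_mult_left)
qed

lemma presented_class_eq_iff: "presented_class R p = presented_class R q \<longleftrightarrow> p - q \<in> relation_ideal R"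
proof -
  have *: "presented_class R p = {a. a - p \<in> relation_ideal R}" for p
  proof -
    have "a \<in> presented_class R p \<longleftrightarrow> a - p \<in> relation_ideal R" for a
    proof -
      have "a \<in> presented_class R p \<longleftrightarrow> (\<exists>h\<in>relation_ideal R. a = h + p)"
        by (auto simp: presented_class_def a_r_coset_def r_coset_def)
      also have "\<dots> \<longleftrightarrow> a - p \<in> relation_ideal R"
      proof
        assume "a - p \<in> relation_ideal R"
        then show "\<exists>h\<in>relation_ideal R. a = h + p" by (rule bexI[rotated]) simp
      qed auto
      finally show ?thesis .
    qed
    then show ?thesis by auto
  qed
  show ?thesis
  proof
    assume "presented_class R p = presented_class R q"
    moreover have "p \<in> presented_class R p" unfolding * using relation_ideal_closed(1)[of R] by simp
    ultimately have "p \<in> presented_class R q" by simp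
    then show "p - q \<in> relation_ideal R" unfolding * by simp
  next
    assume pq: "p - q \<in> relation_ideal R"
    have "a - p \<in> relation_ideal R \<longleftrightarrow> a - q \<in> relation_ideal R" for a
      using relation_ideal_closed(2)[OF _ pq, of "a - p"] relation_ideal_closed(6)[OF _ pq, of "a - q"]
      by auto
    then show "presented_class R p = presented_class R q" unfolding * by auto
  qed
qed

lemma presented_algebra_simps:
  "carrier (presented_algebra R) = range (presented_class R)"
  "presented_class R p \<otimes>\<^bsub>presented_algebra R\<^esub> presented_class R q = presented_class R (p * q)"
  "presented_class R p \<oplus>\<^bsub>presented_algebra R\<^esub> presented_class R q = presented_class R (p + q)"
  "\<one>\<^bsub>presented_algebra R\<^esub> = presented_class R 1"
  "\<zero>\<^bsub>presented_algebra R\<^esub> = presented_class R 0"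
  "c \<odot>\<^bsub>presented_algebra R\<^esub> presented_class R p = presented_class R (c \<cdot>\<^sub>C p)"
proof -
  interpret ideal "relation_ideal R" free_algebra by (rule ideal_relation_ideal)
  note defs = presented_algebra_def quotient_algebra_def ring.extend_def module.fields_def
    FactRing_def relation_ideal_def[symmetric]
  show "carrier (presented_algebra R) = range (presented_class R)"
    by (auto simp: defs A_RCOSETS_def RCOSETS_def presented_class_def a_r_coset_def)
  show "presented_class R p \<otimes>\<^bsub>presented_algebra R\<^esub> presented_class R q = presented_class R (p * q)"
    using rcoset_mult_add[of p q] by (simp add: defs presented_class_def)
  show "presented_class R p \<oplus>\<^bsub>presented_algebra R\<^esub> presented_class R q = presented_class R (p + q)"
    using a_rcos_sum[of p q] by (simp add: defs presented_class_def)
  show "\<one>\<^bsub>presented_algebra R\<^esub> = presented_class R 1"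
    by (simp add: defs presented_class_def)
  show "\<zero>\<^bsub>presented_algebra R\<^esub> = presented_class R 0"
    by (auto simp: defs presented_class_def a_r_coset_def r_coset_def)
  have "c \<odot>\<^bsub>presented_algebra R\<^esub> presented_class R p =
      (\<Union>x\<in>presented_class R p. presented_class R (c \<cdot>\<^sub>C x))"
    by (simp add: defs presented_class_def)
  also have "\<dots> = (\<Union>x\<in>presented_class R p. presented_class R (c \<cdot>\<^sub>C p))"
  proof (rule SUP_cong[OF refl])
    fix x assume "x \<in> presented_class R p"
    then obtain h where "h \<in> relation_ideal R" "x = h + p"
      by (auto simp: presented_class_def a_r_coset_def r_coset_def)
    then have "c \<cdot>\<^sub>C x - c \<cdot>\<^sub>C p \<in> relation_ideal R"
      by (simp add: fscale_add relation_ideal_closed(7))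
    then show "presented_class R (c \<cdot>\<^sub>C x) = presented_class R (c \<cdot>\<^sub>C p)"
      by (simp add: presented_class_eq_iff)
  qed
  also have "\<dots> = presented_class R (c \<cdot>\<^sub>C p)"
    using a_rcos_self[of p] by (auto simp: presented_class_def)
  finally show "c \<odot>\<^bsub>presented_algebra R\<^esub> presented_class R p = presented_class R (c \<cdot>\<^sub>C p)" .
qed

lemma complex_algebra_presented: "complex_algebra (presented_algebra R)"
proof -
  note [simp] = presented_algebra_simps
  have ab: "abelian_group (presented_algebra R)"
  proof (rule abelian_groupI)
    show "\<exists>y\<in>carrier (presented_algebra R). y \<oplus>\<^bsub>presented_algebra R\<^esub> x = \<zero>\<^bsub>presented_algebra R\<^esub>"
      if x: "x \<in> carrier (presented_algebra R)" for x
    proof -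
      obtain p where p: "x = presented_class R p" using x by auto
      show ?thesis by (rule bexI[of _ "presented_class R (- p)"]) (simp_all add: p)
    qed
  qed (auto simp: algebra_simps)
  have "Group.monoid (presented_algebra R)" by (rule monoidI) (auto simp: algebra_simps)
  then have "ring (presented_algebra R)" using ab by (intro ringI) (auto simp: algebra_simps)
  moreover have "module complex_field (presented_algebra R)"
    by (intro moduleI ab cring_from_type_algebra) (auto simp: fscale_add fscale_assoc)
  ultimately show ?thesis
    by (intro complex_algebra.intro complex_algebra_axioms.intro)
       (auto simp: fscale_mult_left fscale_mult_right)
qed

lemma single_Cons_word:
  "Poly_Mapping.single (Word (a # w)) c = gen a * (Poly_Mapping.single (Word w) c :: 'g free_alg)"
  by (simp add: gen_def mult_single plus_word_def)

text \<open>
  This makes the left induction principle for generated subalgebras available for the whole algebra.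
\<close>

lemma carrier_presented_generated:
  "carrier (presented_algebra R) =
     subalgebra_generated (presented_algebra R) (range (presented_gen R))"
proof -
  interpret complex_algebra "presented_algebra R" by (rule complex_algebra_presented)
  let ?S = "subalgebra_generated (presented_algebra R) (range (presented_gen R))"
  have gens: "range (presented_gen R) \<subseteq> carrier (presented_algebra R)"
    by (auto simp: presented_gen_class presented_algebra_simps)
  note sub = subspaceD[OF generated_subspace[OF gens]]
  have word: "presented_class R (Poly_Mapping.single (Word w) 1) \<in> ?S" for w
  proof (induction w)
    case Nil
    have "Poly_Mapping.single (Word []) 1 = (1 :: 'a free_alg)"
      by (subst zero_word_def[symmetric]) simp
    then have "presented_class R (Poly_Mapping.single (Word []) 1) = \<one>\<^bsub>presented_algebra R\<^esub>"
      by (simp only: presented_algebra_simps(4))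
    then show ?case using generated_one by (simp only:)
  next
    case (Cons a w)
    have "presented_gen R a \<otimes>\<^bsub>presented_algebra R\<^esub> presented_class R (Poly_Mapping.single (Word w) 1) =
        presented_class R (Poly_Mapping.single (Word (a # w)) 1)"
      by (simp only: single_Cons_word presented_gen_class presented_algebra_simps(2))
    moreover have "presented_gen R a \<in> ?S" by (rule subsetD[OF generated_superset rangeI])
    ultimately show ?case using generated_mult[OF _ Cons, of "presented_gen R a"] by (simp only:)
  qed
  have "presented_class R p \<in> ?S" for p
  proof (induction p rule: poly_mapping_additive_induct)
    case (1 k c)
    have "Poly_Mapping.single k c = c \<cdot>\<^sub>C Poly_Mapping.single (Word (letters k)) 1"
      by (simp add: fscale_single)
    then show ?case
      using sub(4)[OF word[of "letters k"], of c] by (simp only: presented_algebra_simps)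
  next
    case (2 p q)
    then show ?case using sub(3)[of "presented_class R p" "presented_class R q"]
      by (simp only: presented_algebra_simps)
  qed
  then have "carrier (presented_algebra R) \<subseteq> ?S" by (auto simp: presented_algebra_simps(1))
  moreover have "?S \<subseteq> carrier (presented_algebra R)" using sub(1) by blast
  ultimately show ?thesis by (rule subset_antisym)
qed

definition homogeneous :: "nat \<Rightarrow> 'g free_alg \<Rightarrow> bool" where
  "homogeneous d p \<longleftrightarrow> (\<forall>w\<in>Poly_Mapping.keys p. length (letters w) = d)"

definition degree_part :: "nat \<Rightarrow> 'g free_alg \<Rightarrow> 'g free_alg" where
  "degree_part d p =
     (\<Sum>w | w \<in> Poly_Mapping.keys p \<and> length (letters w) = d. Poly_Mapping.single w (Poly_Mapping.lookup p w))"

lemma lookup_degree_part: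
  "Poly_Mapping.lookup (degree_part d p) w = (if length (letters w) = d then Poly_Mapping.lookup p w else 0)"
proof -
  let ?W = "{w \<in> Poly_Mapping.keys p. length (letters w) = d}"
  have "Poly_Mapping.lookup (degree_part d p) w =
      (\<Sum>v\<in>?W. if v = w then Poly_Mapping.lookup p v else 0)"
    unfolding degree_part_def lookup_sum lookup_single when_def by (rule refl)
  also have "\<dots> = (if w \<in> ?W then Poly_Mapping.lookup p w else 0)"
    by (rule sum.delta) simp
  also have "\<dots> = (if length (letters w) = d then Poly_Mapping.lookup p w else 0)"
    by (cases "Poly_Mapping.lookup p w = 0") (simp_all add: in_keys_iff)
  finally show ?thesis .
qed

lemma degree_part_linear:
  "degree_part d (p + q) = degree_part d p + degree_part d q"
  "degree_part d (p - q) = degree_part d p - degree_part d q"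
  "degree_part d (c \<cdot>\<^sub>C p) = c \<cdot>\<^sub>C degree_part d p"
  by (rule poly_mapping_eqI; simp add: lookup_degree_part lookup_add lookup_minus)+

lemma degree_part_zero [simp]: "degree_part d 0 = 0"
  by (rule poly_mapping_eqI) (simp add: lookup_degree_part)

lemma degree_part_homogeneous:
  assumes "homogeneous d p"
  shows "degree_part m p = (if d = m then p else 0)"
proof (rule poly_mapping_eqI)
  fix w
  have "Poly_Mapping.lookup p w \<noteq> 0 \<longrightarrow> length (letters w) = d"
    using assms by (simp add: homogeneous_def in_keys_iff)
  then show "Poly_Mapping.lookup (degree_part m p) w =
      Poly_Mapping.lookup (if d = m then p else 0) w"
    by (simp add: lookup_degree_part) blast
qed

lemma degree_part_bounded: "\<exists>n. \<forall>m\<ge>n. degree_part m p = 0"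
proof -
  define n where "n = Suc (Max ((\<lambda>w. length (letters w)) ` Poly_Mapping.keys p))"
  have "length (letters w) < n" if "w \<in> Poly_Mapping.keys p" for w
    using that unfolding n_def by (simp add: le_imp_less_Suc)
  then have *: "Poly_Mapping.lookup p w = 0" if "n \<le> length (letters w)" for w
    using that by (meson in_keys_iff not_le)
  have "degree_part m p = 0" if "m \<ge> n" for m
    using that by (intro poly_mapping_eqI) (simp add: lookup_degree_part *)
  then show ?thesis by blast
qed

lemma sum_degree_parts:
  assumes "\<forall>m\<ge>n. degree_part m p = 0"
  shows "p = (\<Sum>m<n. degree_part m p)"
proof (rule poly_mapping_eqI)
  fix w
  have "Poly_Mapping.lookup (\<Sum>m<n. degree_part m p) w =
      (\<Sum>m<n. if m = length (letters w) then Poly_Mapping.lookup p w else 0)"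
    by (auto simp: lookup_sum lookup_degree_part intro!: sum.cong)
  also have "\<dots> = (if length (letters w) < n then Poly_Mapping.lookup p w else 0)" by simp
  also have "\<dots> = Poly_Mapping.lookup p w"
  proof (cases "length (letters w) < n")
    case False
    then have "Poly_Mapping.lookup (degree_part (length (letters w)) p) w = 0" using assms by simp
    then show ?thesis by (simp add: lookup_degree_part)
  qed simp
  finally show "Poly_Mapping.lookup p w = Poly_Mapping.lookup (\<Sum>m<n. degree_part m p) w" by simp
qed

lemma homogeneous_single: "homogeneous (length (letters w)) (Poly_Mapping.single w c)"
  by (simp add: homogeneous_def)

lemma homogeneous_gen: "homogeneous 1 (gen a)"
  using homogeneous_single[of "Word [a]" 1] by (simp add: gen_def)

lemma homogeneous_add: "homogeneous d p \<Longrightarrow> homogeneous d q \<Longrightarrow> homogeneous d (p + q)"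
  using keys_add[of p q] by (auto simp: homogeneous_def)

lemma homogeneous_scale: "homogeneous d p \<Longrightarrow> homogeneous d (c \<cdot>\<^sub>C p)"
  using keys_fscale[of c p] by (auto simp: homogeneous_def)

lemma homogeneous_minus:
  assumes "homogeneous d p" "homogeneous d q"
  shows "homogeneous d (p - q)"
proof -
  have "p - q = p + (- 1) \<cdot>\<^sub>C q" by (rule poly_mapping_eqI) (simp add: lookup_add lookup_minus)
  then show ?thesis
    using homogeneous_add[OF assms(1) homogeneous_scale[OF assms(2), of "- 1"]] by (simp only:)
qed

lemma homogeneous_mult: "homogeneous d p \<Longrightarrow> homogeneous e q \<Longrightarrow> homogeneous (d + e) (p * q)"
  using keys_mult[of p q] by (fastforce simp: homogeneous_def plus_word_def)

lemma homogeneous_commutator: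
  assumes "homogeneous d p" "homogeneous e q"
  shows "homogeneous (d + e) (commutator p q)"
  using homogeneous_mult[OF assms] homogeneous_mult[OF assms(2,1)]
  by (simp add: commutator_def homogeneous_minus add.commute)

lemma homogeneous_sum: "(\<And>i. i \<in> I \<Longrightarrow> homogeneous d (f i)) \<Longrightarrow> homogeneous d (sum f I)"
  by (induction I rule: infinite_finite_induct) (auto simp: homogeneous_add, auto simp: homogeneous_def)

text \<open>
  The free algebra is graded by the length of words.
\<close>

lemma degree_part_mult:
  "degree_part m (p * q) = (\<Sum>i\<le>m. degree_part i p * degree_part (m - i) q)"
proof (induction p rule: poly_mapping_additive_induct)
  case (1 u a)
  show ?case
  proof (induction q rule: poly_mapping_additive_induct)
    case (1 v b)
    let ?u = "Poly_Mapping.single u a" and ?v = "Poly_Mapping.single v b"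
    let ?k = "length (letters u)" and ?l = "length (letters v)"
    have u: "degree_part i ?u = (if ?k = i then ?u else 0)" for i
      by (rule degree_part_homogeneous[OF homogeneous_single])
    have v: "degree_part i ?v = (if ?l = i then ?v else 0)" for i
      by (rule degree_part_homogeneous[OF homogeneous_single])
    have "(\<Sum>i\<le>m. degree_part i ?u * degree_part (m - i) ?v) =
        (\<Sum>i\<le>m. if ?k = i then (if ?l = m - i then ?u * ?v else 0) else 0)"
      by (rule sum.cong) (simp_all add: u v)
    also have "\<dots> = (if ?k + ?l = m then ?u * ?v else 0)" by auto
    also have "\<dots> = degree_part m (?u * ?v)"
      by (simp add: degree_part_homogeneous[OF homogeneous_mult[OF homogeneous_single homogeneous_single]])
    finally show ?case by simp
  next
    case (2 p q)
    then show ?case by (simp add: distrib_left degree_part_linear sum.distrib)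
  qed
next
  case (2 p q)
  then show ?case by (simp add: distrib_right degree_part_linear sum.distrib)
qed

lemma relation_ideal_sum: "(\<And>i. i \<in> I \<Longrightarrow> f i \<in> relation_ideal R) \<Longrightarrow> sum f I \<in> relation_ideal R"
  by (induction I rule: infinite_finite_induct) (auto simp: relation_ideal_closed)

text \<open>
  Homogeneous relations generate a homogeneous ideal: the elements all of whose components lie in
  the ideal form an ideal.
\<close>

lemma degree_part_relation_ideal:
  assumes R: "\<And>p. p \<in> R \<Longrightarrow> \<exists>d. homogeneous d p" and p: "p \<in> relation_ideal R"
  shows "degree_part m p \<in> relation_ideal R"
proof -
  let ?I = "{p. \<forall>m. degree_part m p \<in> relation_ideal R}"
  have "ideal ?I free_algebra"
  proof (rule idealI[OF ring_free_algebra])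
    interpret F: ring "free_algebra :: (complex, 'a free_alg) module" by (rule ring_free_algebra)
    show "subgroup ?I (add_monoid free_algebra)"
    proof (rule F.add.subgroupI)
      show "\<ominus>\<^bsub>free_algebra\<^esub> a \<in> ?I" if "a \<in> ?I" for a
        using that relation_ideal_closed(3)[of _ R] degree_part_linear(2)[of _ 0 a]
        by (simp add: free_algebra_minus)
    qed (auto simp: degree_part_linear relation_ideal_closed intro: exI[of _ 0])
    show "x \<otimes>\<^bsub>free_algebra\<^esub> a \<in> ?I" "a \<otimes>\<^bsub>free_algebra\<^esub> x \<in> ?I" if "a \<in> ?I" for a x
      using that by (simp_all add: degree_part_mult relation_ideal_sum relation_ideal_closed(4,5))
  qed
  moreover have "R \<subseteq> ?I"
  proof
    fix p assume p: "p \<in> R"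
    obtain d where "homogeneous d p" using R[OF p] by blast
    then show "p \<in> ?I"
      using relation_ideal_superset[of R] p by (auto simp: degree_part_homogeneous relation_ideal_closed(1))
  qed
  ultimately have "relation_ideal R \<subseteq> ?I"
    unfolding relation_ideal_def[of R] by (rule ring.genideal_minimal[OF ring_free_algebra])
  then show ?thesis using p by blast
qed


section \<open>Linear maps out of a tensor product\<close>

lemma module_fscale: "Modules.module (fscale :: complex \<Rightarrow> ('k \<Rightarrow>\<^sub>0 complex) \<Rightarrow> _)"
  by (rule Modules.module.intro) (simp_all add: fscale_add fscale_assoc)

lemma free_triples_closed:
  "0 \<in> free_triples U V W"
  "p \<in> free_triples U V W \<Longrightarrow> q \<in> free_triples U V W \<Longrightarrow> p + q \<in> free_triples U V W"
  "p \<in> free_triples U V W \<Longrightarrow> c \<cdot>\<^sub>C p \<in> free_triples U V W"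
  "p \<in> free_triples U V W \<Longrightarrow> q \<in> free_triples U V W \<Longrightarrow> p - q \<in> free_triples U V W"
  "u \<in> U \<Longrightarrow> v \<in> V \<Longrightarrow> w \<in> W \<Longrightarrow> Poly_Mapping.single (u, v, w) c \<in> free_triples U V W"
proof -
  show add: "p \<in> free_triples U V W \<Longrightarrow> q \<in> free_triples U V W \<Longrightarrow> p + q \<in> free_triples U V W"
    for p q using keys_add[of p q] unfolding free_triples_def by blast
  show scale: "p \<in> free_triples U V W \<Longrightarrow> c \<cdot>\<^sub>C p \<in> free_triples U V W" for c p
    using keys_fscale[of c p] unfolding free_triples_def by blast
  have "p - q = p + (- 1) \<cdot>\<^sub>C q" by (rule poly_mapping_eqI) (simp add: lookup_add lookup_minus)
  then show "p \<in> free_triples U V W \<Longrightarrow> q \<in> free_triples U V W \<Longrightarrow> p - q \<in> free_triples U V W"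
    using add[of p "(- 1) \<cdot>\<^sub>C q"] scale[of q "- 1"] by (simp only:)
qed (simp_all add: free_triples_def)

context complex_algebra
begin

lemma triple_mult_extend:
  "triple_mult A p = extend_linearly (\<lambda>(u, v, w). u \<otimes> v \<otimes> w) p"
proof -
  have "(\<lambda>(u, v, w). Poly_Mapping.lookup p (u, v, w) \<odot> (u \<otimes> v \<otimes> w)) =
      (\<lambda>k. Poly_Mapping.lookup p k \<odot> (case k of (u, v, w) \<Rightarrow> u \<otimes> v \<otimes> w))"
    by (auto simp: fun_eq_iff)
  then show ?thesis unfolding triple_mult_def extend_linearly_def by (simp only:)
qed

lemma minus_cancel: "a \<in> carrier A \<Longrightarrow> b \<in> carrier A \<Longrightarrow> (a \<oplus> b) \<ominus> a \<ominus> b = \<zero>"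
  using r_neg[of "a \<oplus> b"] abelian_group.minus_add[OF ring.is_abelian_group[OF ring_A], of a b]
  by (simp add: a_minus_def a_assoc)

lemma minus_self: "a \<in> carrier A \<Longrightarrow> a \<ominus> a = \<zero>"
  by (simp add: a_minus_def r_neg)

text \<open>
  A linear map \<open>g\<close> on the third factor induces a linear map on the algebra as soon as
  multiplication identifies the algebra with the tensor product: the assignment
  \<open>(u, v, w) \<mapsto> u v g(w)\<close>, extended linearly to formal combinations of triples, kills the
  multilinearity relations.
\<close>

lemma extend_third_factor:
  assumes U: "subspace U" and V: "subspace V" and W: "subspace W"
    and g: "\<And>w. w \<in> W \<Longrightarrow> g w \<in> carrier A"
      "\<And>w w'. w \<in> W \<Longrightarrow> w' \<in> W \<Longrightarrow> g (w \<oplus> w') = g w \<oplus> g w'"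
      "\<And>c w. w \<in> W \<Longrightarrow> g (c \<odot> w) = c \<odot> g w"
    and iso: "bij_betw \<phi> (tensor3 A U V W) (carrier A)"
      "\<And>p. p \<in> free_triples U V W \<Longrightarrow> \<phi> (tensor_rel A U V W `` {p}) = triple_mult A p"
  shows "\<exists>C. linear_map C \<and> (\<forall>u\<in>U. \<forall>v\<in>V. \<forall>w\<in>W. C (u \<otimes> v \<otimes> w) = u \<otimes> v \<otimes> g w)"
proof -
  note [simp] = subspaceD(1)[OF U] subspaceD(1)[OF V] subspaceD(1)[OF W] g(1)
  note cl = subspaceD(3,4)[OF U] subspaceD(3,4)[OF V] subspaceD(3,4)[OF W]
  define f where "f = (\<lambda>(u, v, w). u \<otimes> v \<otimes> g w)"
  define t where "t = (\<lambda>(u, v, w). u \<otimes> v \<otimes> w)"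
  let ?F = "free_triples U V W" and ?e = "\<lambda>u v w. Poly_Mapping.single (u, v, w) (1::complex)"
  have fc: "f k \<in> carrier A" and tc: "t k \<in> carrier A" if "k \<in> U \<times> V \<times> W" for k
    using that by (auto simp: f_def t_def)
  have keys: "k \<in> U \<times> V \<times> W" if "p \<in> ?F" "k \<in> Poly_Mapping.keys p" for p k
    using that by (auto simp: free_triples_def)
  have closed: "extend_linearly f p \<in> carrier A" if "p \<in> ?F" for p
    by (intro extend_linearly_closed fc keys[OF that])
  have add: "extend_linearly f (p + q) = extend_linearly f p \<oplus> extend_linearly f q"
    "extend_linearly t (p + q) = extend_linearly t p \<oplus> extend_linearly t q"
    "extend_linearly f (p - q) = extend_linearly f p \<ominus> extend_linearly f q" if "p \<in> ?F" "q \<in> ?F" for p q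
    using keys that fc tc by (intro extend_linearly_add extend_linearly_diff; blast)+
  have scale: "extend_linearly f (c \<cdot>\<^sub>C p) = c \<odot> extend_linearly f p"
    "extend_linearly t (c \<cdot>\<^sub>C p) = c \<odot> extend_linearly t p" if "p \<in> ?F" for c p
    using keys that fc tc by (intro extend_linearly_scale; blast)+
  have e: "extend_linearly f (?e u v w) = u \<otimes> v \<otimes> g w" "extend_linearly t (?e u v w) = u \<otimes> v \<otimes> w"
    "?e u v w \<in> ?F"
    if "u \<in> U" "v \<in> V" "w \<in> W" for u v w
    using fc[of "(u, v, w)"] tc[of "(u, v, w)"] that
    by (simp_all add: extend_linearly_single free_triples_closed) (simp_all add: f_def t_def)
  let ?Z = "{p \<in> ?F. extend_linearly f p = \<zero>}"
  have "multilinear_relators A U V W \<subseteq> ?Z"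
    unfolding multilinear_relators_def Let_def
    by (auto simp: add scale e cl free_triples_closed l_distr r_distr g smult_mult_left smult_mult_right
        minus_cancel minus_self)
  moreover have "Modules.module.subspace (\<cdot>\<^sub>C) ?Z"
    by (rule Modules.module.subspaceI[OF module_fscale])
      (simp_all add: free_triples_closed add scale extend_linearly_zero)
  ultimately have Z: "Modules.module.span (\<cdot>\<^sub>C) (multilinear_relators A U V W) \<subseteq> ?Z"
    by (rule Modules.module.span_minimal[OF module_fscale])
  have tm: "triple_mult A p = extend_linearly t p" for p
    unfolding t_def by (rule triple_mult_extend)
  have well_defined: "extend_linearly f p = extend_linearly f q"
    if p: "p \<in> ?F" and q: "q \<in> ?F" and pq: "extend_linearly t p = extend_linearly t q" for p q
  proof -
    have "\<phi> (tensor_rel A U V W `` {p}) = \<phi> (tensor_rel A U V W `` {q})"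
      using iso(2)[OF p] iso(2)[OF q] pq by (simp add: tm)
    moreover have "tensor_rel A U V W `` {p} \<in> tensor3 A U V W" "tensor_rel A U V W `` {q} \<in> tensor3 A U V W"
      unfolding tensor3_def using p q by (auto intro: quotientI)
    ultimately have eq: "tensor_rel A U V W `` {p} = tensor_rel A U V W `` {q}"
      using iso(1) by (meson bij_betw_imp_inj_on inj_onD)
    have "q \<in> tensor_rel A U V W `` {q}"
      using q Modules.module.span_zero[OF module_fscale] by (simp add: tensor_rel_def)
    then have "(p, q) \<in> tensor_rel A U V W" unfolding eq[symmetric] by simp
    then have "p - q \<in> ?Z" using Z by (auto simp: tensor_rel_def)
    then have "extend_linearly f p \<ominus> extend_linearly f q = \<zero>" using p q by (simp add: add)
    then show ?thesis using closed[OF p] closed[OF q] by (simp add: ring.r_right_minus_eq[OF ring_A])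
  qed
  have surj: "\<exists>p\<in>?F. extend_linearly t p = y" if y: "y \<in> carrier A" for y
  proof -
    obtain T where T: "T \<in> tensor3 A U V W" "\<phi> T = y"
      using y bij_betw_imp_surj_on[OF iso(1)] by (metis imageE)
    then obtain p where "p \<in> ?F" "T = tensor_rel A U V W `` {p}"
      unfolding tensor3_def by (metis quotientE)
    then show ?thesis using T iso(2) tm by auto
  qed
  define C where "C y = extend_linearly f (SOME p. p \<in> ?F \<and> extend_linearly t p = y)" for y
  have C: "C (extend_linearly t p) = extend_linearly f p" if "p \<in> ?F" for p
  proof -
    let ?q = "SOME q. q \<in> ?F \<and> extend_linearly t q = extend_linearly t p"
    have "?q \<in> ?F \<and> extend_linearly t ?q = extend_linearly t p" by (rule someI[of _ p]) (simp add: that)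
    then show ?thesis unfolding C_def using well_defined that by blast
  qed
  have "linear_map C"
    unfolding linear_map_def
  proof (intro conjI ballI allI)
    show "C \<in> carrier A \<rightarrow> carrier A"
    proof
      fix y assume "y \<in> carrier A"
      then obtain p where "p \<in> ?F" "extend_linearly t p = y" using surj by blast
      then show "C y \<in> carrier A" using C closed by auto
    qed
    fix y z c assume y: "y \<in> carrier A"
    obtain p where p: "p \<in> ?F" "extend_linearly t p = y" using surj[OF y] by blast
    show "C (c \<odot> y) = c \<odot> C y"
      using C[of "c \<cdot>\<^sub>C p"] C[of p] p by (simp add: scale free_triples_closed)
    assume z: "z \<in> carrier A"
    obtain q where q: "q \<in> ?F" "extend_linearly t q = z" using surj[OF z] by blast
    show "C (y \<oplus> z) = C y \<oplus> C z"
      using C[of "p + q"] C[of p] C[of q] p q by (simp add: add free_triples_closed)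
  qed
  moreover have "C (u \<otimes> v \<otimes> w) = u \<otimes> v \<otimes> g w" if "u \<in> U" "v \<in> V" "w \<in> W" for u v w
    using C[OF e(3)[OF that]] e(1,2)[OF that] by simp
  ultimately show ?thesis by blast
qed

text \<open>
  The surjective half of the isomorphism with the tensor product.
\<close>

lemma carrier_triple_products:
  assumes "bij_betw \<phi> (tensor3 A U V W) (carrier A)"
    "\<And>p. p \<in> free_triples U V W \<Longrightarrow> \<phi> (tensor_rel A U V W `` {p}) = triple_mult A p"
    and sub: "U \<subseteq> carrier A" "V \<subseteq> carrier A" "W \<subseteq> carrier A"
  shows "carrier A = linear_span A {u \<otimes> v \<otimes> w | u v w. u \<in> U \<and> v \<in> V \<and> w \<in> W}" (is "_ = linear_span A ?S")
proof
  have S: "?S \<subseteq> carrier A" using sub by blast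
  show "linear_span A ?S \<subseteq> carrier A" by (intro span_minimal subspace_carrier S)
  show "carrier A \<subseteq> linear_span A ?S"
  proof
    fix y assume "y \<in> carrier A"
    then obtain T where T: "T \<in> tensor3 A U V W" "\<phi> T = y"
      using bij_betw_imp_surj_on[OF assms(1)] by (metis imageE)
    then obtain p where p: "p \<in> free_triples U V W" "T = tensor_rel A U V W `` {p}"
      unfolding tensor3_def by (metis quotientE)
    then have "y = extend_linearly (\<lambda>(u, v, w). u \<otimes> v \<otimes> w) p"
      using T assms(2) triple_mult_extend by metis
    also have "\<dots> \<in> linear_span A ?S"
      using p(1) subsetD[OF span_superset[of ?S]]
      by (intro extend_linearly_subspace subspace_span S) (fastforce simp: free_triples_def)
    finally show "y \<in> linear_span A ?S" .
  qed
qed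

end

section \<open>The grading of a half of the Yangian\<close>

lemma homogeneous_shift_relator:
  assumes "\<And>r. homogeneous 1 (u r)" "\<And>s. homogeneous 1 (v s)"
  shows "homogeneous 2 (shift_relator c u v r s)"
proof -
  have "homogeneous (1 + 1) (shift_relator c u v r s)"
    unfolding shift_relator_def using assms
    by (intro homogeneous_minus homogeneous_scale homogeneous_add homogeneous_commutator homogeneous_mult)
  then show ?thesis by (simp only: one_add_one)
qed

lemma homogeneous_serre_relator:
  assumes "\<And>r. homogeneous 1 (u r)" "homogeneous 1 y"
  shows "homogeneous (b + 1) (serre_relator b u y r)"
  unfolding serre_relator_def
proof (rule homogeneous_sum)
  fix \<sigma> :: "nat \<Rightarrow> nat"
  have "homogeneous (length ks + 1) (foldr (\<lambda>k z. commutator (u (r (\<sigma> k))) z) ks y)" for ks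
  proof (induction ks)
    case (Cons k ks)
    then show ?case using homogeneous_commutator[OF assms(1) Cons] by simp
  qed (simp add: assms(2)[unfolded One_nat_def])
  from this[of "[0..<b]"]
  show "homogeneous (b + 1) (foldr (\<lambda>k z. commutator (u (r (\<sigma> k))) z) [0..<b] y)" by simp
qed

lemma homogeneous_half_relators:
  assumes "\<And>i r. homogeneous 1 (x i r)" "p \<in> half_relators \<gg> \<epsilon> x"
  shows "\<exists>d. homogeneous d p"
  using assms(2) homogeneous_shift_relator[of "x i" "x j" for i j, OF assms(1) assms(1)]
    homogeneous_serre_relator[of "x i" "x j s" for i j s, OF assms(1) assms(1)]
  unfolding half_relators_def by blast

text \<open>
  The degree of words becomes a grading of either half: the free algebra maps onto it and the
  kernel is homogeneous.
\<close>

lemma half_parametrization: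
  fixes \<gg> :: "('i, 'h::ab_group_add) cartan_datum"
  assumes "yangian_halves_presented \<gg>"
  obtains \<psi> :: "('i \<times> nat) free_alg \<Rightarrow> ('i, 'h) yangian_elem"
  where "range \<psi> = Y_pm \<gg> \<epsilon>"
    "\<And>p q. \<psi> (p + q) = \<psi> p \<oplus>\<^bsub>yangian \<gg>\<^esub> \<psi> q" "\<And>p q. \<psi> (p * q) = \<psi> p \<otimes>\<^bsub>yangian \<gg>\<^esub> \<psi> q"
    "\<And>c p. \<psi> (c \<cdot>\<^sub>C p) = c \<odot>\<^bsub>yangian \<gg>\<^esub> \<psi> p" "\<psi> 1 = \<one>\<^bsub>yangian \<gg>\<^esub>"
    "\<And>i r. \<psi> (gen (i, r)) = yx \<gg> \<epsilon> i r"
    "\<And>p q m. \<psi> p = \<psi> q \<Longrightarrow> \<psi> (degree_part m p) = \<psi> (degree_part m q)"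
proof -
  define R where "R = half_relators \<gg> \<epsilon> (\<lambda>i r. gen (i, r))"
  let ?Y = "(yangian \<gg>)\<lparr>carrier := Y_pm \<gg> \<epsilon>\<rparr>"
  obtain \<phi> where \<phi>: "\<phi> \<in> algebra_iso (presented_algebra R) ?Y"
    and gen: "\<And>i r. \<phi> (presented_gen R (i, r)) = yx \<gg> \<epsilon> i r"
    using assms unfolding yangian_halves_presented_def Let_def R_def by blast
  have hom: "\<phi> \<in> ring_hom (presented_algebra R) ?Y"
    and bij: "bij_betw \<phi> (range (presented_class R)) (Y_pm \<gg> \<epsilon>)"
    and smult: "\<And>c p. \<phi> (presented_class R (c \<cdot>\<^sub>C p)) = c \<odot>\<^bsub>yangian \<gg>\<^esub> \<phi> (presented_class R p)"
    using \<phi> by (auto simp: algebra_iso_def ring_iso_def presented_algebra_simps)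
  define \<psi> where "\<psi> p = \<phi> (presented_class R p)" for p
  show ?thesis
  proof (rule that)
    show "range \<psi> = Y_pm \<gg> \<epsilon>" using bij by (auto simp: bij_betw_def \<psi>_def)
    show "\<psi> (p + q) = \<psi> p \<oplus>\<^bsub>yangian \<gg>\<^esub> \<psi> q" for p q
      using ring_hom_add[OF hom, of "presented_class R p" "presented_class R q"]
      by (simp add: presented_algebra_simps \<psi>_def)
    show "\<psi> (p * q) = \<psi> p \<otimes>\<^bsub>yangian \<gg>\<^esub> \<psi> q" for p q
      using ring_hom_mult[OF hom, of "presented_class R p" "presented_class R q"]
      by (simp add: presented_algebra_simps \<psi>_def)
    show "\<psi> 1 = \<one>\<^bsub>yangian \<gg>\<^esub>"
      using ring_hom_one[OF hom] by (simp add: presented_algebra_simps \<psi>_def)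
    show "\<psi> (c \<cdot>\<^sub>C p) = c \<odot>\<^bsub>yangian \<gg>\<^esub> \<psi> p" for c p
      by (simp add: smult \<psi>_def)
    show "\<psi> (gen (i, r)) = yx \<gg> \<epsilon> i r" for i r
      using gen by (simp add: \<psi>_def presented_gen_class)
    show "\<psi> (degree_part m p) = \<psi> (degree_part m q)" if "\<psi> p = \<psi> q" for p q m
    proof -
      have "presented_class R p = presented_class R q"
        using that bij unfolding \<psi>_def bij_betw_def by (meson inj_onD rangeI)
      then have "p - q \<in> relation_ideal R" by (simp add: presented_class_eq_iff)
      then have "degree_part m (p - q) \<in> relation_ideal R"
        using homogeneous_half_relators[OF homogeneous_gen]
        by (intro degree_part_relation_ideal) (auto simp: R_def)
      then have "presented_class R (degree_part m p) = presented_class R (degree_part m q)"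
        unfolding presented_class_eq_iff degree_part_linear .
      then show ?thesis by (simp only: \<psi>_def)
    qed
  qed
qed


section \<open>Commutation relations in the Yangian\<close>

lemma yangian_class:
  "yx \<gg> \<epsilon> i r = presented_class (yangian_relators \<gg>) (gen (XG \<epsilon> i r))"
  "yh \<gg> i r = presented_class (yangian_relators \<gg>) (gen (HG i r))"
  "yc \<gg> t = presented_class (yangian_relators \<gg>) (gen (CG t))"
  by (simp_all add: yx_def yh_def yc_def presented_gen_class)

lemma yangian_eqI:
  assumes "p - q \<in> relation_ideal (yangian_relators \<gg>)"
  shows "presented_class (yangian_relators \<gg>) p = presented_class (yangian_relators \<gg>) q"
  using assms by (simp only: presented_class_eq_iff)

locale yangian_algebra =
  fixes \<gg> :: "('i, 'h::ab_group_add) cartan_datum"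
begin

abbreviation Y :: "(complex, ('i, 'h) yangian_elem) module" where
  "Y \<equiv> yangian \<gg>"

abbreviation rel :: "('i, 'h) yangian_gen free_alg set" where
  "rel \<equiv> relation_ideal (yangian_relators \<gg>)"

sublocale complex_algebra Y
  unfolding yangian_def by (rule complex_algebra_presented)

lemma class_simps:
  "presented_class (yangian_relators \<gg>) p \<otimes>\<^bsub>Y\<^esub> presented_class (yangian_relators \<gg>) q =
     presented_class (yangian_relators \<gg>) (p * q)"
  "presented_class (yangian_relators \<gg>) p \<oplus>\<^bsub>Y\<^esub> presented_class (yangian_relators \<gg>) q =
     presented_class (yangian_relators \<gg>) (p + q)"
  "c \<odot>\<^bsub>Y\<^esub> presented_class (yangian_relators \<gg>) p = presented_class (yangian_relators \<gg>) (c \<cdot>\<^sub>C p)"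
  "\<zero>\<^bsub>Y\<^esub> = presented_class (yangian_relators \<gg>) 0"
  by (simp_all only: yangian_def presented_algebra_simps)

lemma gens_closed [simp, intro]:
  "yx \<gg> \<epsilon> i r \<in> carrier Y" "yh \<gg> i r \<in> carrier Y" "yc \<gg> t \<in> carrier Y"
  by (simp_all add: yangian_class yangian_def presented_algebra_simps(1))

lemma relators_in_rel:
  "commutator (gen (CG t)) (gen (XG \<epsilon> i r)) - (sgn_pm \<epsilon> * simple_root \<gg> i t) \<cdot>\<^sub>C gen (XG \<epsilon> i r) \<in> rel"
  "commutator (gen (HG i 0)) (gen (XG \<epsilon> j s)) - (sgn_pm \<epsilon> * root_form \<gg> i j) \<cdot>\<^sub>C gen (XG \<epsilon> j s) \<in> rel"
  "commutator (gen (XG Plus i r)) (gen (XG Minus j s)) - (if i = j then gen (HG i (r + s)) else 0) \<in> rel"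
  "shift_relator (sgn_pm \<epsilon> * root_form \<gg> i j) (\<lambda>r. gen (HG i r)) (\<lambda>s. gen (XG \<epsilon> j s)) r s \<in> rel"
  by (rule subsetD[OF relation_ideal_superset]; unfold yangian_relators_def Let_def; blast)+

text \<open>
  Each commutation relation between the Cartan part and the \<open>x\<^sub>j\<^sub>s\<close> is needed in two forms: moving
  \<open>h\<^sub>i\<^sub>r\<close> to the right of \<open>x\<^sup>-\<^sub>j\<^sub>s\<close> brings the non-positive part into normal order, and moving it to the
  left of \<open>x\<^sup>+\<^sub>j\<^sub>s\<close> controls the filtration.  All right hand sides are linear combinations with
  scalars in front, so that membership in a subspace can be read off term by term.
\<close>

lemma yc_yx:
  "yc \<gg> t \<otimes>\<^bsub>Y\<^esub> yx \<gg> \<epsilon> i r =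
     yx \<gg> \<epsilon> i r \<otimes>\<^bsub>Y\<^esub> yc \<gg> t \<oplus>\<^bsub>Y\<^esub> (sgn_pm \<epsilon> * simple_root \<gg> i t) \<odot>\<^bsub>Y\<^esub> yx \<gg> \<epsilon> i r"
  unfolding yangian_class class_simps
  using relators_in_rel(1)[of t \<epsilon> i r] by (intro yangian_eqI) (simp add: commutator_def algebra_simps)

lemma yx_yc:
  "yx \<gg> \<epsilon> i r \<otimes>\<^bsub>Y\<^esub> yc \<gg> t =
     yc \<gg> t \<otimes>\<^bsub>Y\<^esub> yx \<gg> \<epsilon> i r \<oplus>\<^bsub>Y\<^esub> (- (sgn_pm \<epsilon> * simple_root \<gg> i t)) \<odot>\<^bsub>Y\<^esub> yx \<gg> \<epsilon> i r"
  unfolding yangian_class class_simps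
  using relation_ideal_closed(3)[OF relators_in_rel(1)[of t \<epsilon> i r]]
  by (intro yangian_eqI) (simp add: commutator_def fscale_uminus algebra_simps)

lemma yh0_yx:
  "yh \<gg> i 0 \<otimes>\<^bsub>Y\<^esub> yx \<gg> \<epsilon> j s =
     yx \<gg> \<epsilon> j s \<otimes>\<^bsub>Y\<^esub> yh \<gg> i 0 \<oplus>\<^bsub>Y\<^esub> (sgn_pm \<epsilon> * root_form \<gg> i j) \<odot>\<^bsub>Y\<^esub> yx \<gg> \<epsilon> j s"
  unfolding yangian_class class_simps
  using relators_in_rel(2)[of i \<epsilon> j s] by (intro yangian_eqI) (simp add: commutator_def algebra_simps)

lemma yx_yh0:
  "yx \<gg> \<epsilon> j s \<otimes>\<^bsub>Y\<^esub> yh \<gg> i 0 =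
     yh \<gg> i 0 \<otimes>\<^bsub>Y\<^esub> yx \<gg> \<epsilon> j s \<oplus>\<^bsub>Y\<^esub> (- (sgn_pm \<epsilon> * root_form \<gg> i j)) \<odot>\<^bsub>Y\<^esub> yx \<gg> \<epsilon> j s"
  unfolding yangian_class class_simps
  using relation_ideal_closed(3)[OF relators_in_rel(2)[of i \<epsilon> j s]]
  by (intro yangian_eqI) (simp add: commutator_def fscale_uminus algebra_simps)

lemma yh_Suc_yx:
  "yh \<gg> i (Suc r) \<otimes>\<^bsub>Y\<^esub> yx \<gg> \<epsilon> j s =
     yx \<gg> \<epsilon> j s \<otimes>\<^bsub>Y\<^esub> yh \<gg> i (Suc r) \<oplus>\<^bsub>Y\<^esub> (yh \<gg> i r \<otimes>\<^bsub>Y\<^esub> yx \<gg> \<epsilon> j (Suc s) \<oplus>\<^bsub>Y\<^esub>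
     ((- 1) \<odot>\<^bsub>Y\<^esub> (yx \<gg> \<epsilon> j (Suc s) \<otimes>\<^bsub>Y\<^esub> yh \<gg> i r) \<oplus>\<^bsub>Y\<^esub>
     (sgn_pm \<epsilon> * root_form \<gg> i j / 2) \<odot>\<^bsub>Y\<^esub>
       (yh \<gg> i r \<otimes>\<^bsub>Y\<^esub> yx \<gg> \<epsilon> j s \<oplus>\<^bsub>Y\<^esub> yx \<gg> \<epsilon> j s \<otimes>\<^bsub>Y\<^esub> yh \<gg> i r)))"
  unfolding yangian_class class_simps
  using relators_in_rel(4)[of \<epsilon> i j r s]
  by (intro yangian_eqI) (simp add: shift_relator_def commutator_def fscale_uminus algebra_simps)

lemma yx_yh_Suc:
  "yx \<gg> \<epsilon> j s \<otimes>\<^bsub>Y\<^esub> yh \<gg> i (Suc r) =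
     yh \<gg> i (Suc r) \<otimes>\<^bsub>Y\<^esub> yx \<gg> \<epsilon> j s \<oplus>\<^bsub>Y\<^esub> ((- 1) \<odot>\<^bsub>Y\<^esub> (yh \<gg> i r \<otimes>\<^bsub>Y\<^esub> yx \<gg> \<epsilon> j (Suc s)) \<oplus>\<^bsub>Y\<^esub>
     (yx \<gg> \<epsilon> j (Suc s) \<otimes>\<^bsub>Y\<^esub> yh \<gg> i r \<oplus>\<^bsub>Y\<^esub>
     (- (sgn_pm \<epsilon> * root_form \<gg> i j / 2)) \<odot>\<^bsub>Y\<^esub>
       (yh \<gg> i r \<otimes>\<^bsub>Y\<^esub> yx \<gg> \<epsilon> j s \<oplus>\<^bsub>Y\<^esub> yx \<gg> \<epsilon> j s \<otimes>\<^bsub>Y\<^esub> yh \<gg> i r)))"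
  unfolding yangian_class class_simps
  using relation_ideal_closed(3)[OF relators_in_rel(4)[of \<epsilon> i j r s]]
  by (intro yangian_eqI) (simp add: shift_relator_def commutator_def fscale_uminus algebra_simps)

lemma yx_Plus_Minus:
  "yx \<gg> Plus i r \<otimes>\<^bsub>Y\<^esub> yx \<gg> Minus j s =
     yx \<gg> Minus j s \<otimes>\<^bsub>Y\<^esub> yx \<gg> Plus i r \<oplus>\<^bsub>Y\<^esub> (if i = j then yh \<gg> i (r + s) else \<zero>\<^bsub>Y\<^esub>)"
  using relators_in_rel(3)[of i r j s]
  by (cases "i = j"; simp only: yangian_class class_simps if_True if_False simp_thms;
      intro yangian_eqI) (simp_all add: commutator_def algebra_simps)

lemma carrier_generated:
  "carrier Y = subalgebra_generated Y
     ({yx \<gg> \<epsilon> i r | \<epsilon> i r. True} \<union> {yh \<gg> i r | i r. True} \<union> range (yc \<gg>))"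
proof -
  have "range (presented_gen (yangian_relators \<gg>)) =
      {yx \<gg> \<epsilon> i r | \<epsilon> i r. True} \<union> {yh \<gg> i r | i r. True} \<union> range (yc \<gg>)" (is "?L = ?R")
  proof
    show "?L \<subseteq> ?R"
    proof
      fix y assume "y \<in> ?L"
      then obtain g where "y = presented_gen (yangian_relators \<gg>) g" by blast
      then show "y \<in> ?R" by (cases g) (auto simp: yx_def yh_def yc_def)
    qed
  qed (auto simp: yx_def yh_def yc_def)
  then show ?thesis using carrier_presented_generated[of "yangian_relators \<gg>"] by (simp only: yangian_def)
qed

section \<open>Normal ordering in the non-positive part\<close>

text \<open>
  The space \<open>Y\<^sup>- Y\<^sup>0\<close>.  The triangular decomposition speaks of products \<open>u v w\<close> of its three factors,
  whereas the components of the Yangian are built from \<open>Y\<^sup>\<le>\<^sup>0\<close>; the two agree once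
  \<open>Y\<^sup>\<le>\<^sup>0 = Y\<^sup>- Y\<^sup>0\<close> is known.
\<close>

definition ordered_nonpos :: "('i, 'h) yangian_elem set" where
  "ordered_nonpos = linear_span Y {u \<otimes>\<^bsub>Y\<^esub> v | u v. u \<in> Y_pm \<gg> Minus \<and> v \<in> Y_zero \<gg>}"

lemma subspace_Y_pm: "subspace (Y_pm \<gg> \<epsilon>)" and subspace_Y_zero: "subspace (Y_zero \<gg>)"
  and subspace_Y_le_zero: "subspace (Y_le_zero \<gg>)"
  unfolding Y_pm_def Y_zero_def Y_le_zero_def by (intro generated_subspace; blast)+

lemma Y_pm_closed: "u \<in> Y_pm \<gg> \<epsilon> \<Longrightarrow> u \<in> carrier Y"
  and Y_zero_closed: "v \<in> Y_zero \<gg> \<Longrightarrow> v \<in> carrier Y"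
  and Y_le_zero_closed: "a \<in> Y_le_zero \<gg> \<Longrightarrow> a \<in> carrier Y"
  using subspaceD(1) subspace_Y_pm subspace_Y_zero subspace_Y_le_zero by blast+

lemma gens_in:
  "yx \<gg> \<epsilon> i r \<in> Y_pm \<gg> \<epsilon>" "yh \<gg> i r \<in> Y_zero \<gg>" "yc \<gg> t \<in> Y_zero \<gg>"
  unfolding Y_pm_def Y_zero_def by (rule subsetD[OF generated_superset], blast)+

lemma Y_pm_mult: "u \<in> Y_pm \<gg> \<epsilon> \<Longrightarrow> u' \<in> Y_pm \<gg> \<epsilon> \<Longrightarrow> u \<otimes>\<^bsub>Y\<^esub> u' \<in> Y_pm \<gg> \<epsilon>"
  and Y_zero_mult: "v \<in> Y_zero \<gg> \<Longrightarrow> v' \<in> Y_zero \<gg> \<Longrightarrow> v \<otimes>\<^bsub>Y\<^esub> v' \<in> Y_zero \<gg>"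
  unfolding Y_pm_def Y_zero_def by (rule generated_mult; assumption)+

lemma Y_pm_one: "\<one>\<^bsub>Y\<^esub> \<in> Y_pm \<gg> \<epsilon>" and Y_zero_one: "\<one>\<^bsub>Y\<^esub> \<in> Y_zero \<gg>"
  and Y_le_zero_one: "\<one>\<^bsub>Y\<^esub> \<in> Y_le_zero \<gg>"
  unfolding Y_pm_def Y_zero_def Y_le_zero_def by (rule generated_one)+

lemma Y_minus_zero_le_zero:
  assumes "u \<in> Y_pm \<gg> Minus" "v \<in> Y_zero \<gg>"
  shows "u \<otimes>\<^bsub>Y\<^esub> v \<in> Y_le_zero \<gg>"
proof -
  have "Y_pm \<gg> Minus \<subseteq> Y_le_zero \<gg>" "Y_zero \<gg> \<subseteq> Y_le_zero \<gg>"
    unfolding Y_pm_def Y_zero_def Y_le_zero_def by (rule generated_mono, blast)+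
  then have "u \<in> Y_le_zero \<gg>" "v \<in> Y_le_zero \<gg>" using assms by (simp_all add: subset_iff)
  then show ?thesis unfolding Y_le_zero_def by (rule generated_mult)
qed

lemma ordered_nonposI: "u \<in> Y_pm \<gg> Minus \<Longrightarrow> v \<in> Y_zero \<gg> \<Longrightarrow> u \<otimes>\<^bsub>Y\<^esub> v \<in> ordered_nonpos"
  unfolding ordered_nonpos_def by (rule subsetD[OF span_superset]) blast

lemma ordered_products_closed:
  "{u \<otimes>\<^bsub>Y\<^esub> v | u v. u \<in> Y_pm \<gg> Minus \<and> v \<in> Y_zero \<gg>} \<subseteq> carrier Y"
  by (auto simp: Y_pm_closed Y_zero_closed)

lemma subspace_ordered_nonpos: "subspace ordered_nonpos"
  unfolding ordered_nonpos_def by (rule subspace_span[OF ordered_products_closed])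

lemma ordered_nonpos_induct:
  assumes "linear_map f" "subspace N"
    "\<And>u v. u \<in> Y_pm \<gg> Minus \<Longrightarrow> v \<in> Y_zero \<gg> \<Longrightarrow> f (u \<otimes>\<^bsub>Y\<^esub> v) \<in> N" "a \<in> ordered_nonpos"
  shows "f a \<in> N"
proof (rule span_in_vimage[OF assms(1,2) ordered_products_closed])
  show "f x \<in> N" if "x \<in> {u \<otimes>\<^bsub>Y\<^esub> v | u v. u \<in> Y_pm \<gg> Minus \<and> v \<in> Y_zero \<gg>}" for x
    using that assms(3) by blast
qed (rule assms(4)[unfolded ordered_nonpos_def])

lemma Y_minus_ordered:
  assumes "u \<in> Y_pm \<gg> Minus" "a \<in> ordered_nonpos"
  shows "u \<otimes>\<^bsub>Y\<^esub> a \<in> ordered_nonpos"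
proof (rule ordered_nonpos_induct[OF _ subspace_ordered_nonpos _ assms(2)])
  show "linear_map (\<lambda>a. u \<otimes>\<^bsub>Y\<^esub> a)" using assms by (intro linear_map_mult_left Y_pm_closed)
  show "u \<otimes>\<^bsub>Y\<^esub> (u' \<otimes>\<^bsub>Y\<^esub> v) \<in> ordered_nonpos" if "u' \<in> Y_pm \<gg> Minus" "v \<in> Y_zero \<gg>" for u' v
    using ordered_nonposI[OF Y_pm_mult[OF assms(1) that(1)] that(2)] assms(1) that
    by (simp add: m_assoc Y_pm_closed Y_zero_closed)
qed

lemma ordered_Y_zero:
  assumes "v \<in> Y_zero \<gg>" "a \<in> ordered_nonpos"
  shows "a \<otimes>\<^bsub>Y\<^esub> v \<in> ordered_nonpos"
proof (rule ordered_nonpos_induct[OF _ subspace_ordered_nonpos _ assms(2)])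
  show "linear_map (\<lambda>a. a \<otimes>\<^bsub>Y\<^esub> v)" using assms by (intro linear_map_mult_right Y_zero_closed)
  show "(u \<otimes>\<^bsub>Y\<^esub> v') \<otimes>\<^bsub>Y\<^esub> v \<in> ordered_nonpos" if "u \<in> Y_pm \<gg> Minus" "v' \<in> Y_zero \<gg>" for u v'
    using ordered_nonposI[OF that(1) Y_zero_mult[OF that(2) assms(1)]] assms(1) that
    by (simp add: m_assoc Y_pm_closed Y_zero_closed)
qed

text \<open>
  The relation between \<open>h\<^sub>i\<^sub>,\<^sub>r\<^sub>+\<^sub>1\<close> and \<open>x\<^sub>j\<^sub>s\<close> expresses their commutator through products with
  \<open>h\<^sub>i\<^sub>r\<close>, so an induction on \<open>r\<close> moves all of them past \<open>x\<^sub>j\<^sub>s\<close>.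
\<close>

lemma yh_yx_ordered:
  assumes a: "a \<in> ordered_nonpos" and h: "\<And>r. yh \<gg> i r \<otimes>\<^bsub>Y\<^esub> a \<in> ordered_nonpos"
  shows "yh \<gg> i r \<otimes>\<^bsub>Y\<^esub> (yx \<gg> Minus j s \<otimes>\<^bsub>Y\<^esub> a) \<in> ordered_nonpos"
proof (induction r arbitrary: s)
  case 0
  note N = subspaceD[OF subspace_ordered_nonpos]
  have "yh \<gg> i 0 \<otimes>\<^bsub>Y\<^esub> (yx \<gg> Minus j s \<otimes>\<^bsub>Y\<^esub> a) = yx \<gg> Minus j s \<otimes>\<^bsub>Y\<^esub> (yh \<gg> i 0 \<otimes>\<^bsub>Y\<^esub> a) \<oplus>\<^bsub>Y\<^esub>
      (sgn_pm Minus * root_form \<gg> i j) \<odot>\<^bsub>Y\<^esub> (yx \<gg> Minus j s \<otimes>\<^bsub>Y\<^esub> a)"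
    using N(1)[OF a] arg_cong[OF yh0_yx[of i Minus j s], of "\<lambda>y. y \<otimes>\<^bsub>Y\<^esub> a"]
    by (simp add: l_distr m_assoc smult_mult_left)
  also have "\<dots> \<in> ordered_nonpos"
    by (intro N(3,4) Y_minus_ordered gens_in h a)
  finally show ?case .
next
  case (Suc r)
  note N = subspaceD[OF subspace_ordered_nonpos]
  have "yh \<gg> i (Suc r) \<otimes>\<^bsub>Y\<^esub> (yx \<gg> Minus j s \<otimes>\<^bsub>Y\<^esub> a) =
     yx \<gg> Minus j s \<otimes>\<^bsub>Y\<^esub> (yh \<gg> i (Suc r) \<otimes>\<^bsub>Y\<^esub> a) \<oplus>\<^bsub>Y\<^esub>
     (yh \<gg> i r \<otimes>\<^bsub>Y\<^esub> (yx \<gg> Minus j (Suc s) \<otimes>\<^bsub>Y\<^esub> a) \<oplus>\<^bsub>Y\<^esub>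
     ((- 1) \<odot>\<^bsub>Y\<^esub> (yx \<gg> Minus j (Suc s) \<otimes>\<^bsub>Y\<^esub> (yh \<gg> i r \<otimes>\<^bsub>Y\<^esub> a)) \<oplus>\<^bsub>Y\<^esub>
     (sgn_pm Minus * root_form \<gg> i j / 2) \<odot>\<^bsub>Y\<^esub>
       (yh \<gg> i r \<otimes>\<^bsub>Y\<^esub> (yx \<gg> Minus j s \<otimes>\<^bsub>Y\<^esub> a) \<oplus>\<^bsub>Y\<^esub> yx \<gg> Minus j s \<otimes>\<^bsub>Y\<^esub> (yh \<gg> i r \<otimes>\<^bsub>Y\<^esub> a))))"
    using N(1)[OF a] arg_cong[OF yh_Suc_yx[of i r Minus j s], of "\<lambda>y. y \<otimes>\<^bsub>Y\<^esub> a"]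
    by (simp add: l_distr m_assoc smult_mult_left del: sgn_pm.simps)
  also have "\<dots> \<in> ordered_nonpos"
    by (intro N(3,4) Y_minus_ordered gens_in h a Suc)
  finally show ?case .
qed

lemma yc_yx_ordered:
  assumes a: "a \<in> ordered_nonpos" and h: "yc \<gg> t \<otimes>\<^bsub>Y\<^esub> a \<in> ordered_nonpos"
  shows "yc \<gg> t \<otimes>\<^bsub>Y\<^esub> (yx \<gg> Minus j s \<otimes>\<^bsub>Y\<^esub> a) \<in> ordered_nonpos"
proof -
  note N = subspaceD[OF subspace_ordered_nonpos]
  have "yc \<gg> t \<otimes>\<^bsub>Y\<^esub> (yx \<gg> Minus j s \<otimes>\<^bsub>Y\<^esub> a) = yx \<gg> Minus j s \<otimes>\<^bsub>Y\<^esub> (yc \<gg> t \<otimes>\<^bsub>Y\<^esub> a) \<oplus>\<^bsub>Y\<^esub>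
      (sgn_pm Minus * simple_root \<gg> j t) \<odot>\<^bsub>Y\<^esub> (yx \<gg> Minus j s \<otimes>\<^bsub>Y\<^esub> a)"
    using N(1)[OF a] arg_cong[OF yc_yx[of t Minus j s], of "\<lambda>y. y \<otimes>\<^bsub>Y\<^esub> a"]
    by (simp add: l_distr m_assoc smult_mult_left)
  also have "\<dots> \<in> ordered_nonpos"
    by (intro N(3,4) Y_minus_ordered gens_in h a)
  finally show ?thesis .
qed

text \<open>
  It suffices that \<open>Y\<^sup>- Y\<^sup>0\<close> contains the unit and is stable under left multiplication by the
  generators.  This is clear for \<open>x\<^sup>-\<^sub>i\<^sub>r\<close>.  For a Cartan generator \<open>g\<close> it reduces to
  \<open>g u \<in> Y\<^sup>- Y\<^sup>0\<close> for \<open>u \<in> Y\<^sup>-\<close>, which holds by induction on \<open>u\<close>.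
\<close>

lemma Y_le_zero_ordered: "Y_le_zero \<gg> \<subseteq> ordered_nonpos"
proof -
  note N = subspaceD[OF subspace_ordered_nonpos]
  have U: "u \<in> ordered_nonpos" if "u \<in> Y_pm \<gg> Minus" for u
    using ordered_nonposI[OF that Y_zero_one] that by (simp add: Y_pm_closed)
  have V: "v \<in> ordered_nonpos" if "v \<in> Y_zero \<gg>" for v
    using ordered_nonposI[OF Y_pm_one that] that by (simp add: Y_zero_closed)
  \<comment> \<open>The unit among the multipliers records that \<open>u\<close> itself lies in the space, which the
    commutation relations use as well.\<close>
  let ?M = "{u \<in> carrier Y. \<forall>g\<in>{\<one>\<^bsub>Y\<^esub>} \<union> {yh \<gg> i r | i r. True} \<union> range (yc \<gg>). g \<otimes>\<^bsub>Y\<^esub> u \<in> ordered_nonpos}"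
  have M: "subspace ?M"
    by (intro subspace_Ball subspace_vimage linear_map_mult_left subspace_ordered_nonpos) auto
  have minus: "Y_pm \<gg> Minus \<subseteq> ?M"
    unfolding Y_pm_def
  proof (rule generated_left_induct[OF _ M])
    show "\<one>\<^bsub>Y\<^esub> \<in> ?M" using V gens_in Y_zero_one by auto
    fix s x assume "s \<in> {yx \<gg> Minus i r | i r. True}" and x: "x \<in> ?M"
    then obtain j r where s: "s = yx \<gg> Minus j r" by blast
    have "\<one>\<^bsub>Y\<^esub> \<otimes>\<^bsub>Y\<^esub> x \<in> ordered_nonpos" using x by blast
    then have xN: "x \<in> ordered_nonpos" using x by simp
    have "yh \<gg> i k \<otimes>\<^bsub>Y\<^esub> x \<in> ordered_nonpos" "yc \<gg> t \<otimes>\<^bsub>Y\<^esub> x \<in> ordered_nonpos" for i k t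
      using x by blast+
    then show "s \<otimes>\<^bsub>Y\<^esub> x \<in> ?M"
      using xN N(1) Y_minus_ordered[OF gens_in(1) xN, of j r] unfolding s
      by (auto intro!: yh_yx_ordered yc_yx_ordered)
  qed auto
  have left: "g \<otimes>\<^bsub>Y\<^esub> a \<in> ordered_nonpos"
    if g: "g \<in> {yh \<gg> i r | i r. True} \<union> range (yc \<gg>)" and a: "a \<in> ordered_nonpos" for g a
  proof (rule ordered_nonpos_induct[OF _ subspace_ordered_nonpos _ a])
    have gc: "g \<in> carrier Y" using g by auto
    then show "linear_map (\<lambda>a. g \<otimes>\<^bsub>Y\<^esub> a)" by (rule linear_map_mult_left)
    fix u v assume u: "u \<in> Y_pm \<gg> Minus" and v: "v \<in> Y_zero \<gg>"
    have "g \<otimes>\<^bsub>Y\<^esub> u \<in> ordered_nonpos" using minus u g by blast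
    then show "g \<otimes>\<^bsub>Y\<^esub> (u \<otimes>\<^bsub>Y\<^esub> v) \<in> ordered_nonpos"
      using ordered_Y_zero[OF v] gc u v by (simp add: m_assoc[symmetric] Y_pm_closed Y_zero_closed)
  qed
  show ?thesis
    unfolding Y_le_zero_def
  proof (rule generated_left_induct[OF _ subspace_ordered_nonpos])
    show "\<one>\<^bsub>Y\<^esub> \<in> ordered_nonpos" by (rule V[OF Y_zero_one])
    show "s \<otimes>\<^bsub>Y\<^esub> x \<in> ordered_nonpos"
      if "s \<in> {yx \<gg> Minus i r | i r. True} \<union> {yh \<gg> i r | i r. True} \<union> range (yc \<gg>)"
        "x \<in> ordered_nonpos" for s x
      using that left[of s x] Y_minus_ordered[OF gens_in(1), of x] by blast
  qed auto
qed

section \<open>The filtration by left ideals\<close>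

text \<open>
  \<open>pos_ideal n\<close> is the left ideal generated by the products of \<open>n\<close> generators
  \<open>x\<^sup>+\<^sub>i\<^sub>r\<close>.
\<close>

primrec pos_ideal :: "nat \<Rightarrow> ('i, 'h) yangian_elem set" where
  "pos_ideal 0 = carrier Y"
| "pos_ideal (Suc n) = linear_span Y {z \<otimes>\<^bsub>Y\<^esub> yx \<gg> Plus j s | z j s. z \<in> pos_ideal n}"

lemma subspace_pos_ideal: "subspace (pos_ideal n)"
proof (induction n)
  case (Suc n)
  then show ?case by (auto intro!: subspace_span dest: subspaceD(1))
qed (simp add: subspace_carrier)

lemmas pos_idealD = subspaceD[OF subspace_pos_ideal]

lemma pos_ideal_gens_closed: "{z \<otimes>\<^bsub>Y\<^esub> yx \<gg> Plus j s | z j s. z \<in> pos_ideal n} \<subseteq> carrier Y"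
  using pos_idealD(1) by auto

lemma pos_ideal_SucI: "z \<in> pos_ideal n \<Longrightarrow> z \<otimes>\<^bsub>Y\<^esub> yx \<gg> Plus j s \<in> pos_ideal (Suc n)"
  unfolding pos_ideal.simps by (rule subsetD[OF span_superset]) blast

lemma pos_ideal_Suc_induct:
  assumes "linear_map f" "subspace N"
    "\<And>z j s. z \<in> pos_ideal n \<Longrightarrow> f (z \<otimes>\<^bsub>Y\<^esub> yx \<gg> Plus j s) \<in> N" "y \<in> pos_ideal (Suc n)"
  shows "f y \<in> N"
proof (rule span_in_vimage[OF assms(1,2) pos_ideal_gens_closed])
  show "f x \<in> N" if "x \<in> {z \<otimes>\<^bsub>Y\<^esub> yx \<gg> Plus j s | z j s. z \<in> pos_ideal n}" for x
    using that assms(3) by blast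
qed (rule assms(4)[unfolded pos_ideal.simps])

lemma pos_ideal_left_ideal: "y \<in> carrier Y \<Longrightarrow> z \<in> pos_ideal n \<Longrightarrow> y \<otimes>\<^bsub>Y\<^esub> z \<in> pos_ideal n"
proof (induction n arbitrary: z)
  case (Suc n)
  show ?case
  proof (rule pos_ideal_Suc_induct[OF linear_map_mult_left subspace_pos_ideal _ Suc.prems(2)])
    show "y \<otimes>\<^bsub>Y\<^esub> (z \<otimes>\<^bsub>Y\<^esub> yx \<gg> Plus j s) \<in> pos_ideal (Suc n)" if "z \<in> pos_ideal n" for z j s
      using pos_ideal_SucI[OF Suc.IH[OF Suc.prems(1) that]] that Suc.prems(1) pos_idealD(1)
      by (simp add: m_assoc del: pos_ideal.simps)
  qed (rule Suc.prems(1))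
qed simp

lemma pos_ideal_Suc_subset: "pos_ideal (Suc n) \<subseteq> pos_ideal n"
proof (induction n)
  case 0
  then show ?case using pos_idealD(1)[of _ "Suc 0"] by (auto simp del: pos_ideal.simps(2))
next
  case (Suc n)
  show ?case
  proof
    fix y assume y: "y \<in> pos_ideal (Suc (Suc n))"
    show "y \<in> pos_ideal (Suc n)"
      by (rule pos_ideal_Suc_induct[OF linear_map_id subspace_pos_ideal pos_ideal_SucI[OF subsetD[OF Suc]] y])
  qed
qed

lemma pos_ideal_antimono: "m \<le> n \<Longrightarrow> pos_ideal n \<subseteq> pos_ideal m"
  by (rule lift_Suc_antimono_le[of pos_ideal]) (rule pos_ideal_Suc_subset)

text \<open>
  Relation by relation, \<open>x\<^sup>+\<^sub>j\<^sub>s h\<^sub>i\<^sub>r\<close> is rewritten so that every term either ends in a generator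
  \<open>x\<^sup>+\<close> or contains some \<open>x\<^sup>+ h\<^sub>i\<^sub>q\<close> with \<open>q < r\<close>.  The outer induction on \<open>n\<close> moves the Cartan generator
  past the remaining factors.
\<close>

lemma pos_ideal_yh: "z \<in> pos_ideal n \<Longrightarrow> z \<otimes>\<^bsub>Y\<^esub> yh \<gg> i r \<in> pos_ideal n"
proof (induction n arbitrary: z r)
  case (Suc n)
  note N = pos_idealD and IH = Suc.IH
  have step: "z \<otimes>\<^bsub>Y\<^esub> yx \<gg> Plus j s \<otimes>\<^bsub>Y\<^esub> yh \<gg> i r \<in> pos_ideal (Suc n)" if z: "z \<in> pos_ideal n" for z j s r
  proof (induction r arbitrary: s)
    case 0
    have "z \<otimes>\<^bsub>Y\<^esub> yx \<gg> Plus j s \<otimes>\<^bsub>Y\<^esub> yh \<gg> i 0 = (z \<otimes>\<^bsub>Y\<^esub> yh \<gg> i 0) \<otimes>\<^bsub>Y\<^esub> yx \<gg> Plus j s \<oplus>\<^bsub>Y\<^esub>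
        (- (sgn_pm Plus * root_form \<gg> i j)) \<odot>\<^bsub>Y\<^esub> (z \<otimes>\<^bsub>Y\<^esub> yx \<gg> Plus j s)"
      using N(1)[OF z] arg_cong[OF yx_yh0[of Plus j s i], of "\<lambda>y. z \<otimes>\<^bsub>Y\<^esub> y"]
      by (simp add: r_distr m_assoc smult_mult_right del: sgn_pm.simps)
    also have "\<dots> \<in> pos_ideal (Suc n)"
      by (intro N(3,4) pos_ideal_SucI Suc.IH z)
    finally show ?case .
  next
    case (Suc r)
    have "z \<otimes>\<^bsub>Y\<^esub> yx \<gg> Plus j s \<otimes>\<^bsub>Y\<^esub> yh \<gg> i (Suc r) =
        (z \<otimes>\<^bsub>Y\<^esub> yh \<gg> i (Suc r)) \<otimes>\<^bsub>Y\<^esub> yx \<gg> Plus j s \<oplus>\<^bsub>Y\<^esub>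
        ((- 1) \<odot>\<^bsub>Y\<^esub> ((z \<otimes>\<^bsub>Y\<^esub> yh \<gg> i r) \<otimes>\<^bsub>Y\<^esub> yx \<gg> Plus j (Suc s)) \<oplus>\<^bsub>Y\<^esub>
        (z \<otimes>\<^bsub>Y\<^esub> yx \<gg> Plus j (Suc s) \<otimes>\<^bsub>Y\<^esub> yh \<gg> i r \<oplus>\<^bsub>Y\<^esub>
        (- (sgn_pm Plus * root_form \<gg> i j / 2)) \<odot>\<^bsub>Y\<^esub>
          ((z \<otimes>\<^bsub>Y\<^esub> yh \<gg> i r) \<otimes>\<^bsub>Y\<^esub> yx \<gg> Plus j s \<oplus>\<^bsub>Y\<^esub> z \<otimes>\<^bsub>Y\<^esub> yx \<gg> Plus j s \<otimes>\<^bsub>Y\<^esub> yh \<gg> i r)))"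
      using N(1)[OF z] arg_cong[OF yx_yh_Suc[of Plus j s i r], of "\<lambda>y. z \<otimes>\<^bsub>Y\<^esub> y"]
      by (simp add: r_distr m_assoc smult_mult_right del: sgn_pm.simps)
    also have "\<dots> \<in> pos_ideal (Suc n)"
      by (intro N(3,4) pos_ideal_SucI IH Suc z)
    finally show ?case .
  qed
  show ?case
    by (rule pos_ideal_Suc_induct[OF linear_map_mult_right subspace_pos_ideal step Suc.prems]) auto
qed simp

lemma pos_ideal_yc: "z \<in> pos_ideal n \<Longrightarrow> z \<otimes>\<^bsub>Y\<^esub> yc \<gg> t \<in> pos_ideal n"
proof (induction n arbitrary: z)
  case (Suc n)
  note N = pos_idealD
  have step: "z \<otimes>\<^bsub>Y\<^esub> yx \<gg> Plus j s \<otimes>\<^bsub>Y\<^esub> yc \<gg> t \<in> pos_ideal (Suc n)" if z: "z \<in> pos_ideal n" for z j s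
  proof -
    have "z \<otimes>\<^bsub>Y\<^esub> yx \<gg> Plus j s \<otimes>\<^bsub>Y\<^esub> yc \<gg> t = (z \<otimes>\<^bsub>Y\<^esub> yc \<gg> t) \<otimes>\<^bsub>Y\<^esub> yx \<gg> Plus j s \<oplus>\<^bsub>Y\<^esub>
        (- (sgn_pm Plus * simple_root \<gg> j t)) \<odot>\<^bsub>Y\<^esub> (z \<otimes>\<^bsub>Y\<^esub> yx \<gg> Plus j s)"
      using N(1)[OF z] arg_cong[OF yx_yc[of Plus j s t], of "\<lambda>y. z \<otimes>\<^bsub>Y\<^esub> y"]
      by (simp add: r_distr m_assoc smult_mult_right del: sgn_pm.simps)
    also have "\<dots> \<in> pos_ideal (Suc n)"
      by (intro N(3,4) pos_ideal_SucI Suc.IH z)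
    finally show ?thesis .
  qed
  show ?case
    by (rule pos_ideal_Suc_induct[OF linear_map_mult_right subspace_pos_ideal step Suc.prems]) auto
qed simp

text \<open>
  Commuting \<open>x\<^sup>-\<close> past \<open>x\<^sup>+\<close> either preserves the number of factors \<open>x\<^sup>+\<close> or trades one of them
  for a Cartan generator, which by the previous lemmas does no further harm.
\<close>

lemma pos_ideal_yx_Minus: "z \<in> pos_ideal (Suc n) \<Longrightarrow> z \<otimes>\<^bsub>Y\<^esub> yx \<gg> Minus i r \<in> pos_ideal n"
proof (induction n arbitrary: z)
  case 0
  then show ?case using pos_idealD(1)[OF 0] by simp
next
  case (Suc n)
  note N = pos_idealD
  have step: "z \<otimes>\<^bsub>Y\<^esub> yx \<gg> Plus j s \<otimes>\<^bsub>Y\<^esub> yx \<gg> Minus i r \<in> pos_ideal (Suc n)"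
    if z: "z \<in> pos_ideal (Suc n)" for z j s
  proof -
    have "z \<otimes>\<^bsub>Y\<^esub> yx \<gg> Plus j s \<otimes>\<^bsub>Y\<^esub> yx \<gg> Minus i r = (z \<otimes>\<^bsub>Y\<^esub> yx \<gg> Minus i r) \<otimes>\<^bsub>Y\<^esub> yx \<gg> Plus j s \<oplus>\<^bsub>Y\<^esub>
        z \<otimes>\<^bsub>Y\<^esub> (if j = i then yh \<gg> j (s + r) else \<zero>\<^bsub>Y\<^esub>)"
      using N(1)[OF z] arg_cong[OF yx_Plus_Minus[of j s i r], of "\<lambda>y. z \<otimes>\<^bsub>Y\<^esub> y"]
      by (simp add: r_distr m_assoc split del: if_split) (auto simp: r_distr m_assoc)
    also have "\<dots> \<in> pos_ideal (Suc n)"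
    proof (rule N(3))
      show "(z \<otimes>\<^bsub>Y\<^esub> yx \<gg> Minus i r) \<otimes>\<^bsub>Y\<^esub> yx \<gg> Plus j s \<in> pos_ideal (Suc n)"
        by (intro pos_ideal_SucI Suc.IH z)
      show "z \<otimes>\<^bsub>Y\<^esub> (if j = i then yh \<gg> j (s + r) else \<zero>\<^bsub>Y\<^esub>) \<in> pos_ideal (Suc n)"
        using pos_ideal_yh[OF z] N(1)[OF z] N(2)[of "Suc n"] by (simp del: pos_ideal.simps)
    qed
    finally show ?thesis .
  qed
  show ?case
    by (rule pos_ideal_Suc_induct[OF linear_map_mult_right subspace_pos_ideal step Suc.prems]) auto
qed

text \<open>
  Right multiplication by a generator lowers the order of the filtration by at most one, hence
  right multiplication by a product of \<open>n\<close> generators by at most \<open>n\<close>.  Continuity is formulated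
  with an existential quantifier because it then passes to products and sums.
\<close>

lemma pos_ideal_right_continuous:
  assumes "y \<in> carrier Y"
  shows "\<exists>n. \<forall>z\<in>pos_ideal n. z \<otimes>\<^bsub>Y\<^esub> y \<in> pos_ideal m"
proof -
  let ?N = "{y \<in> carrier Y. \<forall>m\<in>UNIV. \<exists>n. \<forall>z\<in>pos_ideal n. z \<otimes>\<^bsub>Y\<^esub> y \<in> pos_ideal m}"
  let ?S = "{yx \<gg> \<epsilon> i r | \<epsilon> i r. True} \<union> {yh \<gg> i r | i r. True} \<union> range (yc \<gg>)"
  note N = pos_idealD
  have gen: "\<exists>n. \<forall>z\<in>pos_ideal n. z \<otimes>\<^bsub>Y\<^esub> g \<in> pos_ideal m" if g: "g \<in> ?S" for g m
  proof -
    consider i r where "g = yx \<gg> Plus i r" | i r where "g = yx \<gg> Minus i r"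
      | i r where "g = yh \<gg> i r" | t where "g = yc \<gg> t"
      using g by (auto; metis pm.exhaust)
    then show ?thesis
    proof cases
      case 1
      then show ?thesis using pos_ideal_SucI pos_ideal_Suc_subset by blast
    next
      case 2
      then show ?thesis using pos_ideal_yx_Minus by blast
    next
      case 3
      then show ?thesis using pos_ideal_yh by blast
    next
      case 4
      then show ?thesis using pos_ideal_yc by blast
    qed
  qed
  have "subalgebra_generated Y ?S \<subseteq> ?N"
  proof (rule generated_left_induct)
    show "?S \<subseteq> carrier Y" by auto
    show "subspace ?N"
    proof (rule subspace_Ball, rule subspaceI)
      fix m :: nat
      let ?P = "{y \<in> carrier Y. \<exists>n. \<forall>z\<in>pos_ideal n. z \<otimes>\<^bsub>Y\<^esub> y \<in> pos_ideal m}"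
      show "\<zero>\<^bsub>Y\<^esub> \<in> ?P" using N(1,2) by auto
      show "x \<oplus>\<^bsub>Y\<^esub> y \<in> ?P" if xy: "x \<in> ?P" "y \<in> ?P" for x y
      proof -
        obtain k l where kl: "\<forall>z\<in>pos_ideal k. z \<otimes>\<^bsub>Y\<^esub> x \<in> pos_ideal m"
          "\<forall>z\<in>pos_ideal l. z \<otimes>\<^bsub>Y\<^esub> y \<in> pos_ideal m" using xy by blast
        have "z \<otimes>\<^bsub>Y\<^esub> (x \<oplus>\<^bsub>Y\<^esub> y) \<in> pos_ideal m" if z: "z \<in> pos_ideal (max k l)" for z
        proof -
          have "z \<in> pos_ideal k" "z \<in> pos_ideal l"
            using z pos_ideal_antimono[of k "max k l"] pos_ideal_antimono[of l "max k l"] by auto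
          then have "z \<otimes>\<^bsub>Y\<^esub> x \<oplus>\<^bsub>Y\<^esub> z \<otimes>\<^bsub>Y\<^esub> y \<in> pos_ideal m" using kl N(3) by blast
          then show ?thesis using N(1)[OF z] xy by (simp add: r_distr)
        qed
        then show ?thesis using xy by blast
      qed
      show "c \<odot>\<^bsub>Y\<^esub> x \<in> ?P" if x: "x \<in> ?P" for c x
      proof -
        obtain k where k: "\<forall>z\<in>pos_ideal k. z \<otimes>\<^bsub>Y\<^esub> x \<in> pos_ideal m" using x by blast
        have "z \<otimes>\<^bsub>Y\<^esub> (c \<odot>\<^bsub>Y\<^esub> x) \<in> pos_ideal m" if z: "z \<in> pos_ideal k" for z
          using k z N(1)[OF z] N(4) x by (simp add: smult_mult_right)
        then show ?thesis using x by blast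
      qed
    qed auto
    have "z \<otimes>\<^bsub>Y\<^esub> \<one>\<^bsub>Y\<^esub> \<in> pos_ideal m" if z: "z \<in> pos_ideal m" for z m
      using z N(1)[OF z] by simp
    then show "\<one>\<^bsub>Y\<^esub> \<in> ?N" by blast
    show "s \<otimes>\<^bsub>Y\<^esub> x \<in> ?N" if s: "s \<in> ?S" and x: "x \<in> ?N" for s x
    proof -
      have sc: "s \<in> carrier Y" and xc: "x \<in> carrier Y" using s x by auto
      have "\<exists>n. \<forall>z\<in>pos_ideal n. z \<otimes>\<^bsub>Y\<^esub> (s \<otimes>\<^bsub>Y\<^esub> x) \<in> pos_ideal m" for m
      proof -
        obtain k where k: "\<forall>z\<in>pos_ideal k. z \<otimes>\<^bsub>Y\<^esub> x \<in> pos_ideal m" using x by blast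
        obtain l where l: "\<forall>z\<in>pos_ideal l. z \<otimes>\<^bsub>Y\<^esub> s \<in> pos_ideal k" using gen[OF s] by blast
        have "z \<otimes>\<^bsub>Y\<^esub> (s \<otimes>\<^bsub>Y\<^esub> x) \<in> pos_ideal m" if z: "z \<in> pos_ideal l" for z
          using k l z N(1)[OF z] sc xc by (simp add: m_assoc[symmetric])
        then show ?thesis by blast
      qed
      then show ?thesis using sc xc by blast
    qed
  qed
  then have "y \<in> ?N" using assms carrier_generated by blast
  then show ?thesis by blast
qed

end


section \<open>The decomposition of the Yangian\<close>

text \<open>
  The maps \<open>\<psi>\<close> and \<open>\<phi>\<close> are the parametrization of the positive half by a free algebra and the
  linear isomorphism of the triangular decomposition.
\<close>

locale decomposed_yangian = yangian_algebra \<gg>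
  for \<gg> :: "('i, 'h::ab_group_add) cartan_datum" +
  fixes \<psi> :: "('i \<times> nat) free_alg \<Rightarrow> ('i, 'h) yangian_elem"
    and \<phi> :: "(('i, 'h) yangian_elem \<times> ('i, 'h) yangian_elem \<times> ('i, 'h) yangian_elem \<Rightarrow>\<^sub>0 complex) set
      \<Rightarrow> ('i, 'h) yangian_elem"
  assumes range_\<psi>: "range \<psi> = Y_pm \<gg> Plus"
    and \<psi>_add: "\<psi> (p + q) = \<psi> p \<oplus>\<^bsub>yangian \<gg>\<^esub> \<psi> q"
    and \<psi>_mult: "\<psi> (p * q) = \<psi> p \<otimes>\<^bsub>yangian \<gg>\<^esub> \<psi> q"
    and \<psi>_scale: "\<psi> (c \<cdot>\<^sub>C p) = c \<odot>\<^bsub>yangian \<gg>\<^esub> \<psi> p"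
    and \<psi>_one: "\<psi> 1 = \<one>\<^bsub>yangian \<gg>\<^esub>"
    and \<psi>_gen: "\<psi> (gen (i, r)) = yx \<gg> Plus i r"
    and \<psi>_degree_part: "\<psi> p = \<psi> q \<Longrightarrow> \<psi> (degree_part m p) = \<psi> (degree_part m q)"
    and \<phi>_bij: "bij_betw \<phi> (tensor3 (yangian \<gg>) (Y_pm \<gg> Minus) (Y_zero \<gg>) (Y_pm \<gg> Plus)) (carrier (yangian \<gg>))"
    and \<phi>_mult: "t \<in> free_triples (Y_pm \<gg> Minus) (Y_zero \<gg>) (Y_pm \<gg> Plus) \<Longrightarrow>
      \<phi> (tensor_rel (yangian \<gg>) (Y_pm \<gg> Minus) (Y_zero \<gg>) (Y_pm \<gg> Plus) `` {t}) = triple_mult (yangian \<gg>) t"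
begin

lemma \<psi>_in: "\<psi> p \<in> Y_pm \<gg> Plus" and \<psi>_closed [simp, intro]: "\<psi> p \<in> carrier Y"
  using range_\<psi> Y_pm_closed by blast+

lemma \<psi>_zero: "\<psi> 0 = \<zero>\<^bsub>Y\<^esub>"
proof -
  have "0 \<cdot>\<^sub>C (0 :: ('i \<times> nat) free_alg) = 0" by (rule poly_mapping_eqI) simp
  then have "\<psi> 0 = 0 \<odot>\<^bsub>Y\<^esub> \<psi> 0" using \<psi>_scale[of 0 0] by simp
  then show ?thesis by simp
qed

lemma \<psi>_sum: "finite I \<Longrightarrow> \<psi> (sum f I) = finsum Y (\<lambda>i. \<psi> (f i)) I"
proof (induction I rule: finite_induct)
  case (insert i I)
  then show ?case by (subst finsum_insert) (auto simp: \<psi>_add)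
qed (simp add: \<psi>_zero)

text \<open>
  The projection of \<open>Y\<^sup>+\<close> onto its component of degree \<open>m\<close>.  The choice of a preimage under \<open>\<psi>\<close>
  is immaterial, since the kernel of \<open>\<psi>\<close> is homogeneous.
\<close>

definition plus_part :: "nat \<Rightarrow> ('i, 'h) yangian_elem \<Rightarrow> ('i, 'h) yangian_elem" where
  "plus_part m w = \<psi> (degree_part m (SOME p. \<psi> p = w))"

lemma plus_part_\<psi>: "plus_part m (\<psi> p) = \<psi> (degree_part m p)"
  unfolding plus_part_def by (rule \<psi>_degree_part, rule someI) (rule refl)

text \<open>
  The projection of the Yangian onto its component of degree \<open>m\<close> is the identity on
  \<open>Y\<^sup>- \<otimes> Y\<^sup>0\<close> tensored with the projection of \<open>Y\<^sup>+\<close>.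
\<close>

definition component :: "nat \<Rightarrow> ('i, 'h) yangian_elem \<Rightarrow> ('i, 'h) yangian_elem" where
  "component m = (SOME C. linear_map C \<and>
     (\<forall>u\<in>Y_pm \<gg> Minus. \<forall>v\<in>Y_zero \<gg>. \<forall>w\<in>Y_pm \<gg> Plus. C (u \<otimes>\<^bsub>Y\<^esub> v \<otimes>\<^bsub>Y\<^esub> w) = u \<otimes>\<^bsub>Y\<^esub> v \<otimes>\<^bsub>Y\<^esub> plus_part m w))"

lemma component_props:
  shows component_linear: "linear_map (component m)"
    and component_mult: "u \<in> Y_pm \<gg> Minus \<Longrightarrow> v \<in> Y_zero \<gg> \<Longrightarrow>
      component m (u \<otimes>\<^bsub>Y\<^esub> v \<otimes>\<^bsub>Y\<^esub> \<psi> p) = u \<otimes>\<^bsub>Y\<^esub> v \<otimes>\<^bsub>Y\<^esub> \<psi> (degree_part m p)"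
proof -
  have surj: "\<exists>p. w = \<psi> p" if "w \<in> Y_pm \<gg> Plus" for w
    using that range_\<psi> by (metis imageE)
  have "\<exists>C. linear_map C \<and>
      (\<forall>u\<in>Y_pm \<gg> Minus. \<forall>v\<in>Y_zero \<gg>. \<forall>w\<in>Y_pm \<gg> Plus. C (u \<otimes>\<^bsub>Y\<^esub> v \<otimes>\<^bsub>Y\<^esub> w) = u \<otimes>\<^bsub>Y\<^esub> v \<otimes>\<^bsub>Y\<^esub> plus_part m w)"
  proof (rule extend_third_factor[OF subspace_Y_pm subspace_Y_zero subspace_Y_pm _ _ _ \<phi>_bij \<phi>_mult])
    fix w w' c assume w: "w \<in> Y_pm \<gg> Plus"
    then obtain p where p: "w = \<psi> p" using surj by blast
    show "plus_part m w \<in> carrier Y" by (simp add: p plus_part_\<psi>)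
    show "plus_part m (c \<odot>\<^bsub>Y\<^esub> w) = c \<odot>\<^bsub>Y\<^esub> plus_part m w"
      unfolding p \<psi>_scale[symmetric] plus_part_\<psi> degree_part_linear by (rule refl)
    assume "w' \<in> Y_pm \<gg> Plus"
    then obtain q where q: "w' = \<psi> q" using surj by blast
    show "plus_part m (w \<oplus>\<^bsub>Y\<^esub> w') = plus_part m w \<oplus>\<^bsub>Y\<^esub> plus_part m w'"
      unfolding p q \<psi>_add[symmetric] plus_part_\<psi> degree_part_linear by (rule refl)
  qed
  note C = someI_ex[OF this, folded component_def]
  show "linear_map (component m)" using C by blast
  show "component m (u \<otimes>\<^bsub>Y\<^esub> v \<otimes>\<^bsub>Y\<^esub> \<psi> p) = u \<otimes>\<^bsub>Y\<^esub> v \<otimes>\<^bsub>Y\<^esub> \<psi> (degree_part m p)"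
    if "u \<in> Y_pm \<gg> Minus" "v \<in> Y_zero \<gg>"
    using C that \<psi>_in plus_part_\<psi> by metis
qed

lemma component_closed [simp, intro]: "y \<in> carrier Y \<Longrightarrow> component m y \<in> carrier Y"
  by (rule linear_mapD(1)[OF component_linear])

lemma triple_products_closed:
  "{u \<otimes>\<^bsub>Y\<^esub> v \<otimes>\<^bsub>Y\<^esub> \<psi> p | u v p. u \<in> Y_pm \<gg> Minus \<and> v \<in> Y_zero \<gg> \<and> Q p} \<subseteq> carrier Y"
  by (auto simp: Y_pm_closed Y_zero_closed)

lemma carrier_triples:
  "carrier Y = linear_span Y {u \<otimes>\<^bsub>Y\<^esub> v \<otimes>\<^bsub>Y\<^esub> \<psi> p | u v p. u \<in> Y_pm \<gg> Minus \<and> v \<in> Y_zero \<gg>}"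
proof -
  have "{u \<otimes>\<^bsub>Y\<^esub> v \<otimes>\<^bsub>Y\<^esub> w | u v w. u \<in> Y_pm \<gg> Minus \<and> v \<in> Y_zero \<gg> \<and> w \<in> Y_pm \<gg> Plus} =
      {u \<otimes>\<^bsub>Y\<^esub> v \<otimes>\<^bsub>Y\<^esub> \<psi> p | u v p. u \<in> Y_pm \<gg> Minus \<and> v \<in> Y_zero \<gg>}"
    unfolding range_\<psi>[symmetric] by blast
  moreover have "carrier Y = linear_span Y
      {u \<otimes>\<^bsub>Y\<^esub> v \<otimes>\<^bsub>Y\<^esub> w | u v w. u \<in> Y_pm \<gg> Minus \<and> v \<in> Y_zero \<gg> \<and> w \<in> Y_pm \<gg> Plus}"
    using Y_pm_closed Y_zero_closed by (intro carrier_triple_products[OF \<phi>_bij \<phi>_mult]) blast+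
  ultimately show ?thesis by (simp only:)
qed

lemma triple_induct:
  assumes "subspace N" "y \<in> carrier Y"
    "\<And>u v p. u \<in> Y_pm \<gg> Minus \<Longrightarrow> v \<in> Y_zero \<gg> \<Longrightarrow> u \<otimes>\<^bsub>Y\<^esub> v \<otimes>\<^bsub>Y\<^esub> \<psi> p \<in> N"
  shows "y \<in> N"
proof -
  have "linear_span Y {u \<otimes>\<^bsub>Y\<^esub> v \<otimes>\<^bsub>Y\<^esub> \<psi> p | u v p. u \<in> Y_pm \<gg> Minus \<and> v \<in> Y_zero \<gg>} \<subseteq> N"
    using assms(3) by (intro span_minimal assms(1)) blast
  then show ?thesis using assms(2) carrier_triples by blast
qed

lemma word_\<psi>:
  "foldr (\<lambda>(i, r) z. yx \<gg> Plus i r \<otimes>\<^bsub>Y\<^esub> z) w \<one>\<^bsub>Y\<^esub> = \<psi> (Poly_Mapping.single (Word w) 1)"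
proof (induction w)
  case Nil
  have "Poly_Mapping.single (Word []) 1 = (1 :: ('i \<times> nat) free_alg)"
    by (subst zero_word_def[symmetric]) simp
  then show ?case by (simp add: \<psi>_one)
next
  case (Cons a w)
  then show ?case by (cases a) (simp add: single_Cons_word \<psi>_mult \<psi>_gen)
qed

lemma words_closed:
  "{foldr (\<lambda>(i, r) z. yx \<gg> Plus i r \<otimes>\<^bsub>Y\<^esub> z) w \<one>\<^bsub>Y\<^esub> | w. length w = k} \<subseteq> carrier Y"
  by (auto simp: word_\<psi>)

lemma subspace_Y_plus_deg: "subspace (Y_plus_deg \<gg> k)"
  unfolding Y_plus_deg_def by (rule subspace_span[OF words_closed])

lemma word_in_Y_plus_deg: "\<psi> (Poly_Mapping.single (Word w) 1) \<in> Y_plus_deg \<gg> (length w)"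
  unfolding Y_plus_deg_def by (rule subsetD[OF span_superset]) (auto simp: word_\<psi>)

lemma \<psi>_degree_part_in: "\<psi> (degree_part m p) \<in> Y_plus_deg \<gg> m"
proof (induction p rule: poly_mapping_additive_induct)
  case (1 k c)
  have k: "Poly_Mapping.single k c = c \<cdot>\<^sub>C Poly_Mapping.single (Word (letters k)) 1"
    by (simp add: fscale_single)
  have "\<psi> (Poly_Mapping.single k c) \<in> Y_plus_deg \<gg> (length (letters k))"
    unfolding k \<psi>_scale by (intro subspaceD(4)[OF subspace_Y_plus_deg] word_in_Y_plus_deg)
  then show ?case
    using subspaceD(2)[OF subspace_Y_plus_deg]
    by (cases "length (letters k) = m")
      (simp_all add: degree_part_homogeneous[OF homogeneous_single] \<psi>_zero)
next
  case (2 p q)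
  then show ?case
    using subspaceD(3)[OF subspace_Y_plus_deg] by (simp add: degree_part_linear \<psi>_add)
qed

lemma Y_plus_degE:
  assumes "b \<in> Y_plus_deg \<gg> k"
  obtains p where "homogeneous k p" "b = \<psi> p"
proof -
  let ?N = "{\<psi> p | p. homogeneous k p}"
  have "subspace ?N"
  proof (rule subspaceI)
    show "\<zero>\<^bsub>Y\<^esub> \<in> ?N" using \<psi>_zero by (auto simp: homogeneous_def intro!: exI[of _ 0])
    show "x \<oplus>\<^bsub>Y\<^esub> y \<in> ?N" if xy: "x \<in> ?N" "y \<in> ?N" for x y
    proof -
      obtain p q where "x = \<psi> p" "homogeneous k p" "y = \<psi> q" "homogeneous k q" using xy by blast
      then show ?thesis using homogeneous_add[of k p q] \<psi>_add[of p q] by auto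
    qed
    show "c \<odot>\<^bsub>Y\<^esub> x \<in> ?N" if x: "x \<in> ?N" for c x
    proof -
      obtain p where "x = \<psi> p" "homogeneous k p" using x by blast
      then show ?thesis using homogeneous_scale[of k p c] \<psi>_scale[of c p] by auto
    qed
  qed auto
  moreover have "{foldr (\<lambda>(i, r) z. yx \<gg> Plus i r \<otimes>\<^bsub>Y\<^esub> z) w \<one>\<^bsub>Y\<^esub> | w. length w = k} \<subseteq> ?N"
  proof (clarify, unfold word_\<psi>)
    fix w :: "('i \<times> nat) list" assume "k = length w"
    then show "\<exists>p. \<psi> (Poly_Mapping.single (Word w) 1) = \<psi> p \<and> homogeneous (length w) p"
      using homogeneous_single[of "Word w" 1] by auto
  qed
  ultimately have "Y_plus_deg \<gg> k \<subseteq> ?N" unfolding Y_plus_deg_def by (intro span_minimal)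
  then show ?thesis using assms that by blast
qed

lemma Y_deg_products_closed:
  "{a \<otimes>\<^bsub>Y\<^esub> b | a b. a \<in> Y_le_zero \<gg> \<and> b \<in> Y_plus_deg \<gg> k} \<subseteq> carrier Y"
  using subspaceD(1)[OF subspace_Y_plus_deg] by (auto simp: Y_le_zero_closed)

lemma subspace_Y_deg: "subspace (Y_deg \<gg> k)"
  unfolding Y_deg_def by (rule subspace_span[OF Y_deg_products_closed])

lemma Y_deg_closed: "y \<in> Y_deg \<gg> k \<Longrightarrow> y \<in> carrier Y"
  by (rule subspaceD(1)[OF subspace_Y_deg])

lemma Y_degI: "a \<in> Y_le_zero \<gg> \<Longrightarrow> b \<in> Y_plus_deg \<gg> k \<Longrightarrow> a \<otimes>\<^bsub>Y\<^esub> b \<in> Y_deg \<gg> k"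
  unfolding Y_deg_def by (rule subsetD[OF span_superset]) blast

lemma Y_deg_subset:
  assumes "subspace N" "\<And>a b. a \<in> Y_le_zero \<gg> \<Longrightarrow> b \<in> Y_plus_deg \<gg> k \<Longrightarrow> a \<otimes>\<^bsub>Y\<^esub> b \<in> N"
  shows "Y_deg \<gg> k \<subseteq> N"
  unfolding Y_deg_def using assms(2) by (intro span_minimal assms(1)) blast

lemma one_in_Y_deg: "\<one>\<^bsub>Y\<^esub> \<in> Y_deg \<gg> 0"
proof -
  have "\<one>\<^bsub>Y\<^esub> \<in> Y_plus_deg \<gg> 0"
    using word_in_Y_plus_deg[of "[]"] by (simp add: word_\<psi>[symmetric])
  from Y_degI[OF Y_le_zero_one this] show ?thesis by simp
qed

lemma component_in_Y_deg:
  assumes "y \<in> carrier Y"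
  shows "component m y \<in> Y_deg \<gg> m"
proof -
  have "y \<in> {y \<in> carrier Y. component m y \<in> Y_deg \<gg> m}"
  proof (rule triple_induct[OF subspace_vimage[OF component_linear subspace_Y_deg] assms])
    show "u \<otimes>\<^bsub>Y\<^esub> v \<otimes>\<^bsub>Y\<^esub> \<psi> p \<in> {y \<in> carrier Y. component m y \<in> Y_deg \<gg> m}"
      if "u \<in> Y_pm \<gg> Minus" "v \<in> Y_zero \<gg>" for u v p
      using that Y_degI[OF Y_minus_zero_le_zero \<psi>_degree_part_in]
      by (simp add: component_mult Y_pm_closed Y_zero_closed)
  qed
  then show ?thesis by blast
qed

text \<open>
  For \<open>a \<in> Y\<^sup>\<le>\<^sup>0\<close> the normal ordering \<open>Y\<^sup>\<le>\<^sup>0 = Y\<^sup>- Y\<^sup>0\<close> reduces the claim about \<open>a b\<close> to products \<open>u v b\<close>.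
\<close>

lemma component_Y_deg:
  assumes "y \<in> Y_deg \<gg> k"
  shows "component m y = (if k = m then y else \<zero>\<^bsub>Y\<^esub>)"
proof -
  let ?f = "\<lambda>y. if k = m then y else \<zero>\<^bsub>Y\<^esub>"
  have f: "linear_map ?f" by (auto simp: linear_map_def)
  let ?E = "{y \<in> carrier Y. component m y = ?f y}"
  have E: "subspace ?E" by (rule subspace_equalizer[OF component_linear f])
  have "Y_deg \<gg> k \<subseteq> ?E"
  proof (rule Y_deg_subset[OF E])
    fix a b assume a: "a \<in> Y_le_zero \<gg>" and "b \<in> Y_plus_deg \<gg> k"
    then obtain p where p: "homogeneous k p" "b = \<psi> p" using Y_plus_degE by blast
    have bc: "b \<in> carrier Y" by (simp add: p)
    show "a \<otimes>\<^bsub>Y\<^esub> b \<in> ?E"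
    proof (rule ordered_nonpos_induct[OF linear_map_mult_right[OF bc] E _ subsetD[OF Y_le_zero_ordered a]])
      show "u \<otimes>\<^bsub>Y\<^esub> v \<otimes>\<^bsub>Y\<^esub> b \<in> ?E" if "u \<in> Y_pm \<gg> Minus" "v \<in> Y_zero \<gg>" for u v
        using that by (simp add: p component_mult degree_part_homogeneous[OF p(1)] \<psi>_zero
            Y_pm_closed Y_zero_closed)
    qed
  qed
  then show ?thesis using assms by blast
qed

text \<open>
  The elements that are the sum of their components form a subspace, and on products \<open>u v w\<close> the
  claim is the decomposition of \<open>w\<close> in \<open>Y\<^sup>+\<close>.
\<close>

lemma sum_components:
  assumes "y \<in> carrier Y"
  shows "\<exists>n. (\<forall>m\<ge>n. component m y = \<zero>\<^bsub>Y\<^esub>) \<and> y = finsum Y (\<lambda>m. component m y) {..<n}"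
proof -
  define P where "P n y \<longleftrightarrow> (\<forall>m\<ge>n. component m y = \<zero>\<^bsub>Y\<^esub>) \<and> y = finsum Y (\<lambda>m. component m y) {..<n}"
    for n y
  have mono: "P n y" if P: "P k y" and le: "k \<le> n" and y: "y \<in> carrier Y" for k n y
  proof -
    have "finsum Y (\<lambda>m. component m y) {..<k} = finsum Y (\<lambda>m. component m y) {..<n}"
      using P le y by (intro finsum_mono_neutral) (auto simp: P_def)
    then show ?thesis using P le by (auto simp: P_def)
  qed
  let ?N = "{y \<in> carrier Y. \<exists>n. P n y}"
  have "subspace ?N"
  proof (rule subspaceI)
    have "P 0 \<zero>\<^bsub>Y\<^esub>" by (simp add: P_def linear_mapD(4)[OF component_linear])
    then show "\<zero>\<^bsub>Y\<^esub> \<in> ?N" by auto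
    show "x \<oplus>\<^bsub>Y\<^esub> y \<in> ?N" if xy: "x \<in> ?N" "y \<in> ?N" for x y
    proof -
      have c: "x \<in> carrier Y" "y \<in> carrier Y" using xy by auto
      obtain k l where "P k x" "P l y" using xy by blast
      then have P: "P (max k l) x" "P (max k l) y" using mono c by (meson max.cobounded1 max.cobounded2)+
      have "finsum Y (\<lambda>m. component m (x \<oplus>\<^bsub>Y\<^esub> y)) {..<max k l} =
          finsum Y (\<lambda>m. component m x \<oplus>\<^bsub>Y\<^esub> component m y) {..<max k l}"
        using c by (intro finsum_cong') (auto simp: linear_mapD(2)[OF component_linear])
      also have "\<dots> = finsum Y (\<lambda>m. component m x) {..<max k l} \<oplus>\<^bsub>Y\<^esub> finsum Y (\<lambda>m. component m y) {..<max k l}"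
        using c by (intro finsum_addf) auto
      also have "\<dots> = x \<oplus>\<^bsub>Y\<^esub> y" using P unfolding P_def by metis
      finally have "P (max k l) (x \<oplus>\<^bsub>Y\<^esub> y)"
        using P c unfolding P_def by (simp add: linear_mapD(2)[OF component_linear])
      then show ?thesis using c by blast
    qed
    show "c \<odot>\<^bsub>Y\<^esub> x \<in> ?N" if x: "x \<in> ?N" for c x
    proof -
      have xc: "x \<in> carrier Y" using x by auto
      obtain k where P: "P k x" using x by blast
      have "finsum Y (\<lambda>m. component m (c \<odot>\<^bsub>Y\<^esub> x)) {..<k} = finsum Y (\<lambda>m. c \<odot>\<^bsub>Y\<^esub> component m x) {..<k}"
        using xc by (intro finsum_cong') (auto simp: linear_mapD(3)[OF component_linear])
      also have "\<dots> = c \<odot>\<^bsub>Y\<^esub> finsum Y (\<lambda>m. component m x) {..<k}"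
        using xc by (intro finsum_smult_ldistr[symmetric]) auto
      also have "\<dots> = c \<odot>\<^bsub>Y\<^esub> x" using P unfolding P_def by metis
      finally have "P k (c \<odot>\<^bsub>Y\<^esub> x)"
        using P xc unfolding P_def by (simp add: linear_mapD(3)[OF component_linear])
      then show ?thesis using xc by blast
    qed
  qed auto
  moreover have "u \<otimes>\<^bsub>Y\<^esub> v \<otimes>\<^bsub>Y\<^esub> \<psi> p \<in> ?N" if uv: "u \<in> Y_pm \<gg> Minus" "v \<in> Y_zero \<gg>" for u v p
  proof -
    have c: "u \<otimes>\<^bsub>Y\<^esub> v \<in> carrier Y" using uv by (simp add: Y_pm_closed Y_zero_closed)
    obtain n where n: "\<forall>m\<ge>n. degree_part m p = 0" using degree_part_bounded by blast
    have "u \<otimes>\<^bsub>Y\<^esub> v \<otimes>\<^bsub>Y\<^esub> \<psi> p = u \<otimes>\<^bsub>Y\<^esub> v \<otimes>\<^bsub>Y\<^esub> \<psi> (\<Sum>m<n. degree_part m p)"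
      using sum_degree_parts[OF n] by simp
    also have "\<dots> = u \<otimes>\<^bsub>Y\<^esub> v \<otimes>\<^bsub>Y\<^esub> finsum Y (\<lambda>m. \<psi> (degree_part m p)) {..<n}" by (simp add: \<psi>_sum)
    also have "\<dots> = finsum Y (\<lambda>m. u \<otimes>\<^bsub>Y\<^esub> v \<otimes>\<^bsub>Y\<^esub> \<psi> (degree_part m p)) {..<n}"
      by (rule linear_map_finsum[OF linear_map_mult_left[OF c]]) simp
    also have "\<dots> = finsum Y (\<lambda>m. component m (u \<otimes>\<^bsub>Y\<^esub> v \<otimes>\<^bsub>Y\<^esub> \<psi> p)) {..<n}"
      using component_mult[OF uv] by simp
    finally have "u \<otimes>\<^bsub>Y\<^esub> v \<otimes>\<^bsub>Y\<^esub> \<psi> p = finsum Y (\<lambda>m. component m (u \<otimes>\<^bsub>Y\<^esub> v \<otimes>\<^bsub>Y\<^esub> \<psi> p)) {..<n}" .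
    moreover have "\<forall>m\<ge>n. component m (u \<otimes>\<^bsub>Y\<^esub> v \<otimes>\<^bsub>Y\<^esub> \<psi> p) = \<zero>\<^bsub>Y\<^esub>"
      using n c component_mult[OF uv] by (simp add: \<psi>_zero)
    ultimately have "P n (u \<otimes>\<^bsub>Y\<^esub> v \<otimes>\<^bsub>Y\<^esub> \<psi> p)" by (simp only: P_def)
    then show ?thesis using c by auto
  qed
  ultimately have "y \<in> ?N" by (intro triple_induct[OF _ assms])
  then show ?thesis by (auto simp: P_def)
qed

text \<open>
  The projections show both that an expansion into homogeneous components exists and that it is
  unique, so they compute the definite description.
\<close>

lemma Y_component_eq:
  assumes y: "y \<in> carrier Y"
  shows "Y_component \<gg> m y = component m y"
proof -
  let ?P = "\<lambda>f. (\<forall>k. f k \<in> Y_deg \<gg> k) \<and> finite {k. f k \<noteq> \<zero>\<^bsub>Y\<^esub>} \<and> y = finsum Y f {k. f k \<noteq> \<zero>\<^bsub>Y\<^esub>}"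
  have "(THE f. ?P f) = (\<lambda>m. component m y)"
  proof (rule the_equality)
    obtain n where n: "\<forall>m\<ge>n. component m y = \<zero>\<^bsub>Y\<^esub>" "y = finsum Y (\<lambda>m. component m y) {..<n}"
      using sum_components[OF y] by blast
    have sub: "{k. component k y \<noteq> \<zero>\<^bsub>Y\<^esub>} \<subseteq> {..<n}" 
    proof
      show "k \<in> {..<n}" if "k \<in> {k. component k y \<noteq> \<zero>\<^bsub>Y\<^esub>}" for k
        using n(1) that by (cases "k < n") auto
    qed
    have "finsum Y (\<lambda>m. component m y) {k. component k y \<noteq> \<zero>\<^bsub>Y\<^esub>} = finsum Y (\<lambda>m. component m y) {..<n}"
      using sub y by (intro finsum_mono_neutral) auto
    then show "?P (\<lambda>m. component m y)"
      using n(2) component_in_Y_deg[OF y] finite_subset[OF sub finite_lessThan] by simp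
    fix f assume f: "?P f"
    have fc: "f k \<in> carrier Y" for k using f Y_deg_closed by blast
    show "f = (\<lambda>m. component m y)"
    proof
      fix m
      let ?K = "{k. f k \<noteq> \<zero>\<^bsub>Y\<^esub>}"
      have "component m y = component m (finsum Y f ?K)" using f by simp
      also have "\<dots> = finsum Y (\<lambda>k. component m (f k)) ?K"
        using fc by (intro linear_map_finsum component_linear)
      also have "\<dots> = finsum Y (\<lambda>k. if m = k then f k else \<zero>\<^bsub>Y\<^esub>) ?K"
        using f fc component_Y_deg[of "f k" k m for k] by (intro finsum_cong') (simp_all add: Pi_iff)
      also have "\<dots> = f m"
      proof (cases "m \<in> ?K")
        case True
        then show ?thesis using f fc by (intro finsum_singleton) auto
      next
        case False
        then have "finsum Y (\<lambda>k. if m = k then f k else \<zero>\<^bsub>Y\<^esub>) ?K \<in> {\<zero>\<^bsub>Y\<^esub>}"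
          by (intro subspace_finsum[OF subspace_zero]) auto
        then show ?thesis using False by simp
      qed
      finally show "f m = component m y" by simp
    qed
  qed
  then show ?thesis unfolding Y_component_def by simp
qed

text \<open>
  An element of the \<open>n\<close>-th left ideal is a combination of products \<open>u v w\<close> in which \<open>w\<close> has no
  components of degree below \<open>n\<close>, since right multiplication by \<open>x\<^sup>+\<^sub>j\<^sub>s\<close> raises all degrees of \<open>w\<close>
  by one.
\<close>

lemma component_pos_ideal:
  assumes "z \<in> pos_ideal n" "i < n"
  shows "component i z = \<zero>\<^bsub>Y\<^esub>"
proof -
  let ?S = "\<lambda>n. {u \<otimes>\<^bsub>Y\<^esub> v \<otimes>\<^bsub>Y\<^esub> \<psi> p | u v p. u \<in> Y_pm \<gg> Minus \<and> v \<in> Y_zero \<gg> \<and> (\<forall>i<n. degree_part i p = 0)}"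
  have sub: "pos_ideal n \<subseteq> linear_span Y (?S n)" for n
  proof (induction n)
    case 0
    then show ?case using carrier_triples by simp
  next
    case (Suc n)
    have N: "subspace (linear_span Y (?S (Suc n)))" by (rule subspace_span[OF triple_products_closed])
    have step: "z \<otimes>\<^bsub>Y\<^esub> yx \<gg> Plus j s \<in> linear_span Y (?S (Suc n))" if z: "z \<in> pos_ideal n" for z j s
    proof (rule span_in_vimage[OF linear_map_mult_right N triple_products_closed _ subsetD[OF Suc z]])
      fix x assume "x \<in> ?S n"
      then obtain u v p where x: "x = u \<otimes>\<^bsub>Y\<^esub> v \<otimes>\<^bsub>Y\<^esub> \<psi> p" "u \<in> Y_pm \<gg> Minus" "v \<in> Y_zero \<gg>"
        and p: "\<forall>i<n. degree_part i p = 0" by blast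
      have g: "degree_part l (gen (j, s)) = (if l = 1 then gen (j, s) else 0)" for l
        by (simp add: degree_part_homogeneous[OF homogeneous_gen])
      have "degree_part i (p * gen (j, s)) = 0" if "i < Suc n" for i
        unfolding degree_part_mult using p that by (intro sum.neutral) (auto simp: g)
      moreover have "x \<otimes>\<^bsub>Y\<^esub> yx \<gg> Plus j s = u \<otimes>\<^bsub>Y\<^esub> v \<otimes>\<^bsub>Y\<^esub> \<psi> (p * gen (j, s))"
        using x by (simp add: \<psi>_mult \<psi>_gen m_assoc Y_pm_closed Y_zero_closed)
      ultimately have "x \<otimes>\<^bsub>Y\<^esub> yx \<gg> Plus j s \<in> ?S (Suc n)" using x by blast
      then show "x \<otimes>\<^bsub>Y\<^esub> yx \<gg> Plus j s \<in> linear_span Y (?S (Suc n))" by (rule subsetD[OF span_superset])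
    qed auto
    show ?case
      using pos_ideal_Suc_induct[OF linear_map_id N step] by (rule subsetI)
  qed
  have "component i z \<in> {\<zero>\<^bsub>Y\<^esub>}"
  proof (rule span_in_vimage[OF component_linear subspace_zero triple_products_closed _ subsetD[OF sub assms(1)]])
    fix x assume "x \<in> ?S n"
    then obtain u v p where x: "x = u \<otimes>\<^bsub>Y\<^esub> v \<otimes>\<^bsub>Y\<^esub> \<psi> p" "u \<in> Y_pm \<gg> Minus" "v \<in> Y_zero \<gg>"
      and p: "\<forall>i<n. degree_part i p = 0" by blast
    show "component i x \<in> {\<zero>\<^bsub>Y\<^esub>}"
      using x p assms(2) by (simp add: component_mult \<psi>_zero Y_pm_closed Y_zero_closed)
  qed
  then show ?thesis by simp
qed

lemma Y_deg_pos_ideal: "Y_deg \<gg> k \<subseteq> pos_ideal k"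
proof (rule Y_deg_subset[OF subspace_pos_ideal])
  have word: "\<psi> (Poly_Mapping.single (Word w) 1) \<in> pos_ideal (length w)" for w
  proof (induction w rule: rev_induct)
    case (snoc a w)
    have "Poly_Mapping.single (Word (w @ [a])) 1 =
        (Poly_Mapping.single (Word w) 1 :: ('i \<times> nat) free_alg) * gen a"
      by (simp add: gen_def mult_single plus_word_def)
    then show ?case using pos_ideal_SucI[OF snoc] by (cases a) (simp add: \<psi>_mult \<psi>_gen del: pos_ideal.simps)
  qed simp
  fix a b assume a: "a \<in> Y_le_zero \<gg>" and b: "b \<in> Y_plus_deg \<gg> k"
  have "Y_plus_deg \<gg> k \<subseteq> pos_ideal k"
    unfolding Y_plus_deg_def
  proof (rule span_minimal[OF _ subspace_pos_ideal], clarify, unfold word_\<psi>)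
    show "\<psi> (Poly_Mapping.single (Word w) 1) \<in> pos_ideal (length w)" for w by (rule word)
  qed
  then show "a \<otimes>\<^bsub>Y\<^esub> b \<in> pos_ideal k" using a b by (blast intro: pos_ideal_left_ideal Y_le_zero_closed)
qed

text \<open>
  The filtration by left ideals consists of the tails of the decomposition.  An element without
  components of small degree is the sum of the remaining ones, and \<open>Y[k]\<close> is contained in the
  \<open>k\<close>-th left ideal.
\<close>

lemma pos_ideal_iff: "z \<in> pos_ideal n \<longleftrightarrow> z \<in> carrier Y \<and> (\<forall>i<n. component i z = \<zero>\<^bsub>Y\<^esub>)"
proof
  assume "z \<in> pos_ideal n"
  then show "z \<in> carrier Y \<and> (\<forall>i<n. component i z = \<zero>\<^bsub>Y\<^esub>)"
    using component_pos_ideal pos_idealD(1) by blast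
next
  assume z: "z \<in> carrier Y \<and> (\<forall>i<n. component i z = \<zero>\<^bsub>Y\<^esub>)"
  obtain k where "z = finsum Y (\<lambda>m. component m z) {..<k}" using sum_components z by blast
  moreover have "component m z \<in> pos_ideal n" for m
  proof (cases "m < n")
    case True
    then show ?thesis using z pos_idealD(2) by simp
  next
    case False
    then show ?thesis
      using component_in_Y_deg[of z m] z Y_deg_pos_ideal pos_ideal_antimono[of n m] by (meson not_less subsetD)
  qed
  ultimately show "z \<in> pos_ideal n" by (metis subspace_finsum[OF subspace_pos_ideal])
qed

lemma decomposed_algebra_Y: "decomposed_algebra Y (Y_deg \<gg>) (Y_component \<gg>)"
proof (intro decomposed_algebra.intro decomposed_algebra_axioms.intro)
  show "complex_algebra Y" by (rule complex_algebra_axioms)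
  show "subspace (Y_deg \<gg> k)" for k by (rule subspace_Y_deg)
  show "\<one>\<^bsub>Y\<^esub> \<in> Y_deg \<gg> 0" by (rule one_in_Y_deg)
  show "Y_component \<gg> m y \<in> Y_deg \<gg> m" if "y \<in> carrier Y" for m y
    using that component_in_Y_deg by (simp add: Y_component_eq)
  show "linear_map (Y_component \<gg> m)" for m
    using component_linear[of m] by (auto simp: linear_map_def Y_component_eq)
  show "Y_component \<gg> m y = (if k = m then y else \<zero>\<^bsub>Y\<^esub>)" if "y \<in> Y_deg \<gg> k" for m y k
    using component_Y_deg[OF that] Y_component_eq[OF Y_deg_closed[OF that]] by simp
  show "Y_component \<gg> i (y \<otimes>\<^bsub>Y\<^esub> z) = \<zero>\<^bsub>Y\<^esub>"
    if "y \<in> carrier Y" "z \<in> carrier Y" "\<And>i. i < n \<Longrightarrow> Y_component \<gg> i z = \<zero>\<^bsub>Y\<^esub>" "i < n" for y z n i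
  proof -
    have "z \<in> pos_ideal n" using that(2,3) by (simp add: pos_ideal_iff Y_component_eq)
    then have "y \<otimes>\<^bsub>Y\<^esub> z \<in> pos_ideal n" by (rule pos_ideal_left_ideal[OF that(1)])
    then show ?thesis using that by (simp add: pos_ideal_iff Y_component_eq)
  qed
  show "\<exists>n. \<forall>z\<in>carrier Y. (\<forall>i<n. Y_component \<gg> i z = \<zero>\<^bsub>Y\<^esub>) \<longrightarrow>
      (\<forall>i<m. Y_component \<gg> i (z \<otimes>\<^bsub>Y\<^esub> y) = \<zero>\<^bsub>Y\<^esub>)" if y: "y \<in> carrier Y" for y m
  proof -
    obtain n where "\<forall>z\<in>pos_ideal n. z \<otimes>\<^bsub>Y\<^esub> y \<in> pos_ideal m"
      using pos_ideal_right_continuous[OF y] by blast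
    then show ?thesis using y by (intro exI[of _ n]) (simp add: pos_ideal_iff Y_component_eq)
  qed
qed

end

section \<open>The completed Yangian\<close>

theorem proposition5p13:
  fixes \<gg> :: "('i::finite, 'h::ab_group_add) cartan_datum"
  assumes "symmetrizable_kac_moody \<gg>"
    and "\<not> has_A1_1_component \<gg>"
    and "yangian_triangular \<gg>"
    and "yangian_halves_presented \<gg>"
  shows "(\<forall>P\<in>carrier (Y_hat \<gg>). \<forall>Q\<in>carrier (Y_hat \<gg>). \<forall>m.
            finite {(k, l). Y_component \<gg> m (P k \<otimes>\<^bsub>yangian \<gg>\<^esub> Q l) \<noteq> \<zero>\<^bsub>yangian \<gg>\<^esub>})
         \<and> complex_algebra (Y_hat \<gg>)"
proof -
  interpret yangian_algebra \<gg> .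
  obtain \<phi> where \<phi>: "bij_betw \<phi> (tensor3 (yangian \<gg>) (Y_pm \<gg> Minus) (Y_zero \<gg>) (Y_pm \<gg> Plus)) (carrier (yangian \<gg>))"
    "\<forall>p\<in>free_triples (Y_pm \<gg> Minus) (Y_zero \<gg>) (Y_pm \<gg> Plus).
      \<phi> (tensor_rel (yangian \<gg>) (Y_pm \<gg> Minus) (Y_zero \<gg>) (Y_pm \<gg> Plus) `` {p}) = triple_mult (yangian \<gg>) p"
    using assms(3) unfolding yangian_triangular_def Let_def by blast
  show ?thesis
  proof (rule half_parametrization[OF assms(4), of Plus])
    fix \<psi> :: "('i \<times> nat) free_alg \<Rightarrow> ('i, 'h) yangian_elem"
    assume \<psi>: "range \<psi> = Y_pm \<gg> Plus"
      "\<And>p q. \<psi> (p + q) = \<psi> p \<oplus>\<^bsub>yangian \<gg>\<^esub> \<psi> q" "\<And>p q. \<psi> (p * q) = \<psi> p \<otimes>\<^bsub>yangian \<gg>\<^esub> \<psi> q"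
      "\<And>c p. \<psi> (c \<cdot>\<^sub>C p) = c \<odot>\<^bsub>yangian \<gg>\<^esub> \<psi> p" "\<psi> 1 = \<one>\<^bsub>yangian \<gg>\<^esub>"
      "\<And>i r. \<psi> (gen (i, r)) = yx \<gg> Plus i r"
      "\<And>p q m. \<psi> p = \<psi> q \<Longrightarrow> \<psi> (degree_part m p) = \<psi> (degree_part m q)"
    interpret decomposed_yangian \<gg> \<psi> \<phi>
      proof
      show "bij_betw \<phi> (tensor3 (yangian \<gg>) (Y_pm \<gg> Minus) (Y_zero \<gg>) (Y_pm \<gg> Plus)) (carrier (yangian \<gg>))"
        by (rule \<phi>(1))
      show "\<phi> (tensor_rel (yangian \<gg>) (Y_pm \<gg> Minus) (Y_zero \<gg>) (Y_pm \<gg> Plus) `` {t}) =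
          triple_mult (yangian \<gg>) t" if "t \<in> free_triples (Y_pm \<gg> Minus) (Y_zero \<gg>) (Y_pm \<gg> Plus)" for t
        using \<phi>(2) that by (rule bspec)
    qed (rule \<psi>; assumption?)+
    interpret D: decomposed_algebra "yangian \<gg>" "Y_deg \<gg>" "Y_component \<gg>"
      by (rule decomposed_algebra_Y)
    have "D.hat_mult = Y_hat_mult \<gg>"
      by (simp add: fun_eq_iff D.hat_mult_def Y_hat_mult_def)
    then have "D.hat = Y_hat \<gg>" by (simp add: D.hat_def Y_hat_def)
    then show ?thesis using D.finite_product_support D.complex_algebra_hat by simp
  qed
qed

end
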